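(* (Brunn-Minkowski inequality) Let $K\in\mathbb R$, $N\in[1,\infty]$ and let $(X,d,\nu)$ be a weak $\mathrm{CD}(K,N)$ space. For nonempty compact subsets $A_0,A_1\subset\mathrm{supp}\,\nu$ and $t\in(0,1)$, let $[A_0,A_1]_t$ be the set of $t$-barycenters of $A_0$ and $A_1$, i.e. the set of $y\in X$ that can be written as $\gamma(t)$ with $\gamma:[0,1]\to X$ a minimal constant-speed geodesic with $\gamma(0)\in A_0$ and $\gamma(1)\in A_1$. (i) If $N<\infty$, then $$\nu\big[[A_0,A_1]_t\big]^{\frac1N}\ge(1-t)\Big[\inf_{(x,y)\in A_0\times A_1}\beta^{(K,N)}_{1-t}(x,y)^{\frac1N}\Big]\nu[A_0]^{\frac1N}+t\Big[\inf_{(x,y)\in A_0\times A_1}\beta^{(K,N)}_{t}(x,y)^{\frac1N}\Big]\nu[A_1]^{\frac1N}.$$ Moreover, if $K\ge0$ (and $N<\infty$), then $\nu[[A_0,A_1]_t]^{\frac1N}\ge(1-t)\nu[A_0]^{\frac1N}+t\,\nu[A_1]^{\frac1N}$. (ii) If $N=\infty$, then $$\log\frac1{\nu[[A_0,A_1]_t]}\le(1-t)\log\frac1{\nu[A_0]}+t\log\frac1{\nu[A_1]}+\frac{t(1-t)}2\Big[K_-\max_{(x,y)\in A_0\times A_1}d(x,y)^2-K_+\min_{(x,y)\in A_0\times A_1}d(x,y)^2\Big],$$ where $K_+=\max\{K,0\}$ and $K_-=-\min\{K,0\}$.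
   Context: Spaces. An irreversible metric on $X$ is $d:X\times X\to[0,\infty)$ with $d(x,y)=0$ iff $x=y$ and the triangle inequality (no symmetry). Topology: generated by forward balls $B^+_x(r)=\{y:d(x,y)<r\}$. $\lambda_d(A)=\inf\{\lambda\ge1:d(x,y)\le\lambda d(y,x)\ \forall x,y\in A\}$. $(X,d)$ is a forward metric space if for some point $\star$ and some nondecreasing $\Theta:[0,\infty)\to[1,\infty)$ one has $\lambda_d(\overline{B^+_\star(r)})\le\Theta(r)$ for all $r>0$. It is forward boundedly compact if all closed forward balls are compact. It is a forward geodesic space if any $x,y$ are joined by a constant-speed minimal geodesic, i.e. continuous $\gamma:[0,1]\to X$ from $x$ to $y$ with $d(\gamma(s),\gamma(t))=(t-s)d(x,y)$ for $0\le s\le t\le1$; $\Gamma(X)$ is the set of these curves. "-measure space" means equipped with a nonnegative locally finite Borel measure. Optimal transport. $e_t(\gamma)=\gamma(t)$. An optimal transference plan from $\mu_0$ to $\mu_1$ (w.r.t. $d^2$) is a coupling $\pi$ of $(\mu_0,\mu_1)$ minimizing $\int d(x,y)^2d\pi(x,y)$. A dynamical optimal transference plan is a probability measure $\Pi$ on $\Gamma(X)$ with $(e_0,e_1)_\sharp\Pi$ optimal; $\mu_t=(e_t)_\sharp\Pi$ is a displacement interpolation, associated with $\pi=(e_0,e_1)_\sharp\Pi$. Functionals. For $N\in[1,\infty]$, $DC_N$ is the set of continuous convex $U:[0,\infty)\to\mathbb R$, $C^2$ on $(0,\infty)$, $U(0)=0$, such that with $p(r)=rU'(r)-U(r)$ the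 function $r\mapsto p(r)/r^{1-1/N}$ is nondecreasing. Put $U'(\infty)=\lim_{r\to\infty}U(r)/r$. For compactly supported $\mu=\rho\nu+\mu_s$ (Lebesgue decomposition w.r.t. $\nu$), $U_\nu(\mu)=\int_XU(\rho)\,d\nu+U'(\infty)\mu_s[X]$, and for measurable $\beta:X\times X\to(0,\infty]$ and $\pi\in P(X\times X)$ with first marginal $\mu$, disintegrated as $\pi(dx\,dy)=\mu(dx)\pi(dy|x)$, $$U^\beta_{\pi,\nu}(\mu)=\int_{X\times X}U\Big(\frac{\rho(x)}{\beta(x,y)}\Big)\beta(x,y)\,\pi(dy|x)\,\nu(dx)+U'(\infty)\mu_s[X],$$ with the conventions $U(0)/0=U'(0)$, $U(\infty)/\infty=U'(\infty)$. Coefficients. $\mathfrak s_{K,N}(r)=\sqrt{\tfrac{N-1}{K}}\sin\big(r\sqrt{\tfrac{K}{N-1}}\big)$ if $K>0$, $r$ if $K=0$, $\sqrt{\tfrac{N-1}{-K}}\sinh\big(r\sqrt{\tfrac{-K}{N-1}}\big)$ if $K<0$. For $N\in(1,\infty)$, $t\in(0,1]$: $\beta^{(K,N)}_t(x,y)=\infty$ if $K>0$ and $d(x,y)\ge\pi\sqrt{(N-1)/K}$, and otherwise $\beta^{(K,N)}_t(x,y)=\big(\frac{\mathfrak s_{K,N}(t\,d(x,y))}{t\,\mathfrak s_{K,N}(d(x,y))}\big)^{N-1}$ (equal to $1$ if $x=y$); $\beta^{(K,N)}_0=1$. $\beta^{(K,1)}_t=\lim_{N\downarrow1}\beta^{(K,N)}_t$,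 $\beta^{(K,\infty)}_t=\lim_{N\uparrow\infty}\beta^{(K,N)}_t$ (so $\beta^{(K,\infty)}_t=e^{\frac K6(1-t^2)d(x,y)^2}$ for $t\in(0,1]$). In products, $\infty\cdot0=0$. $\breve\beta(x,y)=\beta(y,x)$ and $\breve\pi$ is the image of $\pi$ under $(x,y)\mapsto(y,x)$. If $N=1$, or if $K>0$, $N\in(1,\infty)$ and $\sup_{x,y}d(x,y)=\pi\sqrt{(N-1)/K}$, then $U^{\beta^{(K,N)}_t}_{\pi,\nu}$ and $U^{\breve\beta^{(K,N)}_t}_{\breve\pi,\nu}$ are defined as the limits as $N'\downarrow N$ of the same expressions with $N'$. Weak $\mathrm{CD}(K,N)$. A forward boundedly compact, $\sigma$-finite forward geodesic-measure space $(X,d,\nu)$ is a weak $\mathrm{CD}(K,N)$ space if for any two compactly supported probability measures $\mu_0,\mu_1$ with $\mathrm{supp}\,\mu_i\subset\mathrm{supp}\,\nu$ there are a displacement interpolation $(\mu_t)_{0\le t\le1}$ and an associated optimal transference plan $\pi$ from $\mu_0$ to $\mu_1$ such that for all $U\in DC_N$ and $t\in[0,1]$: $U_\nu(\mu_t)\le(1-t)\,U^{\beta^{(K,N)}_{1-t}}_{\pi,\nu}(\mu_0)+t\,U^{\breve\beta^{(K,N)}_t}_{\breve\pi,\nu}(\mu_1)$. *)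

theory Defs
  imports "HOL-Probability.Probability"
begin

section \<open>Irreversible metrics and forward geodesic spaces\<close>

text \<open>
  The space \<open>X\<close> is a type \<open>'a\<close>; its topology and Borel sets come from the distance function
  \<open>d\<close>, not from a type class.
\<close>

definition irreversible_metric :: "('a \<Rightarrow> 'a \<Rightarrow> real) \<Rightarrow> bool" where
  "irreversible_metric d \<longleftrightarrow>
     (\<forall>x y. 0 \<le> d x y) \<and> (\<forall>x y. d x y = 0 \<longleftrightarrow> x = y) \<and> (\<forall>x y z. d x z \<le> d x y + d y z)"

definition forward_topology_on :: "'a set \<Rightarrow> ('a \<Rightarrow> 'a \<Rightarrow> real) \<Rightarrow> 'a topology" where
  "forward_topology_on S d = topology_generated_by {{y \<in> S. d x y < r} | x r. x \<in> S \<and> 0 < r}"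

abbreviation forward_topology :: "('a \<Rightarrow> 'a \<Rightarrow> real) \<Rightarrow> 'a topology" where
  "forward_topology d \<equiv> forward_topology_on UNIV d"

definition forward_ball :: "('a \<Rightarrow> 'a \<Rightarrow> real) \<Rightarrow> 'a \<Rightarrow> real \<Rightarrow> 'a set" where
  "forward_ball d x r = {y. d x y < r}"

definition closed_forward_ball :: "('a \<Rightarrow> 'a \<Rightarrow> real) \<Rightarrow> 'a \<Rightarrow> real \<Rightarrow> 'a set" where
  "closed_forward_ball d x r = forward_topology d closure_of forward_ball d x r"

text \<open>The reversibility constant is \<open>\<infinity>\<close> if no admissible constant exists.\<close>

definition reversibility :: "('a \<Rightarrow> 'a \<Rightarrow> real) \<Rightarrow> 'a set \<Rightarrow> ereal" where
  "reversibility d A = (INF l\<in>{l::real. 1 \<le> l \<and> (\<forall>x\<in>A. \<forall>y\<in>A. d x y \<le> l * d y x)}. ereal l)"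

definition forward_metric_space :: "('a \<Rightarrow> 'a \<Rightarrow> real) \<Rightarrow> bool" where
  "forward_metric_space d \<longleftrightarrow> irreversible_metric d \<and>
     (\<exists>p (\<Theta> :: real \<Rightarrow> real). mono_on {0..} \<Theta> \<and> (\<forall>r\<ge>0. 1 \<le> \<Theta> r) \<and>
        (\<forall>r>0. reversibility d (closed_forward_ball d p r) \<le> ereal (\<Theta> r)))"

definition forward_boundedly_compact :: "('a \<Rightarrow> 'a \<Rightarrow> real) \<Rightarrow> bool" where
  "forward_boundedly_compact d \<longleftrightarrow>
     (\<forall>x. \<forall>r>0. compactin (forward_topology d) (closed_forward_ball d x r))"

text \<open>
  The set \<open>\<Gamma>(X)\<close>. Curves are functions on \<open>[0,1]\<close>, hence taken to be extensional, so that a curve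
  is determined by its values on \<open>[0,1]\<close>.
\<close>

definition geodesics :: "('a \<Rightarrow> 'a \<Rightarrow> real) \<Rightarrow> (real \<Rightarrow> 'a) set" where
  "geodesics d = {\<gamma> \<in> extensional {0..1}.
     continuous_map (top_of_set {0..1}) (forward_topology d) \<gamma> \<and>
     (\<forall>s t. 0 \<le> s \<and> s \<le> t \<and> t \<le> 1 \<longrightarrow> d (\<gamma> s) (\<gamma> t) = (t - s) * d (\<gamma> 0) (\<gamma> 1))}"

definition forward_geodesic_space :: "('a \<Rightarrow> 'a \<Rightarrow> real) \<Rightarrow> bool" where
  "forward_geodesic_space d \<longleftrightarrow>
     forward_metric_space d \<and> (\<forall>x y. \<exists>\<gamma>\<in>geodesics d. \<gamma> 0 = x \<and> \<gamma> 1 = y)"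

definition barycenters :: "('a \<Rightarrow> 'a \<Rightarrow> real) \<Rightarrow> 'a set \<Rightarrow> 'a set \<Rightarrow> real \<Rightarrow> 'a set" where
  "barycenters d A B t = {\<gamma> t | \<gamma>. \<gamma> \<in> geodesics d \<and> \<gamma> 0 \<in> A \<and> \<gamma> 1 \<in> B}"


section \<open>Borel measures\<close>

definition borel_of :: "'a topology \<Rightarrow> 'a measure" where
  "borel_of T = sigma (topspace T) {U. openin T U}"

abbreviation fborel :: "('a \<Rightarrow> 'a \<Rightarrow> real) \<Rightarrow> 'a measure" where
  "fborel d \<equiv> borel_of (forward_topology d)"

definition locally_finite_measure :: "'a topology \<Rightarrow> 'a measure \<Rightarrow> bool" where
  "locally_finite_measure T \<nu> \<longleftrightarrow>
     (\<forall>x\<in>topspace T. \<exists>U. openin T U \<and> x \<in> U \<and> emeasure \<nu> U < \<infinity>)"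

definition msupport :: "'a topology \<Rightarrow> 'a measure \<Rightarrow> 'a set" where
  "msupport T \<mu> = {x \<in> topspace T. \<forall>U. openin T U \<and> x \<in> U \<longrightarrow> 0 < emeasure \<mu> U}"

text \<open>\<open>\<mu> = \<rho> \<nu> + \<mu>\<^sub>s\<close> with \<open>\<mu>\<^sub>s\<close> singular to \<open>\<nu>\<close>.\<close>

definition is_lebesgue_decomposition ::
    "'a measure \<Rightarrow> 'a measure \<Rightarrow> ('a \<Rightarrow> real) \<Rightarrow> 'a measure \<Rightarrow> bool" where
  "is_lebesgue_decomposition \<nu> \<mu> \<rho> \<mu>\<^sub>s \<longleftrightarrow>
     \<rho> \<in> borel_measurable \<nu> \<and> (\<forall>x. 0 \<le> \<rho> x) \<and> sets \<mu>\<^sub>s = sets \<nu> \<and>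
     (\<exists>S\<in>null_sets \<nu>. emeasure \<mu>\<^sub>s (space \<nu> - S) = 0) \<and>
     (\<forall>A\<in>sets \<nu>. emeasure \<mu> A = (\<integral>\<^sup>+x\<in>A. ennreal (\<rho> x) \<partial>\<nu>) + emeasure \<mu>\<^sub>s A)"

text \<open>The decomposition is unique up to \<open>\<nu>\<close>-null changes of the density.\<close>

definition lebesgue_decomposition ::
    "'a measure \<Rightarrow> 'a measure \<Rightarrow> ('a \<Rightarrow> real) \<times> 'a measure" where
  "lebesgue_decomposition \<nu> \<mu> = (SOME (\<rho>, \<mu>\<^sub>s). is_lebesgue_decomposition \<nu> \<mu> \<rho> \<mu>\<^sub>s)"

definition ac_density :: "'a measure \<Rightarrow> 'a measure \<Rightarrow> 'a \<Rightarrow> real" where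
  "ac_density \<nu> \<mu> = fst (lebesgue_decomposition \<nu> \<mu>)"

definition singular_part :: "'a measure \<Rightarrow> 'a measure \<Rightarrow> 'a measure" where
  "singular_part \<nu> \<mu> = snd (lebesgue_decomposition \<nu> \<mu>)"

text \<open>\<open>\<pi>(dx dy) = \<mu>(dx) \<kappa>(dy|x)\<close>; in particular \<open>\<mu>\<close> is the first marginal of \<open>\<pi>\<close>.\<close>

definition disintegrates ::
    "'a measure \<Rightarrow> ('a \<times> 'a) measure \<Rightarrow> 'a measure \<Rightarrow> ('a \<Rightarrow> 'a measure) \<Rightarrow> bool" where
  "disintegrates B \<pi> \<mu> \<kappa> \<longleftrightarrow> \<kappa> \<in> B \<rightarrow>\<^sub>M prob_algebra B \<and>
     (\<forall>A\<in>sets (B \<Otimes>\<^sub>M B). emeasure \<pi> A = (\<integral>\<^sup>+x. emeasure (\<kappa> x) {y \<in> space B. (x, y) \<in> A} \<partial>\<mu>))"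


section \<open>Optimal transport\<close>

definition is_coupling ::
    "'a measure \<Rightarrow> 'a measure \<Rightarrow> 'a measure \<Rightarrow> ('a \<times> 'a) measure \<Rightarrow> bool" where
  "is_coupling B \<mu>\<^sub>0 \<mu>\<^sub>1 \<pi> \<longleftrightarrow> prob_space \<pi> \<and> sets \<pi> = sets (B \<Otimes>\<^sub>M B) \<and>
     distr \<pi> B fst = \<mu>\<^sub>0 \<and> distr \<pi> B snd = \<mu>\<^sub>1"

definition transport_cost :: "('a \<Rightarrow> 'a \<Rightarrow> real) \<Rightarrow> ('a \<times> 'a) measure \<Rightarrow> ennreal" where
  "transport_cost d \<pi> = (\<integral>\<^sup>+(x, y). ennreal ((d x y)\<^sup>2) \<partial>\<pi>)"

definition optimal_plan ::
    "('a \<Rightarrow> 'a \<Rightarrow> real) \<Rightarrow> 'a measure \<Rightarrow> 'a measure \<Rightarrow> ('a \<times> 'a) measure \<Rightarrow> bool" where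
  "optimal_plan d \<mu>\<^sub>0 \<mu>\<^sub>1 \<pi> \<longleftrightarrow> is_coupling (fborel d) \<mu>\<^sub>0 \<mu>\<^sub>1 \<pi> \<and>
     (\<forall>\<pi>'. is_coupling (fborel d) \<mu>\<^sub>0 \<mu>\<^sub>1 \<pi>' \<longrightarrow> transport_cost d \<pi> \<le> transport_cost d \<pi>')"

text \<open>\<open>\<Gamma>(X)\<close> carries the topology of uniform convergence.\<close>

definition curve_dist ::
    "('a \<Rightarrow> 'a \<Rightarrow> real) \<Rightarrow> (real \<Rightarrow> 'a) \<Rightarrow> (real \<Rightarrow> 'a) \<Rightarrow> real" where
  "curve_dist d \<gamma> \<eta> = (SUP t\<in>{0..1}. d (\<gamma> t) (\<eta> t))"

definition curve_topology :: "('a \<Rightarrow> 'a \<Rightarrow> real) \<Rightarrow> (real \<Rightarrow> 'a) topology" where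
  "curve_topology d = forward_topology_on (geodesics d) (curve_dist d)"

definition interpolant ::
    "('a \<Rightarrow> 'a \<Rightarrow> real) \<Rightarrow> (real \<Rightarrow> 'a) measure \<Rightarrow> real \<Rightarrow> 'a measure" where
  "interpolant d P t = distr P (fborel d) (\<lambda>\<gamma>. \<gamma> t)"

definition endpoint_plan ::
    "('a \<Rightarrow> 'a \<Rightarrow> real) \<Rightarrow> (real \<Rightarrow> 'a) measure \<Rightarrow> ('a \<times> 'a) measure" where
  "endpoint_plan d P = distr P (fborel d \<Otimes>\<^sub>M fborel d) (\<lambda>\<gamma>. (\<gamma> 0, \<gamma> 1))"

definition dynamical_optimal_plan ::
    "('a \<Rightarrow> 'a \<Rightarrow> real) \<Rightarrow> 'a measure \<Rightarrow> 'a measure \<Rightarrow> (real \<Rightarrow> 'a) measure \<Rightarrow> bool" where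
  "dynamical_optimal_plan d \<mu>\<^sub>0 \<mu>\<^sub>1 P \<longleftrightarrow> prob_space P \<and> sets P = sets (borel_of (curve_topology d)) \<and>
     optimal_plan d \<mu>\<^sub>0 \<mu>\<^sub>1 (endpoint_plan d P)"

definition swap_plan :: "('a \<Rightarrow> 'a \<Rightarrow> real) \<Rightarrow> ('a \<times> 'a) measure \<Rightarrow> ('a \<times> 'a) measure" where
  "swap_plan d \<pi> = distr \<pi> (fborel d \<Otimes>\<^sub>M fborel d) (\<lambda>(x, y). (y, x))"


section \<open>Nonlinear functionals\<close>

text \<open>Functions in \<open>DC\<^sub>N\<close> live on \<open>[0,\<infinity>)\<close>; values at negative arguments are irrelevant.\<close>

definition DC :: "ereal \<Rightarrow> (real \<Rightarrow> real) set" where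
  "DC N = {U. continuous_on {0..} U \<and> convex_on {0..} U \<and> U 0 = 0 \<and>
     (\<forall>r>0. U field_differentiable at r \<and> deriv U field_differentiable at r) \<and>
     continuous_on {0<..} (deriv (deriv U)) \<and>
     mono_on {0<..} (\<lambda>r. (r * deriv U r - U r) / r powr (1 - real_of_ereal (1 / N)))}"

definition slope_at_infinity :: "(real \<Rightarrow> real) \<Rightarrow> ereal" where
  "slope_at_infinity U = Lim at_top (\<lambda>r. ereal (U r / r))"

definition slope_at_zero :: "(real \<Rightarrow> real) \<Rightarrow> ereal" where
  "slope_at_zero U = Lim (at_right 0) (\<lambda>r. ereal (U r / r))"

text \<open>
  Integrals with values in \<open>[-\<infinity>,\<infinity>]\<close>, as positive part minus negative part;
  \<open>iterated_integral \<nu> \<kappa> f\<close> integrates \<open>f(x,y)\<close> against \<open>\<kappa>(dy|x) \<nu>(dx)\<close>.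
  Note that \<open>\<infinity> - \<infinity> = \<infinity>\<close> on type \<open>ereal\<close>.
\<close>

definition extended_integral :: "'a measure \<Rightarrow> ('a \<Rightarrow> ereal) \<Rightarrow> ereal" where
  "extended_integral \<nu> f =
     enn2ereal (\<integral>\<^sup>+x. e2ennreal (f x) \<partial>\<nu>) - enn2ereal (\<integral>\<^sup>+x. e2ennreal (- f x) \<partial>\<nu>)"

definition iterated_integral ::
    "'a measure \<Rightarrow> ('a \<Rightarrow> 'a measure) \<Rightarrow> ('a \<Rightarrow> 'a \<Rightarrow> ereal) \<Rightarrow> ereal" where
  "iterated_integral \<nu> \<kappa> f =
     enn2ereal (\<integral>\<^sup>+x. (\<integral>\<^sup>+y. e2ennreal (f x y) \<partial>\<kappa> x) \<partial>\<nu>)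
     - enn2ereal (\<integral>\<^sup>+x. (\<integral>\<^sup>+y. e2ennreal (- f x y) \<partial>\<kappa> x) \<partial>\<nu>)"

definition U_functional :: "(real \<Rightarrow> real) \<Rightarrow> 'a measure \<Rightarrow> 'a measure \<Rightarrow> ereal" where
  "U_functional U \<nu> \<mu> =
     extended_integral \<nu> (\<lambda>x. ereal (U (ac_density \<nu> \<mu> x)))
     + slope_at_infinity U * enn2ereal (emeasure (singular_part \<nu> \<mu>) (space \<nu>))"

text \<open>
  \<open>U(r/b) b\<close> for \<open>0 < b \<le> \<infinity>\<close>. For \<open>b = \<infinity>\<close> it is \<open>r\<close> times \<open>U(r/b)/(r/b) = U(0)/0 = U'(0)\<close>,
  which is \<open>0\<close> when \<open>r = 0\<close> (also if \<open>U'(0) = -\<infinity>\<close>).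
\<close>

definition U_distorted :: "(real \<Rightarrow> real) \<Rightarrow> real \<Rightarrow> ennreal \<Rightarrow> ereal" where
  "U_distorted U r b =
     (if b = \<infinity> then ereal r * slope_at_zero U else ereal (U (r / enn2real b) * enn2real b))"

text \<open>
  The functional \<open>U\<^sup>\<beta>\<close> of \<open>\<pi>(dx dy) = \<mu>(dx) \<kappa>(dy|x)\<close>. The plan enters through \<open>\<kappa>\<close>, which it determines
  up to \<open>\<mu>\<close>-null sets; where the density vanishes so does the integrand, whatever \<open>\<kappa>\<close> is.
\<close>

definition U_beta_functional ::
    "(real \<Rightarrow> real) \<Rightarrow> 'a measure \<Rightarrow> ('a \<Rightarrow> 'a \<Rightarrow> ennreal) \<Rightarrow> ('a \<Rightarrow> 'a measure) \<Rightarrow> 'a measure \<Rightarrow> ereal" where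
  "U_beta_functional U \<nu> b \<kappa> \<mu> =
     iterated_integral \<nu> \<kappa> (\<lambda>x y. U_distorted U (ac_density \<nu> \<mu> x) (b x y))
     + slope_at_infinity U * enn2ereal (emeasure (singular_part \<nu> \<mu>) (space \<nu>))"


section \<open>Distortion coefficients\<close>

definition s_coeff :: "real \<Rightarrow> real \<Rightarrow> real \<Rightarrow> real" where
  "s_coeff K N r =
     (if K > 0 then sqrt ((N - 1) / K) * sin (r * sqrt (K / (N - 1)))
      else if K = 0 then r
      else sqrt ((N - 1) / (- K)) * sinh (r * sqrt (- K / (N - 1))))"

text \<open>The case \<open>1 < N < \<infinity>\<close>.\<close>

definition beta_fin ::
    "('a \<Rightarrow> 'a \<Rightarrow> real) \<Rightarrow> real \<Rightarrow> real \<Rightarrow> real \<Rightarrow> 'a \<Rightarrow> 'a \<Rightarrow> ennreal" where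
  "beta_fin d K N t x y =
     (if t = 0 then 1
      else if K > 0 \<and> d x y \<ge> pi * sqrt ((N - 1) / K) then \<infinity>
      else if x = y then 1
      else ennreal ((s_coeff K N (t * d x y) / (t * s_coeff K N (d x y))) powr (N - 1)))"

definition beta ::
    "('a \<Rightarrow> 'a \<Rightarrow> real) \<Rightarrow> real \<Rightarrow> ereal \<Rightarrow> real \<Rightarrow> 'a \<Rightarrow> 'a \<Rightarrow> ennreal" where
  "beta d K N t x y =
     (if N = 1 then Lim (at_right 1) (\<lambda>N'. beta_fin d K N' t x y)
      else if N = \<infinity> then Lim at_top (\<lambda>N'. beta_fin d K N' t x y)
      else beta_fin d K (real_of_ereal N) t x y)"

text \<open>
  \<open>cd_value d K N F\<close> is the value at \<open>N\<close> of a functional \<open>F\<close> depending on the dimension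
  parameter, replaced by the limit as \<open>N' \<down> N\<close> in the exceptional cases.
\<close>

definition exceptional :: "('a \<Rightarrow> 'a \<Rightarrow> real) \<Rightarrow> real \<Rightarrow> ereal \<Rightarrow> bool" where
  "exceptional d K N \<longleftrightarrow> N = 1 \<or>
     (K > 0 \<and> 1 < N \<and> N < \<infinity> \<and>
      (SUP (x, y)\<in>UNIV. ereal (d x y)) = ereal (pi * sqrt ((real_of_ereal N - 1) / K)))"

definition cd_value ::
    "('a \<Rightarrow> 'a \<Rightarrow> real) \<Rightarrow> real \<Rightarrow> ereal \<Rightarrow> (ereal \<Rightarrow> ereal) \<Rightarrow> ereal" where
  "cd_value d K N F =
     (if exceptional d K N then Lim (at_right (real_of_ereal N)) (\<lambda>N'. F (ereal N')) else F N)"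


section \<open>Weak \<open>CD(K,N)\<close> spaces\<close>

definition cs_probability :: "('a \<Rightarrow> 'a \<Rightarrow> real) \<Rightarrow> 'a measure \<Rightarrow> bool" where
  "cs_probability d \<mu> \<longleftrightarrow> prob_space \<mu> \<and> sets \<mu> = sets (fborel d) \<and>
     compactin (forward_topology d) (msupport (forward_topology d) \<mu>)"

text \<open>
  \<open>P\<close> is the dynamical plan, with displacement interpolation \<open>interpolant d P\<close> and associated
  optimal plan \<open>\<pi> = endpoint_plan d P\<close>; \<open>\<kappa>\<close> and \<open>\<kappa>'\<close> are the disintegrations of \<open>\<pi>\<close> and of the swapped
  plan with respect to their first marginals. Products on \<open>ereal\<close> satisfy \<open>0 * \<infinity> = 0\<close>.
\<close>

definition weak_CD :: "real \<Rightarrow> ereal \<Rightarrow> ('a \<Rightarrow> 'a \<Rightarrow> real) \<Rightarrow> 'a measure \<Rightarrow> bool" where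
  "weak_CD K N d \<nu> \<longleftrightarrow>
     forward_geodesic_space d \<and> forward_boundedly_compact d \<and>
     sets \<nu> = sets (fborel d) \<and> locally_finite_measure (forward_topology d) \<nu> \<and>
     sigma_finite_measure \<nu> \<and>
     (\<forall>\<mu>\<^sub>0 \<mu>\<^sub>1. cs_probability d \<mu>\<^sub>0 \<and> cs_probability d \<mu>\<^sub>1 \<and>
        msupport (forward_topology d) \<mu>\<^sub>0 \<subseteq> msupport (forward_topology d) \<nu> \<and>
        msupport (forward_topology d) \<mu>\<^sub>1 \<subseteq> msupport (forward_topology d) \<nu> \<longrightarrow>
        (\<exists>P \<kappa> \<kappa>'. dynamical_optimal_plan d \<mu>\<^sub>0 \<mu>\<^sub>1 P \<and>
           disintegrates (fborel d) (endpoint_plan d P) \<mu>\<^sub>0 \<kappa> \<and>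
           disintegrates (fborel d) (swap_plan d (endpoint_plan d P)) \<mu>\<^sub>1 \<kappa>' \<and>
           (\<forall>U\<in>DC N. \<forall>t\<in>{0..1}.
              U_functional U \<nu> (interpolant d P t) \<le>
                ereal (1 - t) *
                  cd_value d K N (\<lambda>N'. U_beta_functional U \<nu> (beta d K N' (1 - t)) \<kappa> \<mu>\<^sub>0)
                + ereal t *
                  cd_value d K N (\<lambda>N'. U_beta_functional U \<nu> (\<lambda>x y. beta d K N' t y x) \<kappa>' \<mu>\<^sub>1))))"


section \<open>Powers and logarithms of extended nonnegative numbers\<close>

text \<open>\<open>x\<^sup>a\<close> for \<open>a > 0\<close>.\<close>

definition ennpowr :: "ennreal \<Rightarrow> real \<Rightarrow> ennreal" where
  "ennpowr x a = (if x = \<infinity> then \<infinity> else ennreal (enn2real x powr a))"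

definition ennlog :: "ennreal \<Rightarrow> ereal" where
  "ennlog x = (if x = 0 then - \<infinity> else if x = \<infinity> then \<infinity> else ereal (ln (enn2real x)))"

end

theory Submission
  imports Defs "HOL-Real_Asymp.Real_Asymp"
begin

text \<open>
  Apply the curvature-dimension inequality to the uniform distributions on \<open>A\<^sub>0\<close> and \<open>A\<^sub>1\<close>. The
  interpolant at time \<open>t\<close> is concentrated on \<open>S = [A\<^sub>0, A\<^sub>1]\<^sub>t\<close>, which is closed because \<open>y \<in> S\<close> just
  says \<open>d(x,y) = t d(x,z)\<close> and \<open>d(y,z) = (1 - t) d(x,z)\<close> for some \<open>x \<in> A\<^sub>0\<close>, \<open>z \<in> A\<^sub>1\<close>. For \<open>N < \<infinity>\<close> the
  function \<open>U(r) = -r\<^bsup>1-1/N\<^esup>\<close> turns the left side into at least \<open>-\<nu>(S)\<^bsup>1/N\<^esup>\<close> by Jensen's inequality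
  and the right side into the claimed lower bound; for \<open>N = 1\<close> take exponents \<open>1 - 1/M\<close> and let
  \<open>M \<down> 1\<close>. For \<open>N = \<infinity>\<close> use \<open>U(r) = r ln r\<close>.

  Where the functionals are defined as limits \<open>N' \<down> N\<close>, these limits exist because \<open>\<beta>\<close> is
  nonincreasing in the dimension, i.e. because \<open>ln (sin(ta) / (t sin a)) / a\<^sup>2\<close> and its hyperbolic
  counterpart are nondecreasing in \<open>a\<close>.
\<close>

section \<open>Forward metric spaces and barycenters\<close>

text \<open>Without symmetry of \<open>d\<close>, the Hausdorff property and the continuity of the
  distance rest on the reversibility bound, which controls backward distances by forward ones near
  each point.

  The limits N' \<down> N are a real obstacle, since \<open>Lim\<close> is an unspecified value
  where no limit exists. For a power function the distorted functional is minus a nonnegative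
  integral that grows with \<beta>, so monotonicity in N' turns its limit into minus a supremum.

  Both \<beta> and \<nu>(S) may be infinite. For N < \<infinity> the estimates therefore live in
  [0,\<infinity>], where no case distinction is needed. The slope of the power functions at infinity
  is 0, so any probability measure on \<open>A\<^sub>0\<close> serves when that set is null. For N =
  \<infinity> the infinite slope instead removes the singular part of the interpolant, and null sets
  are separated because they make the right side infinite.

  For N < \<infinity>, the term belonging to \<open>A\<^sub>1\<close> is the term belonging to
  \<open>A\<^sub>0\<close> for the reversed distance.\<close>

lemma irreversible_metricD:
  assumes "irreversible_metric d"
  shows "0 \<le> d x y" and "d x x = 0" and "d x y = 0 \<longleftrightarrow> x = y" and "d x z \<le> d x y + d y z"
  using assms unfolding irreversible_metric_def by blast+

lemma irreversible_metric_pos: "irreversible_metric d \<Longrightarrow> x \<noteq> y \<Longrightarrow> 0 < d x y"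
  using irreversible_metricD(1,3)[of d x y] by simp

lemma topspace_forward_topology:
  assumes "irreversible_metric d"
  shows "topspace (forward_topology d) = UNIV"
proof -
  have "x \<in> topspace (forward_topology d)" for x
    unfolding forward_topology_on_def topology_generated_by_topspace
    using irreversible_metricD(2)[OF assms, of x]
    by (intro UnionI[of "{y \<in> UNIV. d x y < 1}"]) (simp_all, metis zero_less_one)
  then show ?thesis by auto
qed

lemma openin_forward_ball:
  assumes "irreversible_metric d" "0 < r"
  shows "openin (forward_topology d) (forward_ball d x r)"
  unfolding forward_topology_on_def
  by (rule topology_generated_by_Basis) (use assms in \<open>auto simp: forward_ball_def\<close>)

text \<open>The triangle inequality places the forward ball of radius r - d(x,y) about y inside the
  ball of radius r about x, so the generating balls already form a basis.\<close>

lemma openin_forward_topology_iff: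
  assumes "irreversible_metric d"
  shows "openin (forward_topology d) U \<longleftrightarrow> (\<forall>x\<in>U. \<exists>r>0. forward_ball d x r \<subseteq> U)"
proof
  assume "openin (forward_topology d) U"
  then have "generate_topology_on {{y \<in> UNIV. d x y < r} | x r. x \<in> UNIV \<and> 0 < r} U"
    unfolding forward_topology_on_def openin_topology_generated_by_iff .
  then show "\<forall>x\<in>U. \<exists>r>0. forward_ball d x r \<subseteq> U"
  proof induction
    case (Int a b)
    show ?case
    proof
      fix x assume "x \<in> a \<inter> b"
      then obtain r s where "r > 0" "forward_ball d x r \<subseteq> a" "s > 0" "forward_ball d x s \<subseteq> b"
        using Int by blast
      then have "min r s > 0" "forward_ball d x (min r s) \<subseteq> a \<inter> b"
        by (auto simp: forward_ball_def)
      then show "\<exists>r>0. forward_ball d x r \<subseteq> a \<inter> b" by blast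
    qed
  next
    case (Basis s)
    then obtain x r where s: "s = {y. d x y < r}" by auto
    show ?case
    proof
      fix y assume "y \<in> s"
      moreover have "forward_ball d y (r - d x y) \<subseteq> s"
      proof
        fix z assume "z \<in> forward_ball d y (r - d x y)"
        then show "z \<in> s"
          using irreversible_metricD(4)[OF assms, of x z y] by (simp add: s forward_ball_def)
      qed
      ultimately show "\<exists>r>0. forward_ball d y r \<subseteq> s"
        unfolding s by (metis diff_gt_0_iff_gt mem_Collect_eq)
    qed
  next
    case (UN \<K>)
    then show ?case by (meson Sup_upper UnionE order_trans)
  qed simp
next
  assume "\<forall>x\<in>U. \<exists>r>0. forward_ball d x r \<subseteq> U"
  then obtain r where r: "\<And>x. x \<in> U \<Longrightarrow> 0 < r x \<and> forward_ball d x (r x) \<subseteq> U"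
    by metis
  then have U: "(\<Union>x\<in>U. forward_ball d x (r x)) = U"
    using irreversible_metricD(2)[OF assms] unfolding forward_ball_def by auto
  have "openin (forward_topology d) (\<Union>x\<in>U. forward_ball d x (r x))"
    using r openin_forward_ball[OF assms] by (intro openin_Union) auto
  then show "openin (forward_topology d) U"
    unfolding U .
qed

text \<open>The reversibility constant is an infimum, equal to \<infinity> when no admissible factor
  exists; being at most \<Theta>(R), it has an actual witness \<open>l\<close>. The open balls used
  here lie inside the closed ones of the definition.\<close>

lemma forward_metric_space_reversible:
  assumes "forward_metric_space d"
  obtains p where "\<And>R. \<exists>l\<ge>1. \<forall>y z. d p y < R \<longrightarrow> d p z < R \<longrightarrow> d y z \<le> l * d z y"
proof -
  from assms obtain p and \<Theta> :: "real \<Rightarrow> real" where irr: "irreversible_metric d"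
    and \<Theta>: "\<And>r. r > 0 \<Longrightarrow> reversibility d (closed_forward_ball d p r) \<le> ereal (\<Theta> r)"
    unfolding forward_metric_space_def by blast
  show thesis
  proof (rule that)
    fix R
    show "\<exists>l\<ge>1. \<forall>y z. d p y < R \<longrightarrow> d p z < R \<longrightarrow> d y z \<le> l * d z y"
    proof (cases "R > 0")
      case True
      let ?C = "closed_forward_ball d p R"
      have sub: "forward_ball d p R \<subseteq> ?C"
        unfolding closed_forward_ball_def
        by (rule closure_of_subset) (simp add: topspace_forward_topology irr)
      have "reversibility d ?C < \<infinity>"
        using \<Theta>[OF True] by auto
      then obtain l where "1 \<le> l" "\<And>y z. y \<in> ?C \<Longrightarrow> z \<in> ?C \<Longrightarrow> d y z \<le> l * d z y"
        unfolding reversibility_def Inf_less_iff by blast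
      with sub show ?thesis by (intro exI[of _ l]) (auto simp: forward_ball_def subset_iff)
    next
      case False
      then have "\<not> d p y < R" for y using irreversible_metricD(1)[OF irr, of p y] by simp
      then show ?thesis by (intro exI[of _ 1]) simp
    qed
  qed
qed

text \<open>The local replacement for symmetry. All points with d(x,y) < 1 stay in the ball of
  radius d(p,x) + 1 about the base point, on which one factor \<open>l\<close> compares the two
  directions.\<close>

lemma forward_metric_space_backward_small:
  assumes "forward_metric_space d" "0 < e"
  obtains \<delta> where "0 < \<delta>" "\<And>y. d x y < \<delta> \<Longrightarrow> d y x < e"
proof -
  have irr: "irreversible_metric d" using assms(1) by (simp add: forward_metric_space_def)
  obtain p where p: "\<And>R. \<exists>l\<ge>1. \<forall>y z. d p y < R \<longrightarrow> d p z < R \<longrightarrow> d y z \<le> l * d z y"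
    using forward_metric_space_reversible[OF assms(1)] by blast
  obtain l where l: "1 \<le> l"
    "\<And>y z. d p y < d p x + 1 \<Longrightarrow> d p z < d p x + 1 \<Longrightarrow> d y z \<le> l * d z y"
    using p[of "d p x + 1"] by blast
  show thesis
  proof
    show "0 < min 1 (e / l)" using l(1) \<open>0 < e\<close> by auto
    fix y assume y: "d x y < min 1 (e / l)"
    then have "d y x \<le> l * d x y"
      using l(2)[of y x] irreversible_metricD(4)[OF irr, of p y x] by simp
    also have "l * d x y < e" using y l(1) by (simp add: field_simps)
    finally show "d y x < e" .
  qed
qed

section \<open>Separation, compactness and geodesics in the forward topology\<close>

context
  fixes d :: "'a \<Rightarrow> 'a \<Rightarrow> real"
  assumes fms: "forward_metric_space d"
begin

lemma forward_metric_space_irreversible: "irreversible_metric d"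
  using fms by (simp add: forward_metric_space_def)

lemma forward_metric_space_topspace [simp]: "topspace (forward_topology d) = UNIV"
  by (rule topspace_forward_topology[OF forward_metric_space_irreversible])

text \<open>In d(x,y) \<le> d(x,z) + d(z,y) the second leg points towards y, which a forward ball
  about y does not control directly; hence the radius \<delta> that makes backward distances to y
  small.\<close>

lemma forward_metric_space_Hausdorff: "Hausdorff_space (forward_topology d)"
  unfolding Hausdorff_space_def
proof (intro allI impI)
  note irr = forward_metric_space_irreversible
  note D = irreversible_metricD[OF irr]
  fix x y assume "x \<in> topspace (forward_topology d) \<and> y \<in> topspace (forward_topology d) \<and> x \<noteq> y"
  then have "d x y > 0" using D(1,3) by (metis less_eq_real_def)
  then obtain \<delta> where \<delta>: "0 < \<delta>" "\<And>z. d y z < \<delta> \<Longrightarrow> d z y < d x y / 2"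
    using forward_metric_space_backward_small[OF fms, of "d x y / 2" y] by auto
  have "disjnt (forward_ball d x (d x y / 2)) (forward_ball d y \<delta>)"
    unfolding disjnt_iff
  proof (intro allI notI)
    fix z assume "z \<in> forward_ball d x (d x y / 2) \<and> z \<in> forward_ball d y \<delta>"
    then have "d x z < d x y / 2" "d z y < d x y / 2" using \<delta>(2) by (auto simp: forward_ball_def)
    then show False using D(4)[of x y z] by simp
  qed
  moreover have "x \<in> forward_ball d x (d x y / 2)" "y \<in> forward_ball d y \<delta>"
    using \<open>d x y > 0\<close> \<delta>(1) D(2) by (auto simp: forward_ball_def)
  ultimately show "\<exists>U V. openin (forward_topology d) U \<and> openin (forward_topology d) V \<and>
      x \<in> U \<and> y \<in> V \<and> disjnt U V"
    using openin_forward_ball[OF irr] \<open>d x y > 0\<close> \<delta>(1)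
    by (intro exI[of _ "forward_ball d x (d x y / 2)"] exI[of _ "forward_ball d y \<delta>"]) simp
qed

lemma compactin_forward_imp_closedin:
  "compactin (forward_topology d) A \<Longrightarrow> closedin (forward_topology d) A"
  by (rule compactin_imp_closedin[OF forward_metric_space_Hausdorff])

text \<open>Moving both arguments costs a leg at x and a leg at y, in one direction for the upper
  estimate and in the other for the lower one. So all of d(x,x'), d(x',x), d(y,y'), d(y',y) are made
  smaller than e/2.\<close>

lemma continuous_map_forward_dist:
  "continuous_map (prod_topology (forward_topology d) (forward_topology d)) euclideanreal (\<lambda>(x, y). d x y)"
  unfolding continuous_map_def
proof (intro conjI allI impI)
  note irr = forward_metric_space_irreversible
  note D = irreversible_metricD[OF irr]
  fix W assume "openin euclideanreal W"
  then have W: "open W" by simp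
  show "openin (prod_topology (forward_topology d) (forward_topology d))
     {x \<in> topspace (prod_topology (forward_topology d) (forward_topology d)). (\<lambda>(x, y). d x y) x \<in> W}"
    unfolding openin_prod_topology_alt
  proof (intro allI impI)
    fix x y
    assume "(x, y) \<in> {x \<in> topspace (prod_topology (forward_topology d) (forward_topology d)).
      (\<lambda>(x, y). d x y) x \<in> W}"
    then have "d x y \<in> W" by simp
    then obtain e where e: "e > 0" "\<And>r. \<bar>r - d x y\<bar> < e \<Longrightarrow> r \<in> W"
      using W unfolding open_dist dist_real_def by blast
    obtain \<delta>1 where \<delta>1: "0 < \<delta>1" "\<And>z. d x z < \<delta>1 \<Longrightarrow> d z x < e / 2"
      using forward_metric_space_backward_small[OF fms, of "e / 2" x] e(1) by auto
    obtain \<delta>2 where \<delta>2: "0 < \<delta>2" "\<And>z. d y z < \<delta>2 \<Longrightarrow> d z y < e / 2"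
      using forward_metric_space_backward_small[OF fms, of "e / 2" y] e(1) by auto
    let ?U = "forward_ball d x (min \<delta>1 (e / 2))" and ?V = "forward_ball d y (min \<delta>2 (e / 2))"
    have "d x' y' \<in> W" if "x' \<in> ?U" "y' \<in> ?V" for x' y'
    proof (rule e(2))
      have "d x x' < e / 2" "d x' x < e / 2" "d y y' < e / 2" "d y' y < e / 2"
        using that \<delta>1 \<delta>2 by (auto simp: forward_ball_def)
      then show "\<bar>d x' y' - d x y\<bar> < e"
        using D(4)[of x' y' x] D(4)[of x y' y] D(4)[of x y x'] D(4)[of x' y y'] by linarith
    qed
    then have "?U \<times> ?V \<subseteq> {x \<in> topspace (prod_topology (forward_topology d) (forward_topology d)).
                (\<lambda>(x, y). d x y) x \<in> W}"
      by (intro subsetI) (simp add: mem_Times_iff split_beta del: subsetI)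
    moreover have "x \<in> ?U" "y \<in> ?V"
      using \<delta>1(1) \<delta>2(1) e(1) D(2) by (auto simp: forward_ball_def)
    moreover have "openin (forward_topology d) ?U" "openin (forward_topology d) ?V"
      using \<delta>1(1) \<delta>2(1) e(1) by (auto intro!: openin_forward_ball[OF irr])
    ultimately show "\<exists>U V. openin (forward_topology d) U \<and> openin (forward_topology d) V \<and>
             x \<in> U \<and> y \<in> V \<and> U \<times> V \<subseteq>
              {x \<in> topspace (prod_topology (forward_topology d) (forward_topology d)).
                (\<lambda>(x, y). d x y) x \<in> W}"
      by (intro exI[of _ ?U] exI[of _ ?V] conjI)
  qed
qed auto

lemma compact_forward_dist_image:
  assumes "compactin (forward_topology d) A" "compactin (forward_topology d) B"
  shows "compact ((\<lambda>(x, y). d x y) ` (A \<times> B))"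
proof -
  have "compactin (prod_topology (forward_topology d) (forward_topology d)) (A \<times> B)"
    using assms by (simp add: compactin_Times)
  from image_compactin[OF this continuous_map_forward_dist] show ?thesis by simp
qed

lemma dist_attains_inf_sup:
  assumes "compactin (forward_topology d) A" "compactin (forward_topology d) B" "A \<noteq> {}" "B \<noteq> {}"
  obtains x y x' y' where "x \<in> A" "y \<in> B" "x' \<in> A" "y' \<in> B"
    "\<forall>u\<in>A. \<forall>v\<in>B. d x y \<le> d u v \<and> d u v \<le> d x' y'"
proof -
  let ?D = "(\<lambda>(x, y). d x y) ` (A \<times> B)"
  have c: "compact ?D" "?D \<noteq> {}" using compact_forward_dist_image[OF assms(1,2)] assms(3,4) by auto
  obtain s where s: "s \<in> ?D" "\<forall>r\<in>?D. s \<le> r"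
    using compact_attains_inf[OF c] by (rule bexE)
  obtain m where m: "m \<in> ?D" "\<forall>r\<in>?D. r \<le> m"
    using compact_attains_sup[OF c] by (rule bexE)
  obtain x y where "x \<in> A" "y \<in> B" "s = d x y" using s(1) by auto
  moreover obtain x' y' where "x' \<in> A" "y' \<in> B" "m = d x' y'" using m(1) by auto
  moreover have "d u v \<in> ?D" if "u \<in> A" "v \<in> B" for u v using that by force
  ultimately show thesis using s(2) m(2) by (intro that[of x y x' y']) (assumption | blast)+
qed

text \<open>
  The continuity requirement in \<^const>\<open>geodesics\<close> comes for free: an affine parametrisation is
  forward continuous on both sides, because small forward distances force small backward ones.
\<close>

lemma geodesicsI:
  assumes "\<gamma> \<in> extensional {0..1}"
    and \<gamma>: "\<And>s t. 0 \<le> s \<Longrightarrow> s \<le> t \<Longrightarrow> t \<le> 1 \<Longrightarrow> d (\<gamma> s) (\<gamma> t) = (t - s) * d (\<gamma> 0) (\<gamma> 1)"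
  shows "\<gamma> \<in> geodesics d"
proof -
  note irr = forward_metric_space_irreversible
  note D = irreversible_metricD[OF irr]
  let ?D = "d (\<gamma> 0) (\<gamma> 1)"
  obtain p where p: "\<And>R. \<exists>l\<ge>1. \<forall>y z. d p y < R \<longrightarrow> d p z < R \<longrightarrow> d y z \<le> l * d z y"
    using forward_metric_space_reversible[OF fms] by blast
  \<comment> \<open>Large enough that the whole curve stays in the ball of radius \<open>R\<close>
    about p, so that a single factor \<open>l\<close> serves for running along the curve
    backwards.\<close>
  define R where "R = d p (\<gamma> 0) + ?D + 1"
  have R: "d p (\<gamma> s) < R" if "0 \<le> s" "s \<le> 1" for s
  proof -
    have "d (\<gamma> 0) (\<gamma> s) \<le> 1 * ?D" using \<gamma>[of 0 s] that D(1) by (simp add: mult_left_le_one_le)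
    then show ?thesis using D(4)[of p "\<gamma> s" "\<gamma> 0"] by (simp add: R_def)
  qed
  obtain l where l: "1 \<le> l" "\<And>y z. d p y < R \<Longrightarrow> d p z < R \<Longrightarrow> d y z \<le> l * d z y"
    using p[of R] by blast
  have lip: "d (\<gamma> s) (\<gamma> u) \<le> \<bar>u - s\<bar> * (l * ?D)" if "0 \<le> s" "s \<le> 1" "0 \<le> u" "u \<le> 1" for s u
  proof (cases "s \<le> u")
    case True
    have "(u - s) * ?D \<le> (u - s) * (l * ?D)"
      using True l(1) D(1)[of "\<gamma> 0" "\<gamma> 1"] by (intro mult_left_mono) (auto simp: mult_le_cancel_right1)
    then show ?thesis using \<gamma>[of s u] that True by simp
  next
    case False
    then have "d (\<gamma> u) (\<gamma> s) = (s - u) * ?D" using \<gamma>[of u s] that by simp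
    then show ?thesis using l(2)[of "\<gamma> s" "\<gamma> u"] R that False by (simp add: ac_simps)
  qed
  have "continuous_map (top_of_set {0..1}) (forward_topology d) \<gamma>"
    unfolding continuous_map_def
  proof (intro conjI allI impI)
    fix U assume U: "openin (forward_topology d) U"
    show "openin (top_of_set {0..1}) {x \<in> topspace (top_of_set {0..1}). \<gamma> x \<in> U}"
      unfolding openin_euclidean_subtopology_iff
    proof (intro conjI ballI)
      fix s assume "s \<in> {x \<in> topspace (top_of_set {0..1}). \<gamma> x \<in> U}"
      then have s: "0 \<le> s" "s \<le> 1" "\<gamma> s \<in> U" by auto
      then obtain r where r: "r > 0" "forward_ball d (\<gamma> s) r \<subseteq> U"
        using U unfolding openin_forward_topology_iff[OF irr] by blast
      \<comment> \<open>The summand 1 keeps the divisor positive for a constant curve, where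
        \<open>?D\<close> is 0.\<close>
      have pos: "0 < l * ?D + 1" using l(1) D(1)[of "\<gamma> 0" "\<gamma> 1"] by (simp add: add_nonneg_pos)
      show "\<exists>e>0. \<forall>x'\<in>{0..1}. dist x' s < e \<longrightarrow> x' \<in> {x \<in> topspace (top_of_set {0..1}). \<gamma> x \<in> U}"
      proof (intro exI[of _ "r / (l * ?D + 1)"] conjI ballI impI)
        show "0 < r / (l * ?D + 1)" using r(1) pos by simp
        fix u :: real assume u: "u \<in> {0..1}" "dist u s < r / (l * ?D + 1)"
        have "d (\<gamma> s) (\<gamma> u) \<le> \<bar>u - s\<bar> * (l * ?D)" using lip[of s u] s u by simp
        also have "\<dots> \<le> \<bar>u - s\<bar> * (l * ?D + 1)" by (intro mult_left_mono) auto
        also have "\<dots> < r" using u(2) pos by (simp add: dist_real_def field_simps)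
        finally show "u \<in> {x \<in> topspace (top_of_set {0..1}). \<gamma> x \<in> U}"
          using r(2) u(1) by (auto simp: forward_ball_def)
      qed
    qed auto
  qed auto
  then show ?thesis using assms(1) \<gamma> unfolding geodesics_def by blast
qed

text \<open>A point dividing the distance from \<open>x\<close> to \<open>z\<close> in the ratio \<open>t : 1 - t\<close> lies on a geodesic
  obtained by concatenating geodesics from \<open>x\<close> to \<open>y\<close> and from \<open>y\<close> to \<open>z\<close>.\<close>

lemma barycenters_eq:
  assumes geo: "forward_geodesic_space d" and t: "0 < t" "t < 1"
  shows "barycenters d A B t =
    {y. \<exists>x\<in>A. \<exists>z\<in>B. d x y = t * d x z \<and> d y z = (1 - t) * d x z}" (is "_ = ?R")
proof
  show "barycenters d A B t \<subseteq> ?R"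
  proof
    fix y assume "y \<in> barycenters d A B t"
    then obtain \<gamma> where \<gamma>: "y = \<gamma> t" "\<gamma> \<in> geodesics d" "\<gamma> 0 \<in> A" "\<gamma> 1 \<in> B"
      unfolding barycenters_def by blast
    have "d (\<gamma> r) (\<gamma> s) = (s - r) * d (\<gamma> 0) (\<gamma> 1)" if "0 \<le> r \<and> r \<le> s \<and> s \<le> 1" for r s
      using \<gamma>(2) that unfolding geodesics_def by blast
    from this[of 0 t] this[of t 1] show "y \<in> ?R"
      using \<gamma> t by auto
  qed
next
  note irr = forward_metric_space_irreversible
  note D = irreversible_metricD[OF irr]
  show "?R \<subseteq> barycenters d A B t"
  proof
    fix y assume "y \<in> ?R"
    then obtain x z where xz: "x \<in> A" "z \<in> B" and xy: "d x y = t * d x z"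
      and yz: "d y z = (1 - t) * d x z" by blast
    let ?D = "d x z"
    obtain \<gamma>1 where \<gamma>1: "\<gamma>1 \<in> geodesics d" "\<gamma>1 0 = x" "\<gamma>1 1 = y"
      using geo unfolding forward_geodesic_space_def by blast
    obtain \<gamma>2 where \<gamma>2: "\<gamma>2 \<in> geodesics d" "\<gamma>2 0 = y" "\<gamma>2 1 = z"
      using geo unfolding forward_geodesic_space_def by blast
    have G1: "d (\<gamma>1 r) (\<gamma>1 s) = (s - r) * d x y" if "0 \<le> r" "r \<le> s" "s \<le> 1" for r s
      using \<gamma>1 that unfolding geodesics_def by blast
    have G2: "d (\<gamma>2 r) (\<gamma>2 s) = (s - r) * d y z" if "0 \<le> r" "r \<le> s" "s \<le> 1" for r s
      using \<gamma>2 that unfolding geodesics_def by blast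
    define \<gamma> where "\<gamma> = restrict (\<lambda>s. if s \<le> t then \<gamma>1 (s / t) else \<gamma>2 ((s - t) / (1 - t))) {0..1}"
    have \<gamma>_lo: "\<gamma> s = \<gamma>1 (s / t)" if "0 \<le> s" "s \<le> t" for s using that t by (simp add: \<gamma>_def)
    have \<gamma>_hi: "\<gamma> s = \<gamma>2 ((s - t) / (1 - t))" if "t \<le> s" "s \<le> 1" for s
      using that t \<gamma>1(3) \<gamma>2(2) by (cases "s = t") (simp_all add: \<gamma>_def)
    have ends: "\<gamma> 0 = x" "\<gamma> t = y" "\<gamma> 1 = z"
      using \<gamma>_lo[of 0] \<gamma>_lo[of t] \<gamma>_hi[of 1] t \<gamma>1 \<gamma>2 by auto
    have lo: "d (\<gamma> r) (\<gamma> s) = (s - r) * ?D" if "0 \<le> r" "r \<le> s" "s \<le> t" for r s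
    proof -
      have "d (\<gamma>1 (r / t)) (\<gamma>1 (s / t)) = (s / t - r / t) * (t * ?D)"
        using G1[of "r / t" "s / t"] that t xy by (simp add: divide_right_mono)
      then show ?thesis using that t by (simp add: \<gamma>_lo diff_divide_distrib[symmetric])
    qed
    have hi: "d (\<gamma> r) (\<gamma> s) = (s - r) * ?D" if "t \<le> r" "r \<le> s" "s \<le> 1" for r s
    proof -
      have "d (\<gamma>2 ((r - t) / (1 - t))) (\<gamma>2 ((s - t) / (1 - t)))
          = ((s - t) / (1 - t) - (r - t) / (1 - t)) * ((1 - t) * ?D)"
        using G2[of "(r - t) / (1 - t)" "(s - t) / (1 - t)"] that t yz by (simp add: divide_right_mono)
      then show ?thesis using that t by (simp add: \<gamma>_hi diff_divide_distrib[symmetric])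
    qed
    have "d (\<gamma> r) (\<gamma> s) = (s - r) * ?D" if "0 \<le> r" "r \<le> s" "s \<le> 1" for r s
    proof -
      consider "s \<le> t" | "t \<le> r" | "r \<le> t" "t \<le> s" by linarith
      then show ?thesis
      proof cases
        \<comment> \<open>The two pieces meet at y. The triangle inequality through y gives the
          upper bound. For the lower one, a shorter connection from \<gamma>(r) to \<gamma>(s) would
          make the way from x to z shorter than d(x,z).\<close>
        case 3
        have "d (\<gamma> r) (\<gamma> s) \<le> (s - r) * ?D"
          using D(4)[of "\<gamma> r" "\<gamma> s" y] lo[of r t] hi[of t s] 3 that ends t
          by (simp add: algebra_simps)
        moreover have "?D \<le> r * ?D + d (\<gamma> r) (\<gamma> s) + (1 - s) * ?D"
          using D(4)[of x z "\<gamma> r"] D(4)[of "\<gamma> r" z "\<gamma> s"] lo[of 0 r] hi[of s 1] 3 that ends t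
          by simp
        ultimately show ?thesis by (simp add: algebra_simps)
      qed (use lo hi that in auto)
    qed
    then have "\<gamma> \<in> geodesics d"
      using ends by (intro geodesicsI) (auto simp: \<gamma>_def)
    then show "y \<in> barycenters d A B t"
      using xz ends unfolding barycenters_def by blast
  qed
qed

text \<open>The set is the image of the zero set of the continuous function \<open>Q\<close> under
  the projection that forgets (x,z). That projection is a closed map because (x,z) ranges over the
  compact space A \<times> B. Adding two absolute values packs both equations into one.\<close>

lemma closedin_barycenters:
  assumes geo: "forward_geodesic_space d" and t: "0 < t" "t < 1"
    and A: "compactin (forward_topology d) A" and B: "compactin (forward_topology d) B"
  shows "closedin (forward_topology d) (barycenters d A B t)"
proof -
  let ?T = "forward_topology d"
  let ?P = "subtopology (prod_topology ?T ?T) (A \<times> B)"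
  have "compact_space ?P"
    using A B by (intro compact_space_subtopology) (simp add: compactin_Times)
  then have cl: "closed_map (prod_topology ?P ?T) ?T snd"
    by (rule closed_map_snd)
  define Q where "Q = (\<lambda>p::('a \<times> 'a) \<times> 'a. \<bar>d (fst (fst p)) (snd p) - t * d (fst (fst p)) (snd (fst p))\<bar>
      + \<bar>d (snd p) (snd (fst p)) - (1 - t) * d (fst (fst p)) (snd (fst p))\<bar>)"
  have dist: "continuous_map X euclideanreal (\<lambda>p. d (f p) (g p))"
    if "continuous_map X ?T f" "continuous_map X ?T g" for X :: "(('a \<times> 'a) \<times> 'a) topology" and f g
    using continuous_map_compose[OF _ continuous_map_forward_dist, of X "\<lambda>p. (f p, g p)"] that
    by (simp add: continuous_map_pairwise o_def)
  have p: "continuous_map (prod_topology ?P ?T) ?T snd"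
      "continuous_map (prod_topology ?P ?T) ?T (\<lambda>p. fst (fst p))"
      "continuous_map (prod_topology ?P ?T) ?T (\<lambda>p. snd (fst p))"
    using continuous_map_compose[OF continuous_map_fst[of ?P ?T] continuous_map_from_subtopology[OF continuous_map_fst]]
      continuous_map_compose[OF continuous_map_fst[of ?P ?T] continuous_map_from_subtopology[OF continuous_map_snd]]
    by (simp_all add: continuous_map_snd o_def)
  have "continuous_map (prod_topology ?P ?T) euclideanreal Q"
    unfolding Q_def by (intro continuous_intros dist p)
  then have "closedin (prod_topology ?P ?T) {p \<in> topspace (prod_topology ?P ?T). Q p \<in> {0}}"
    by (rule closedin_continuous_map_preimage) simp
  then have "closedin ?T (snd ` {p \<in> topspace (prod_topology ?P ?T). Q p \<in> {0}})"
    using cl unfolding closed_map_def by blast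
  also have "snd ` {p \<in> topspace (prod_topology ?P ?T). Q p \<in> {0}} = barycenters d A B t"
    unfolding barycenters_eq[OF geo t] by (force simp: Q_def image_iff)
  finally show ?thesis .
qed

section \<open>The curve topology and evaluation at a time\<close>

lemma topspace_curve_topology: "topspace (curve_topology d) = geodesics d"
proof -
  have "\<gamma> \<in> topspace (curve_topology d)" if "\<gamma> \<in> geodesics d" for \<gamma>
    unfolding curve_topology_def forward_topology_on_def topology_generated_by_topspace
    using that irreversible_metricD(2)[OF forward_metric_space_irreversible]
    by (intro UnionI[of "{\<eta> \<in> geodesics d. curve_dist d \<gamma> \<eta> < 1}"])
       (simp_all add: curve_dist_def, metis zero_less_one)
  moreover have "topspace (curve_topology d) \<subseteq> geodesics d"
    unfolding curve_topology_def forward_topology_on_def topology_generated_by_topspace by blast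
  ultimately show ?thesis by blast
qed

lemma dist_le_curve_dist:
  assumes "\<gamma> \<in> geodesics d" "\<eta> \<in> geodesics d" "0 \<le> t" "t \<le> 1"
  shows "d (\<gamma> t) (\<eta> t) \<le> curve_dist d \<gamma> \<eta>"
  unfolding curve_dist_def
proof (rule cSUP_upper)
  note D = irreversible_metricD[OF forward_metric_space_irreversible]
  have G: "d (\<xi> r) (\<xi> s) \<le> d (\<xi> 0) (\<xi> 1)"
    if "\<xi> \<in> geodesics d" "0 \<le> r" "r \<le> s" "s \<le> 1" for \<xi> r s
  proof -
    have "d (\<xi> r) (\<xi> s) = (s - r) * d (\<xi> 0) (\<xi> 1)"
      using that unfolding geodesics_def by blast
    then show ?thesis using that D(1) by (simp add: mult_left_le_one_le)
  qed
  show "bdd_above ((\<lambda>s. d (\<gamma> s) (\<eta> s)) ` {0..1})"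
  proof (rule bdd_aboveI2)
    fix s :: real assume "s \<in> {0..1}"
    \<comment> \<open>The detour \<gamma>(s), \<gamma>(1), \<eta>(0), \<eta>(s) gives a bound
      independent of s; a real supremum says nothing without one.\<close>
    then show "d (\<gamma> s) (\<eta> s) \<le> d (\<gamma> 0) (\<gamma> 1) + d (\<gamma> 1) (\<eta> 0) + d (\<eta> 0) (\<eta> 1)"
      using G[OF assms(1), of s 1] G[OF assms(2), of 0 s]
        D(4)[of "\<gamma> s" "\<eta> s" "\<gamma> 1"] D(4)[of "\<gamma> 1" "\<eta> s" "\<eta> 0"] by simp
  qed
qed (use assms in auto)

text \<open>Evaluation does not increase distances and is therefore continuous. Its measurability is
  what gives meaning to the image measures \<open>interpolant\<close> and
  \<open>endpoint_plan\<close>.\<close>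

lemma openin_curve_eval_preimage:
  assumes U: "openin (forward_topology d) U" and t: "0 \<le> t" "t \<le> 1"
  shows "openin (curve_topology d) {\<gamma> \<in> geodesics d. \<gamma> t \<in> U}"
proof (subst openin_subopen, intro ballI)
  fix \<gamma> assume "\<gamma> \<in> {\<gamma> \<in> geodesics d. \<gamma> t \<in> U}"
  then have \<gamma>: "\<gamma> \<in> geodesics d" "\<gamma> t \<in> U" by auto
  obtain r where r: "r > 0" "forward_ball d (\<gamma> t) r \<subseteq> U"
    using U \<gamma>(2) unfolding openin_forward_topology_iff[OF forward_metric_space_irreversible] by blast
  let ?B = "{\<eta> \<in> geodesics d. curve_dist d \<gamma> \<eta> < r}"
  have "openin (curve_topology d) ?B"
    unfolding curve_topology_def forward_topology_on_def
    by (rule topology_generated_by_Basis) (use \<gamma>(1) r(1) in blast)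
  moreover have "\<gamma> \<in> ?B"
    using \<gamma>(1) r(1) irreversible_metricD(2)[OF forward_metric_space_irreversible]
    by (simp add: curve_dist_def)
  moreover have "?B \<subseteq> {\<gamma> \<in> geodesics d. \<gamma> t \<in> U}"
  proof
    fix \<eta> assume \<eta>: "\<eta> \<in> ?B"
    then have "d (\<gamma> t) (\<eta> t) < r"
      using dist_le_curve_dist[OF \<gamma>(1), of \<eta> t] t by auto
    then show "\<eta> \<in> {\<gamma> \<in> geodesics d. \<gamma> t \<in> U}"
      using \<eta> r(2) by (auto simp: forward_ball_def)
  qed
  ultimately show "\<exists>T. openin (curve_topology d) T \<and> \<gamma> \<in> T \<and> T \<subseteq> {\<gamma> \<in> geodesics d. \<gamma> t \<in> U}"
    by blast
qed

end

section \<open>Lebesgue decomposition and Jensen inequalities\<close>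

lemma emeasure_eq_pos_measure:
  assumes "emeasure M A \<noteq> 0" "emeasure M A \<noteq> \<infinity>"
  shows "emeasure M A = ennreal (measure M A)" "0 < measure M A"
proof -
  show eq: "emeasure M A = ennreal (measure M A)"
    using assms(2) by (intro emeasure_eq_ennreal_measure) simp
  show "0 < measure M A"
  proof (rule ccontr)
    assume "\<not> 0 < measure M A"
    then have "measure M A = 0" using measure_nonneg[of M A] by linarith
    then show False using assms(1) eq by simp
  qed
qed

text \<open>\<open>lebesgue_decomposition\<close> is a choice, so nothing is known about
  \<open>ac_density\<close> before a decomposition exists. Off a null set of maximal \<mu>-measure,
  \<mu> charges no further null set, and Radon-Nikodym applies there.\<close>

lemma ex_lebesgue_decomposition:
  assumes "sigma_finite_measure \<nu>" and "finite_measure \<mu>" and sets: "sets \<mu> = sets \<nu>"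
  shows "\<exists>\<rho> \<mu>\<^sub>s. is_lebesgue_decomposition \<nu> \<mu> \<rho> \<mu>\<^sub>s"
proof -
  interpret \<nu>: sigma_finite_measure \<nu> by fact
  interpret \<mu>: finite_measure \<mu> by fact
  note [measurable_cong] = sets
  have space: "space \<mu> = space \<nu>" using sets by (rule sets_eq_imp_space_eq)
  \<comment> \<open>The singular part lives on a \<open>\<nu>\<close>-null set \<open>S'\<close> of maximal \<open>\<mu>\<close>-measure.\<close>
  have "emeasure \<mu> ` null_sets \<nu> \<noteq> {}" by auto
  from ennreal_Sup_countable_SUP[OF this] obtain f :: "nat \<Rightarrow> ennreal"
    where f: "range f \<subseteq> emeasure \<mu> ` null_sets \<nu>" "Sup (emeasure \<mu> ` null_sets \<nu>) = (SUP i. f i)"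
    by blast
  have "\<forall>i. \<exists>S\<in>null_sets \<nu>. f i = emeasure \<mu> S" using f(1) by blast
  then obtain S where S: "\<And>i. S i \<in> null_sets \<nu>" "\<And>i. f i = emeasure \<mu> (S i)" by metis
  define S' where "S' = (\<Union>i. S i)"
  have S': "S' \<in> null_sets \<nu>" unfolding S'_def by (intro null_sets_UN S)
  then have S'_sets [measurable]: "S' \<in> sets \<nu>" by auto
  have max: "emeasure \<mu> (A - S') = 0" if A: "A \<in> null_sets \<nu>" for A
  proof -
    have AS: "A \<union> S' \<in> null_sets \<nu>" using A S' by auto
    have "emeasure \<mu> (A \<union> S') \<le> (SUP i. f i)"
      unfolding f(2)[symmetric] by (rule SUP_upper[OF AS])
    also have "\<dots> \<le> emeasure \<mu> S'"
      unfolding S(2) by (intro SUP_least emeasure_mono) (auto simp: S'_def sets S'_sets[unfolded S'_def])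
    finally have le: "emeasure \<mu> (A \<union> S') \<le> emeasure \<mu> S'" .
    have "emeasure \<mu> S' + emeasure \<mu> (A - S') = emeasure \<mu> (S' \<union> (A - S'))"
      using A by (intro plus_emeasure) (auto simp: sets)
    also have "S' \<union> (A - S') = A \<union> S'" by auto
    finally have "emeasure \<mu> S' + emeasure \<mu> (A - S') \<le> emeasure \<mu> S' + 0" using le by simp
    then show ?thesis by (simp add: ennreal_add_left_cancel_le)
  qed
  let ?ac = "density \<mu> (indicator (space \<nu> - S'))"
  let ?s = "density \<mu> (indicator S')"
  have ac_eq: "emeasure ?ac A = emeasure \<mu> (A - S')" if "A \<in> sets \<nu>" for A
  proof -
    have "A \<inter> (space \<nu> - S') = A - S'" using sets.sets_into_space[OF that] by auto
    then show ?thesis using that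
      by (subst emeasure_density) (auto simp: sets indicator_inter_arith[symmetric] mult.commute Int_commute)
  qed
  have s_eq: "emeasure ?s A = emeasure \<mu> (A \<inter> S')" if "A \<in> sets \<nu>" for A
    using that by (subst emeasure_density) (auto simp: sets indicator_inter_arith[symmetric] Int_commute)
  have "absolutely_continuous \<nu> ?ac"
    unfolding absolutely_continuous_def
  proof
    fix A assume "A \<in> null_sets \<nu>"
    then show "A \<in> null_sets ?ac" using max[of A] ac_eq[of A] by (intro null_setsI) (auto simp: sets)
  qed
  then obtain g where g [measurable]: "g \<in> borel_measurable \<nu>" and g_eq: "density \<nu> g = ?ac"
    using \<nu>.Radon_Nikodym[of ?ac] by (auto simp: sets)
  have "(\<integral>\<^sup>+x. g x \<partial>\<nu>) = emeasure (density \<nu> g) (space \<nu>)"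
    by (simp add: emeasure_density cong: nn_integral_cong)
  also have "\<dots> \<noteq> \<infinity>"
    unfolding g_eq using ac_eq[of "space \<nu>"] \<mu>.emeasure_finite by simp
  \<comment> \<open>The density of a decomposition has to be real-valued, which finiteness of \<mu>
    permits.\<close>
  finally have "AE x in \<nu>. g x \<noteq> \<infinity>" by (intro nn_integral_PInf_AE) auto
  then have g': "AE x in \<nu>. ennreal (enn2real (g x)) = g x" by (auto simp: less_top)
  have "is_lebesgue_decomposition \<nu> \<mu> (\<lambda>x. enn2real (g x)) ?s"
    unfolding is_lebesgue_decomposition_def
  proof (intro conjI ballI bexI[OF _ S'])
    have "(space \<nu> - S') \<inter> S' = {}" by auto
    then show "emeasure ?s (space \<nu> - S') = 0" by (subst s_eq) auto
    fix A assume A: "A \<in> sets \<nu>"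
    have "emeasure \<mu> A = emeasure \<mu> (A - S') + emeasure \<mu> (A \<inter> S')"
      using A by (subst plus_emeasure) (auto simp: sets Un_Diff_Int)
    also have "emeasure \<mu> (A - S') = (\<integral>\<^sup>+x\<in>A. g x \<partial>\<nu>)"
      using A by (simp add: ac_eq[symmetric] g_eq[symmetric] emeasure_density)
    also have "\<dots> = (\<integral>\<^sup>+x\<in>A. ennreal (enn2real (g x)) \<partial>\<nu>)"
      using g' by (intro nn_integral_cong_AE) auto
    finally show "emeasure \<mu> A = (\<integral>\<^sup>+x\<in>A. ennreal (enn2real (g x)) \<partial>\<nu>) + emeasure ?s A"
      using A by (simp add: s_eq)
  qed (auto simp: sets)
  then show ?thesis by blast
qed

lemma lebesgue_decomposition_spec:
  assumes "sigma_finite_measure \<nu>" "finite_measure \<mu>" "sets \<mu> = sets \<nu>"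
  shows "is_lebesgue_decomposition \<nu> \<mu> (ac_density \<nu> \<mu>) (singular_part \<nu> \<mu>)"
proof -
  obtain \<rho> \<mu>\<^sub>s where "is_lebesgue_decomposition \<nu> \<mu> \<rho> \<mu>\<^sub>s"
    using ex_lebesgue_decomposition[OF assms] by blast
  then have "case (\<rho>, \<mu>\<^sub>s) of (\<rho>, \<mu>\<^sub>s) \<Rightarrow> is_lebesgue_decomposition \<nu> \<mu> \<rho> \<mu>\<^sub>s" by simp
  then have "case lebesgue_decomposition \<nu> \<mu> of (\<rho>, \<mu>\<^sub>s) \<Rightarrow> is_lebesgue_decomposition \<nu> \<mu> \<rho> \<mu>\<^sub>s"
    unfolding lebesgue_decomposition_def by (rule someI)
  then show ?thesis
    unfolding ac_density_def singular_part_def by (simp add: split_beta)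
qed

context
  fixes \<nu> \<mu> :: "'a measure"
  assumes \<nu>: "sigma_finite_measure \<nu>" and \<mu>: "finite_measure \<mu>" and sets: "sets \<mu> = sets \<nu>"
begin

lemma ac_density_measurable: "ac_density \<nu> \<mu> \<in> borel_measurable \<nu>"
  using lebesgue_decomposition_spec[OF \<nu> \<mu> sets] unfolding is_lebesgue_decomposition_def by blast

lemma ac_density_nonneg: "0 \<le> ac_density \<nu> \<mu> x"
  using lebesgue_decomposition_spec[OF \<nu> \<mu> sets] unfolding is_lebesgue_decomposition_def by blast

lemma emeasure_eq_ac_density_plus_singular_part:
  "A \<in> sets \<nu> \<Longrightarrow>
    emeasure \<mu> A = (\<integral>\<^sup>+x\<in>A. ennreal (ac_density \<nu> \<mu> x) \<partial>\<nu>) + emeasure (singular_part \<nu> \<mu>) A"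
  using lebesgue_decomposition_spec[OF \<nu> \<mu> sets] unfolding is_lebesgue_decomposition_def by blast

lemma AE_ac_density_eq_0:
  assumes S [measurable]: "S \<in> sets \<nu>" and "emeasure \<mu> (space \<nu> - S) = 0"
  shows "AE x in \<nu>. x \<notin> S \<longrightarrow> ac_density \<nu> \<mu> x = 0"
proof -
  note [measurable] = ac_density_measurable
  have "(\<integral>\<^sup>+x\<in>space \<nu> - S. ennreal (ac_density \<nu> \<mu> x) \<partial>\<nu>) = 0"
    using emeasure_eq_ac_density_plus_singular_part[of "space \<nu> - S"] assms by simp
  then have "AE x in \<nu>. ennreal (ac_density \<nu> \<mu> x) * indicator (space \<nu> - S) x = 0"
    by (subst (asm) nn_integral_0_iff_AE) auto
  then show ?thesis
    using AE_space
  proof eventually_elim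
    case (elim x)
    then show ?case using ac_density_nonneg[of x] by (auto split: split_indicator_asm simp: ennreal_eq_0_iff)
  qed
qed

end

text \<open>The decomposition is only some choice, so uniqueness has to identify it. The null set
  carrying the singular part is also null for the uniform distribution, so the singular part
  vanishes and the densities agree almost everywhere.\<close>

lemma uniform_measure_decomposition:
  assumes \<nu>: "sigma_finite_measure \<nu>" and A [measurable]: "A \<in> sets \<nu>"
    and pos: "emeasure \<nu> A \<noteq> 0" and fin: "emeasure \<nu> A \<noteq> \<infinity>"
  shows "emeasure (singular_part \<nu> (uniform_measure \<nu> A)) (space \<nu>) = 0"
    and "AE x in \<nu>. ac_density \<nu> (uniform_measure \<nu> A) x = indicator A x / measure \<nu> A"
proof -
  interpret \<nu>: sigma_finite_measure \<nu> by fact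
  let ?\<mu> = "uniform_measure \<nu> A"
  interpret \<mu>: prob_space ?\<mu> using pos fin by (intro prob_space_uniform_measure) auto
  have fm: "finite_measure ?\<mu>" by unfold_locales
  note spec = lebesgue_decomposition_spec[OF \<nu> fm sets_uniform_measure]
  note [measurable] = ac_density_measurable[OF \<nu> fm sets_uniform_measure]
  note eq = emeasure_eq_ac_density_plus_singular_part[OF \<nu> fm sets_uniform_measure]
  let ?s = "singular_part \<nu> ?\<mu>"
  have s_sets: "sets ?s = sets \<nu>" using spec unfolding is_lebesgue_decomposition_def by blast
  obtain S where S: "S \<in> null_sets \<nu>" "emeasure ?s (space \<nu> - S) = 0"
    using spec unfolding is_lebesgue_decomposition_def by blast
  have "emeasure \<nu> (A \<inter> S) = 0" using S(1) A by (metis null_setsD1 null_set_Int1)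
  then have "emeasure ?\<mu> S = 0" using S(1) by (auto simp: emeasure_uniform_measure)
  then have "emeasure ?s S = 0" using eq[of S] S(1) by auto
  then have "emeasure ?s (S \<union> (space \<nu> - S)) = 0"
    using S by (subst emeasure_Un_null_set) (auto simp: s_sets intro!: null_setsI)
  moreover have "S \<union> (space \<nu> - S) = space \<nu>"
    using S(1) sets.sets_into_space[of S \<nu>] by auto
  ultimately show s0: "emeasure ?s (space \<nu>) = 0" by simp
  have s0': "emeasure ?s B = 0" if "B \<in> sets \<nu>" for B
    using emeasure_mono[of B "space \<nu>" ?s] s0 sets.sets_into_space[OF that] s_sets by auto
  have "density \<nu> (\<lambda>x. ennreal (ac_density \<nu> ?\<mu> x)) = density \<nu> (\<lambda>x. indicator A x / emeasure \<nu> A)"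
  proof (rule measure_eqI)
    fix B assume "B \<in> sets (density \<nu> (\<lambda>x. ennreal (ac_density \<nu> ?\<mu> x)))"
    then have [measurable]: "B \<in> sets \<nu>" by simp
    have "emeasure (density \<nu> (\<lambda>x. ennreal (ac_density \<nu> ?\<mu> x))) B = emeasure ?\<mu> B"
      using eq[of B] s0'[of B] by (simp add: emeasure_density)
    then show "emeasure (density \<nu> (\<lambda>x. ennreal (ac_density \<nu> ?\<mu> x))) B
        = emeasure (density \<nu> (\<lambda>x. indicator A x / emeasure \<nu> A)) B"
      unfolding uniform_measure_def .
  qed simp
  then have "AE x in \<nu>. ennreal (ac_density \<nu> ?\<mu> x) = indicator A x / emeasure \<nu> A"
    by (intro \<nu>.density_unique) auto
  then show "AE x in \<nu>. ac_density \<nu> ?\<mu> x = indicator A x / measure \<nu> A"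
  proof eventually_elim
    case (elim x)
    have "emeasure \<nu> A = ennreal (measure \<nu> A)" "measure \<nu> A > 0"
      using emeasure_eq_pos_measure[OF pos fin] by auto
    with elim have "ennreal (ac_density \<nu> ?\<mu> x) = ennreal (indicator A x / measure \<nu> A)"
      by (auto simp: indicator_def divide_ennreal[symmetric] ennreal_1[symmetric] simp del: ennreal_1)
    then show ?case
      using ac_density_nonneg[OF \<nu> fm sets_uniform_measure, of x] by (subst (asm) ennreal_inj) auto
  qed
qed

text \<open>Jensen in tangent form: with s = \<nu>(S), the concave power lies below its tangent at r
  = 1/s, the density of the uniform distribution on S. The tangent has positive slope, so it is
  enough that the absolutely continuous part has mass at most 1.\<close>

lemma powr_integral_le_ennpowr:
  assumes \<nu>: "sigma_finite_measure \<nu>" and \<mu>: "prob_space \<mu>" and sets: "sets \<mu> = sets \<nu>"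
    and S [measurable]: "S \<in> sets \<nu>" and conc: "emeasure \<mu> (space \<nu> - S) = 0" and M: "1 < M"
  shows "(\<integral>\<^sup>+x. ennreal (ac_density \<nu> \<mu> x powr (1 - 1 / M)) \<partial>\<nu>) \<le> ennpowr (emeasure \<nu> S) (1 / M)"
proof -
  interpret \<mu>: prob_space \<mu> by fact
  have fm: "finite_measure \<mu>" by unfold_locales
  let ?\<rho> = "ac_density \<nu> \<mu>" and ?s = "enn2real (emeasure \<nu> S)"
  note [measurable] = ac_density_measurable[OF \<nu> fm sets]
  note nn = ac_density_nonneg[OF \<nu> fm sets]
  have "(\<integral>\<^sup>+x\<in>S. ennreal (?\<rho> x) \<partial>\<nu>) \<le> emeasure \<mu> S"
    using emeasure_eq_ac_density_plus_singular_part[OF \<nu> fm sets S] by simp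
  also have "\<dots> \<le> 1" by (rule \<mu>.emeasure_le_1)
  finally have mass: "(\<integral>\<^sup>+x\<in>S. ennreal (?\<rho> x) \<partial>\<nu>) \<le> 1" .
  have "AE x in \<nu>. x \<notin> S \<longrightarrow> ?\<rho> x = 0" by (rule AE_ac_density_eq_0[OF \<nu> fm sets S conc])
  then have int: "(\<integral>\<^sup>+x. ennreal (?\<rho> x powr (1 - 1 / M)) \<partial>\<nu>)
      = (\<integral>\<^sup>+x. ennreal (?\<rho> x powr (1 - 1 / M)) * indicator S x \<partial>\<nu>)"
    by (intro nn_integral_cong_AE) (auto split: split_indicator)
  consider "emeasure \<nu> S = \<infinity>" | "emeasure \<nu> S = 0" | "emeasure \<nu> S = ennreal ?s" "?s > 0"
    by (metis enn2real_positive_iff ennreal_enn2real infinity_ennreal_def top.not_eq_extremum zero_less_iff_neq_zero)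
  then show ?thesis
  proof cases
    case 1
    then show ?thesis by (simp add: ennpowr_def)
  next
    case 2
    then have "AE x in \<nu>. x \<notin> S" by (intro AE_not_in null_setsI S)
    then have "(\<integral>\<^sup>+x. ennreal (?\<rho> x powr (1 - 1 / M)) * indicator S x \<partial>\<nu>) = (\<integral>\<^sup>+x. 0 \<partial>\<nu>)"
      by (intro nn_integral_cong_AE) auto
    then show ?thesis unfolding int by simp
  next
    case 3
    let ?c = "?s powr (1 / M)"
    \<comment> \<open>Young's inequality for r and 1/s with weights 1 - 1/M and 1/M, multiplied by
      \<open>?c\<close>; the right side is the tangent at 1/s.\<close>
    have young: "r powr (1 - 1 / M) \<le> ?c * (1 - 1 / M) * r + ?c * (1 / M / ?s)" if "r \<ge> 0" for r
    proof (cases "r = 0")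
      case False
      have "r powr (1 - 1 / M) * (1 / ?s) powr (1 / M) \<le> (1 - 1 / M) * r + 1 / M * (1 / ?s)"
        using that False M 3(2) by (intro Youngs_inequality_0) auto
      then have "?c * (r powr (1 - 1 / M) * (1 / ?s) powr (1 / M)) \<le> ?c * ((1 - 1 / M) * r + 1 / M * (1 / ?s))"
        by (rule mult_left_mono) simp
      moreover have "?c * (r powr (1 - 1 / M) * (1 / ?s) powr (1 / M)) = r powr (1 - 1 / M)"
        using 3(2) by (simp add: powr_divide)
      ultimately show ?thesis by (simp only: distrib_left mult.assoc mult.left_commute times_divide_eq_right mult_1_right divide_divide_eq_left)
    qed (use M 3 in simp)
    have "(\<integral>\<^sup>+x. ennreal (?\<rho> x powr (1 - 1 / M)) * indicator S x \<partial>\<nu>)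
       \<le> (\<integral>\<^sup>+x. ennreal (?c * (1 - 1 / M)) * (ennreal (?\<rho> x) * indicator S x)
              + ennreal (?c * (1 / M / ?s)) * indicator S x \<partial>\<nu>)"
    proof (intro nn_integral_mono)
      fix x
      have "ennreal (?\<rho> x powr (1 - 1 / M)) \<le> ennreal (?c * (1 - 1 / M) * ?\<rho> x + ?c * (1 / M / ?s))"
        using young[OF nn] by (rule ennreal_leI)
      also have "\<dots> = ennreal (?c * (1 - 1 / M)) * ennreal (?\<rho> x) + ennreal (?c * (1 / M / ?s))"
        using M nn[of x] by (subst ennreal_plus) (auto simp: ennreal_mult)
      finally show "ennreal (?\<rho> x powr (1 - 1 / M)) * indicator S x
        \<le> ennreal (?c * (1 - 1 / M)) * (ennreal (?\<rho> x) * indicator S x)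
              + ennreal (?c * (1 / M / ?s)) * indicator S x"
        by (auto split: split_indicator)
    qed
    also have "\<dots> = ennreal (?c * (1 - 1 / M)) * (\<integral>\<^sup>+x\<in>S. ennreal (?\<rho> x) \<partial>\<nu>)
        + ennreal (?c * (1 / M / ?s)) * emeasure \<nu> S"
      by (subst nn_integral_add) (auto simp: nn_integral_cmult nn_integral_cmult_indicator)
    also have "\<dots> \<le> ennreal (?c * (1 - 1 / M)) * 1 + ennreal (?c * (1 / M / ?s)) * ennreal ?s"
      using mass 3(1) by (intro add_mono mult_left_mono) auto
    also have "\<dots> = ennreal (?c * (1 - 1 / M) + ?c * (1 / M))"
      using M 3(2) by (simp add: ennreal_mult[symmetric] ennreal_plus[symmetric] del: ennreal_plus)
    also have "\<dots> = ennpowr (emeasure \<nu> S) (1 / M)"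
      using 3(1) ennreal_neq_top[of ?s] by (simp only: ennpowr_def) (simp add: algebra_simps)
    finally show ?thesis unfolding int .
  qed
qed

lemma ln_ge_one_minus_inverse: "1 - 1 / x \<le> ln x" if "0 < x" for x :: real
  using ln_le_minus_one[of "1 / x"] that by (simp add: ln_div)

lemma enn2ereal_eq_ereal_enn2real: "z < \<infinity> \<Longrightarrow> enn2ereal z = ereal (enn2real z)"
  by (cases z rule: ennreal_cases) (auto simp: enn2ereal_ennreal)

text \<open>The slope of r ln r at infinity is \<infinity>, so a finite bound on the functional
  leaves no room for a singular part. The whole mass 1 then sits in the density, which forces
  \<nu>(S) > 0.\<close>

lemma entropy_lower_bound:
  assumes \<nu>: "sigma_finite_measure \<nu>" and \<mu>: "prob_space \<mu>" and sets: "sets \<mu> = sets \<nu>"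
    and S [measurable]: "S \<in> sets \<nu>" and conc: "emeasure \<mu> (space \<nu> - S) = 0"
    and fin: "emeasure \<nu> S \<noteq> \<infinity>"
    and le: "U_functional (\<lambda>r. r * ln r) \<nu> \<mu> \<le> ereal c"
  shows "emeasure \<nu> S \<noteq> 0" and "- ln (measure \<nu> S) \<le> c"
proof -
  interpret \<mu>: prob_space \<mu> by fact
  have fm: "finite_measure \<mu>" by unfold_locales
  let ?\<rho> = "ac_density \<nu> \<mu>" and ?s = "measure \<nu> S" and ?U = "\<lambda>r::real. r * ln r"
  let ?E = "extended_integral \<nu> (\<lambda>x. ereal (?U (?\<rho> x)))"
  note [measurable] = ac_density_measurable[OF \<nu> fm sets]
  note nn = ac_density_nonneg[OF \<nu> fm sets]
  have space: "space \<mu> = space \<nu>" using sets by (rule sets_eq_imp_space_eq)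
  have slope: "slope_at_infinity ?U = \<infinity>"
    unfolding slope_at_infinity_def
  proof (rule tendsto_Lim)
    have "((\<lambda>r::real. ereal (ln r)) \<longlongrightarrow> \<infinity>) at_top"
      using ln_at_top by (simp add: tendsto_PInfty_eq_at_top)
    then show "((\<lambda>r::real. ereal (r * ln r / r)) \<longlongrightarrow> \<infinity>) at_top"
      by (rule Lim_transform_eventually) (auto intro: eventually_mono[OF eventually_gt_at_top[of 0]])
  qed simp
  have s0: "emeasure (singular_part \<nu> \<mu>) (space \<nu>) = 0"
  proof (rule ccontr)
    assume "emeasure (singular_part \<nu> \<mu>) (space \<nu>) \<noteq> 0"
    then have "\<infinity> * enn2ereal (emeasure (singular_part \<nu> \<mu>) (space \<nu>)) = \<infinity>"
      by (cases "emeasure (singular_part \<nu> \<mu>) (space \<nu>)" rule: ennreal_cases)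
         (auto simp: enn2ereal_ennreal)
    then have "U_functional ?U \<nu> \<mu> = ?E + \<infinity>"
      unfolding U_functional_def slope by simp
    then show False using le by simp
  qed
  have AE0: "AE x in \<nu>. x \<notin> S \<longrightarrow> ?\<rho> x = 0" by (rule AE_ac_density_eq_0[OF \<nu> fm sets S conc])
  have "(\<integral>\<^sup>+x\<in>space \<nu>. ennreal (?\<rho> x) \<partial>\<nu>) = 1"
    using emeasure_eq_ac_density_plus_singular_part[OF \<nu> fm sets, of "space \<nu>"] s0
      \<mu>.emeasure_space_1 by (simp add: space)
  then have mass: "(\<integral>\<^sup>+x. ennreal (?\<rho> x) \<partial>\<nu>) = 1"
    by (simp cong: nn_integral_cong)
  show S0: "emeasure \<nu> S \<noteq> 0"
  proof
    assume "emeasure \<nu> S = 0"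
    then have "AE x in \<nu>. x \<notin> S" by (intro AE_not_in null_setsI S)
    with AE0 have "AE x in \<nu>. ennreal (?\<rho> x) = 0" by eventually_elim simp
    then have "(\<integral>\<^sup>+x. ennreal (?\<rho> x) \<partial>\<nu>) = (\<integral>\<^sup>+x. 0 \<partial>\<nu>)" by (rule nn_integral_cong_AE)
    then show False using mass by simp
  qed
  have s: "emeasure \<nu> S = ennreal ?s" "0 < ?s"
    using emeasure_eq_pos_measure[OF S0 fin] by auto
  have int\<rho>: "integrable \<nu> ?\<rho>"
    using mass nn by (intro integrableI_nonneg) auto
  have mass': "integral\<^sup>L \<nu> ?\<rho> = 1"
    using mass nn by (subst integral_eq_nn_integral) auto
  have intS: "integrable \<nu> (indicator S :: 'a \<Rightarrow> real)"
    using fin by (intro integrable_real_indicator) (auto simp: less_top)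
  have E: "?E \<le> ereal c"
    using le unfolding U_functional_def s0 by (simp add: zero_ennreal.rep_eq)
  \<comment> \<open>As -r ln r never exceeds 1 and S has finite measure, the negative part is
    integrable; the upper bound then makes the positive part integrable too. Only now can the
    extended integral be replaced by a Bochner integral.\<close>
  have "AE x in \<nu>. ennreal (- ?U (?\<rho> x)) \<le> indicator S x"
    using AE0
  proof eventually_elim
    case (elim x)
    have "- ?U (?\<rho> x) \<le> 1"
    proof (cases "?\<rho> x = 0")
      case False
      then have "?\<rho> x > 0" using nn[of x] by simp
      then have "?\<rho> x * (1 - 1 / ?\<rho> x) \<le> ?\<rho> x * ln (?\<rho> x)"
        by (intro mult_left_mono ln_ge_one_minus_inverse) auto
      then show ?thesis using \<open>?\<rho> x > 0\<close> by (simp add: algebra_simps)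
    qed simp
    then have "ennreal (- ?U (?\<rho> x)) \<le> ennreal 1" by (rule ennreal_leI)
    with elim show ?case by (auto split: split_indicator)
  qed
  then have "(\<integral>\<^sup>+x. ennreal (- ?U (?\<rho> x)) \<partial>\<nu>) \<le> (\<integral>\<^sup>+x. indicator S x \<partial>\<nu>)"
    by (rule nn_integral_mono_AE)
  then have neg: "(\<integral>\<^sup>+x. ennreal (- ?U (?\<rho> x)) \<partial>\<nu>) < \<infinity>"
    using fin by (simp add: less_top order_le_less_trans)
  let ?P = "\<integral>\<^sup>+x. ennreal (?U (?\<rho> x)) \<partial>\<nu>" and ?N = "\<integral>\<^sup>+x. ennreal (- ?U (?\<rho> x)) \<partial>\<nu>"
  have E_eq: "?E = enn2ereal ?P - enn2ereal ?N"
    unfolding extended_integral_def by simp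
  have "?P < \<infinity>"
  proof (rule ccontr)
    assume "\<not> ?P < \<infinity>"
    then have "?P = \<infinity>" by (metis infinity_ennreal_def top.not_eq_extremum)
    then have "?E = \<infinity>" unfolding E_eq by simp
    then show False using E by simp
  qed
  then have intU: "integrable \<nu> (\<lambda>x. ?U (?\<rho> x))"
    using neg by (auto simp: real_integrable_def)
  have "?E = ereal (enn2real ?P) - ereal (enn2real ?N)"
    unfolding E_eq using \<open>?P < \<infinity>\<close> neg enn2ereal_eq_ereal_enn2real by simp
  also have "\<dots> = ereal (\<integral>x. ?U (?\<rho> x) \<partial>\<nu>)"
    by (simp add: real_lebesgue_integral_def[OF intU])
  finally have c: "(\<integral>x. ?U (?\<rho> x) \<partial>\<nu>) \<le> c" using E by simp
  \<comment> \<open>The tangent of r ln r at 1/s, cut off outside S. It integrates to (1 - ln s) -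
    1.\<close>
  have "AE x in \<nu>. (1 - ln ?s) * ?\<rho> x - 1 / ?s * indicator S x \<le> ?U (?\<rho> x)"
    using AE0
  proof eventually_elim
    case (elim x)
    show ?case
    proof (cases "?\<rho> x = 0")
      case True
      then show ?thesis using s(2) by (auto split: split_indicator)
    next
      case False
      then have pos: "?\<rho> x > 0" "x \<in> S" using nn[of x] elim by auto
      have "?\<rho> x * (1 - 1 / (?s * ?\<rho> x)) \<le> ?\<rho> x * ln (?s * ?\<rho> x)"
        using pos s(2) by (intro mult_left_mono ln_ge_one_minus_inverse) auto
      then show ?thesis using pos s(2) by (simp add: ln_mult algebra_simps)
    qed
  qed
  then have "(\<integral>x. (1 - ln ?s) * ?\<rho> x - 1 / ?s * indicator S x \<partial>\<nu>) \<le> (\<integral>x. ?U (?\<rho> x) \<partial>\<nu>)"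
    using int\<rho> intS intU by (intro integral_mono_AE) auto
  also have "(\<integral>x. (1 - ln ?s) * ?\<rho> x - 1 / ?s * indicator S x \<partial>\<nu>) = (1 - ln ?s) * 1 - 1 / ?s * ?s"
    using int\<rho> intS mass' by (subst Bochner_Integration.integral_diff) auto
  finally show "- ln ?s \<le> c" using c s(2) by simp
qed

section \<open>Nonlinear functionals\<close>

text \<open>The functional is a difference of two integrals, which are bounded separately. For c
  \<ge> 0 the subtracted integral is dropped; for c < 0 the first one vanishes and the bound comes
  from the second.\<close>

lemma iterated_integral_le:
  assumes A [measurable]: "A \<in> sets \<nu>" and fin: "emeasure \<nu> A \<noteq> \<infinity>"
    and inside: "AE x in \<nu>. x \<in> A \<longrightarrow> prob_space (\<kappa> x) \<and> (AE y in \<kappa> x. f x y \<le> ereal c)"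
    and outside: "AE x in \<nu>. x \<notin> A \<longrightarrow> (\<forall>y. f x y = 0)"
  shows "iterated_integral \<nu> \<kappa> f \<le> ereal (c * measure \<nu> A)"
proof -
  have m: "emeasure \<nu> A = ennreal (measure \<nu> A)"
    using fin by (simp add: emeasure_eq_ennreal_measure)
  let ?P = "\<integral>\<^sup>+x. (\<integral>\<^sup>+y. e2ennreal (f x y) \<partial>\<kappa> x) \<partial>\<nu>"
  let ?N = "\<integral>\<^sup>+x. (\<integral>\<^sup>+y. e2ennreal (- f x y) \<partial>\<kappa> x) \<partial>\<nu>"
  have "?P \<le> (\<integral>\<^sup>+x. ennreal c * indicator A x \<partial>\<nu>)"
  proof (rule nn_integral_mono_AE)
    show "AE x in \<nu>. (\<integral>\<^sup>+y. e2ennreal (f x y) \<partial>\<kappa> x) \<le> ennreal c * indicator A x"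
      using inside outside
    proof eventually_elim
      case (elim x)
      show ?case
      proof (cases "x \<in> A")
        case True
        then interpret prob_space "\<kappa> x" using elim by simp
        have "(\<integral>\<^sup>+y. e2ennreal (f x y) \<partial>\<kappa> x) \<le> (\<integral>\<^sup>+y. ennreal c \<partial>\<kappa> x)"
        proof (rule nn_integral_mono_AE)
          have "AE y in \<kappa> x. f x y \<le> ereal c" using elim True by simp
          then show "AE y in \<kappa> x. e2ennreal (f x y) \<le> ennreal c"
            by eventually_elim (metis e2ennreal_mono e2ennreal_ereal)
        qed
        then show ?thesis using True by (simp add: emeasure_space_1)
      qed (use elim in simp)
    qed
  qed
  also have "\<dots> = ennreal c * emeasure \<nu> A" by (simp add: nn_integral_cmult_indicator)
  finally have P: "?P \<le> ennreal c * emeasure \<nu> A" .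
  have "ennreal (- c) * emeasure \<nu> A = (\<integral>\<^sup>+x. ennreal (- c) * indicator A x \<partial>\<nu>)"
    by (simp add: nn_integral_cmult_indicator)
  also have "\<dots> \<le> ?N"
  proof (rule nn_integral_mono_AE)
    show "AE x in \<nu>. ennreal (- c) * indicator A x \<le> (\<integral>\<^sup>+y. e2ennreal (- f x y) \<partial>\<kappa> x)"
      using inside
    proof eventually_elim
      case (elim x)
      show ?case
      proof (cases "x \<in> A")
        case True
        then interpret prob_space "\<kappa> x" using elim by simp
        have "(\<integral>\<^sup>+y. ennreal (- c) \<partial>\<kappa> x) \<le> (\<integral>\<^sup>+y. e2ennreal (- f x y) \<partial>\<kappa> x)"
        proof (rule nn_integral_mono_AE)
          have "AE y in \<kappa> x. f x y \<le> ereal c" using elim True by simp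
          then show "AE y in \<kappa> x. ennreal (- c) \<le> e2ennreal (- f x y)"
            by eventually_elim (metis e2ennreal_mono e2ennreal_ereal ereal_minus_le_minus uminus_ereal.simps(1))
        qed
        then show ?thesis using True by (simp add: emeasure_space_1)
      qed simp
    qed
  qed
  finally have N: "ennreal (- c) * emeasure \<nu> A \<le> ?N" .
  show ?thesis
  proof (cases "0 \<le> c")
    case True
    have "iterated_integral \<nu> \<kappa> f \<le> enn2ereal ?P"
      unfolding iterated_integral_def by (rule ereal_diff_le_self) simp
    also have "\<dots> \<le> enn2ereal (ennreal c * emeasure \<nu> A)"
      using P by (simp add: less_eq_ennreal.rep_eq)
    also have "\<dots> = ereal (c * measure \<nu> A)"
      using True by (simp add: m ennreal_mult[symmetric] enn2ereal_ennreal)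
    finally show ?thesis .
  next
    case False
    then have "?P = 0" using P by (simp add: ennreal_neg)
    then have "iterated_integral \<nu> \<kappa> f = - enn2ereal ?N"
      unfolding iterated_integral_def by (simp add: zero_ennreal.rep_eq)
    also have "\<dots> \<le> - enn2ereal (ennreal (- c) * emeasure \<nu> A)"
      using N by (simp add: less_eq_ennreal.rep_eq)
    also have "\<dots> = ereal (c * measure \<nu> A)"
      using False mult_nonpos_nonneg[of c "measure \<nu> A"]
      by (simp add: m ennreal_mult[symmetric] enn2ereal_ennreal)
    finally show ?thesis .
  qed
qed

lemma ennpowr_mono: "x \<le> y \<Longrightarrow> 0 \<le> a \<Longrightarrow> ennpowr x a \<le> ennpowr y a"
  unfolding ennpowr_def
  by (auto simp: top_unique intro!: ennreal_leI powr_mono2 enn2real_mono simp: less_top)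

text \<open>Up to a factor and a linear term, the Renyi entropy density of dimension
  \<open>M\<close>. The parameter is kept apart from N because at \<open>M = 1\<close> the exponent
  is 0 and the function jumps at 0, so it is not in \<open>DC N\<close>.\<close>

abbreviation (input) neg_powr :: "real \<Rightarrow> real \<Rightarrow> real" where
  "neg_powr M \<equiv> (\<lambda>r. - (r powr (1 - 1 / M)))"

lemma slope_at_infinity_neg_powr: "1 < M \<Longrightarrow> slope_at_infinity (neg_powr M) = 0"
  unfolding slope_at_infinity_def
proof (rule tendsto_Lim)
  assume "1 < M"
  then have "((\<lambda>r::real. - (r powr (- (1 / M)))) \<longlongrightarrow> - 0) at_top"
    by (intro tendsto_minus tendsto_neg_powr filterlim_ident) auto
  then have "((\<lambda>r::real. ereal (- (r powr (- (1 / M))))) \<longlongrightarrow> 0) at_top"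
    unfolding zero_ereal_def by (intro tendsto_ereal) simp
  then show "((\<lambda>r::real. ereal (- (r powr (1 - 1 / M)) / r)) \<longlongrightarrow> 0) at_top"
    by (rule Lim_transform_eventually)
      (auto intro!: eventually_mono[OF eventually_gt_at_top[of 0]] simp: powr_diff powr_minus field_simps)
qed simp

lemma slope_at_zero_neg_powr: "1 < M \<Longrightarrow> slope_at_zero (neg_powr M) = - \<infinity>"
  unfolding slope_at_zero_def
proof (rule tendsto_Lim)
  assume M: "1 < M"
  have "((\<lambda>r::real. r powr (1 / M)) \<longlongrightarrow> 0) (at_right 0)"
    using M by real_asymp
  then have "filterlim (\<lambda>r::real. inverse (r powr (1 / M))) at_top (at_right 0)"
    by (rule filterlim_inverse_at_top) (auto simp: eventually_at_right_less intro!: eventually_mono[OF eventually_at_right_less[of 0]])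
  then have "((\<lambda>r::real. ereal (inverse (r powr (1 / M)))) \<longlongrightarrow> \<infinity>) (at_right 0)"
    by (simp add: tendsto_PInfty_eq_at_top)
  from tendsto_uminus_ereal[OF this]
  have "((\<lambda>r::real. ereal (- inverse (r powr (1 / M)))) \<longlongrightarrow> - \<infinity>) (at_right 0)"
    by simp
  then show "((\<lambda>r::real. ereal (- (r powr (1 - 1 / M)) / r)) \<longlongrightarrow> - \<infinity>) (at_right 0)"
    by (rule Lim_transform_eventually)
      (auto intro!: eventually_mono[OF eventually_at_right_less[of 0]] simp: powr_diff field_simps)
qed simp

text \<open>The power splits as (r/b)^(1-1/M) b = r^(1-1/M) b^(1/M). At b = \<infinity> the slope
  -\<infinity> at zero gives the same formula, with 0 * \<infinity> = 0 covering a vanishing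
  density.\<close>

lemma U_distorted_neg_powr:
  assumes M: "1 < M" and r: "0 \<le> r"
  shows "U_distorted (neg_powr M) r b = - enn2ereal (ennreal (r powr (1 - 1 / M)) * ennpowr b (1 / M))"
proof (cases "b = \<infinity>")
  case True
  show ?thesis
  proof (cases "r = 0")
    case False
    then have "ennreal (r powr (1 - 1 / M)) * \<infinity> = \<infinity>" using r by (simp add: ennreal_mult_top)
    then show ?thesis
      using True False r by (simp add: U_distorted_def slope_at_zero_neg_powr M ennpowr_def)
  qed (use True M in \<open>simp add: U_distorted_def zero_ennreal.rep_eq zero_ereal_def[symmetric]\<close>)
next
  case False
  define c where "c = enn2real b"
  have c: "0 \<le> c" by (simp add: c_def)
  have "(r / c) powr (1 - 1 / M) * c = r powr (1 - 1 / M) * c powr (1 / M)"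
  proof (cases "c = 0")
    case False
    then have "c = c powr (1 - 1 / M) * c powr (1 / M)"
      using c by (simp add: powr_add[symmetric])
    then show ?thesis using c False r
      by (smt (verit) nonzero_mult_div_cancel_left powr_divide powr_eq_0_iff times_divide_eq_left mult.assoc mult.commute)
  qed simp
  then show ?thesis using False c
    by (simp add: U_distorted_def ennpowr_def c_def[symmetric] ennreal_mult[symmetric] enn2ereal_ennreal)
qed

text \<open>The integrand has one sign and the singular part enters with slope 0. So no difference
  of infinities remains, and the dependence on \<open>b\<close> is monotone.\<close>

lemma U_beta_functional_neg_powr:
  assumes "1 < M" and "\<And>x. 0 \<le> ac_density \<nu> \<mu> x"
  shows "U_beta_functional (neg_powr M) \<nu> b \<kappa> \<mu> = - enn2ereal
    (\<integral>\<^sup>+x. (\<integral>\<^sup>+y. ennreal (ac_density \<nu> \<mu> x powr (1 - 1 / M)) * ennpowr (b x y) (1 / M) \<partial>\<kappa> x) \<partial>\<nu>)"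
proof -
  have "e2ennreal (- enn2ereal z) = 0" for z
    using e2ennreal_neg[of "- enn2ereal z"] by simp
  then show ?thesis
    unfolding U_beta_functional_def iterated_integral_def slope_at_infinity_neg_powr[OF assms(1)]
      U_distorted_neg_powr[OF assms]
    by (simp add: zero_ennreal.rep_eq)
qed

lemma U_functional_neg_powr:
  assumes "1 < M"
  shows "U_functional (neg_powr M) \<nu> \<mu> = - enn2ereal
    (\<integral>\<^sup>+x. ennreal (ac_density \<nu> \<mu> x powr (1 - 1 / M)) \<partial>\<nu>)"
  unfolding U_functional_def extended_integral_def slope_at_infinity_neg_powr[OF assms]
  by (simp add: ennreal_neg zero_ennreal.rep_eq)

text \<open>On A the density is the constant 1/\<nu>(A) and each kernel has mass 1, so
  \<open>?c\<close> bounds the inner integral there. Integrating it over A leaves the power 1 - (1 -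
  1/M) = 1/M of \<nu>(A).\<close>

lemma powr_integral_ge_ennpowr:
  assumes \<nu>: "sigma_finite_measure \<nu>" and A [measurable]: "A \<in> sets \<nu>"
    and pos: "emeasure \<nu> A \<noteq> 0" and fin: "emeasure \<nu> A \<noteq> \<infinity>" and M: "1 < M"
    and inside: "AE x in \<nu>. x \<in> A \<longrightarrow> prob_space (\<kappa> x) \<and> (AE y in \<kappa> x. I \<le> b x y)"
  shows "ennpowr I (1 / M) * ennpowr (emeasure \<nu> A) (1 / M) \<le>
    (\<integral>\<^sup>+x. (\<integral>\<^sup>+y. ennreal (ac_density \<nu> (uniform_measure \<nu> A) x powr (1 - 1 / M)) *
       ennpowr (b x y) (1 / M) \<partial>\<kappa> x) \<partial>\<nu>)"
proof -
  let ?m = "measure \<nu> A" and ?\<rho> = "ac_density \<nu> (uniform_measure \<nu> A)"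
  have m: "emeasure \<nu> A = ennreal ?m" "0 < ?m"
    using emeasure_eq_pos_measure[OF pos fin] by auto
  let ?c = "ennreal ((1 / ?m) powr (1 - 1 / M)) * ennpowr I (1 / M)"
  have "(1 / ?m) powr (1 - 1 / M) * ?m = ?m powr (1 / M)"
    using m(2) by (simp add: powr_divide powr_diff field_simps)
  then have "ennpowr I (1 / M) * ennpowr (emeasure \<nu> A) (1 / M) = ?c * emeasure \<nu> A"
    using m by (simp add: ennpowr_def ennreal_mult[symmetric] mult.assoc mult.commute mult.left_commute)
  also have "\<dots> = (\<integral>\<^sup>+x. ?c * indicator A x \<partial>\<nu>)" by (simp add: nn_integral_cmult_indicator)
  also have "\<dots> \<le> (\<integral>\<^sup>+x. (\<integral>\<^sup>+y. ennreal (?\<rho> x powr (1 - 1 / M)) * ennpowr (b x y) (1 / M) \<partial>\<kappa> x) \<partial>\<nu>)"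
  proof (rule nn_integral_mono_AE)
    show "AE x in \<nu>. ?c * indicator A x \<le>
        (\<integral>\<^sup>+y. ennreal (?\<rho> x powr (1 - 1 / M)) * ennpowr (b x y) (1 / M) \<partial>\<kappa> x)"
      using inside uniform_measure_decomposition(2)[OF \<nu> A pos fin]
    proof eventually_elim
      case (elim x)
      show ?case
      proof (cases "x \<in> A")
        case True
        then interpret prob_space "\<kappa> x" using elim by simp
        have "(\<integral>\<^sup>+y. ?c \<partial>\<kappa> x) \<le> (\<integral>\<^sup>+y. ennreal (?\<rho> x powr (1 - 1 / M)) * ennpowr (b x y) (1 / M) \<partial>\<kappa> x)"
        proof (rule nn_integral_mono_AE)
          have "AE y in \<kappa> x. I \<le> b x y" using elim True by simp
          then show "AE y in \<kappa> x. ?c \<le> ennreal (?\<rho> x powr (1 - 1 / M)) * ennpowr (b x y) (1 / M)"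
            by eventually_elim (use True elim M in \<open>simp add: mult_left_mono ennpowr_mono\<close>)
        qed
        then show ?thesis using True by (simp add: emeasure_space_1)
      qed simp
    qed
  qed
  finally show ?thesis .
qed

text \<open>Lower bounds on \<beta> are available only on the product of the two given sets; this
  transfers the concentration of a plan to almost all of its kernels.\<close>

lemma disintegrates_AE_prob_space:
  assumes dis: "disintegrates B \<pi> \<mu> \<kappa>" and sets: "sets \<mu> = sets B" and C [measurable]: "C \<in> sets B"
    and null: "emeasure \<pi> (space B \<times> (space B - C)) = 0"
  shows "AE x in \<mu>. prob_space (\<kappa> x) \<and> (AE y in \<kappa> x. y \<in> C)"
proof -
  note [measurable_cong] = sets
  have space: "space \<mu> = space B" using sets by (rule sets_eq_imp_space_eq)
  have \<kappa>: "\<kappa> \<in> B \<rightarrow>\<^sub>M prob_algebra B" using dis by (simp add: disintegrates_def)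
  have [measurable]: "\<kappa> \<in> B \<rightarrow>\<^sub>M subprob_algebra B" using \<kappa> by (rule measurable_prob_algebraD)
  have k: "prob_space (\<kappa> x)" "sets (\<kappa> x) = sets B" if "x \<in> space B" for x
    using measurable_space[OF \<kappa> that] by (auto simp: space_prob_algebra)
  have "0 = (\<integral>\<^sup>+x. emeasure (\<kappa> x) {y \<in> space B. (x, y) \<in> space B \<times> (space B - C)} \<partial>\<mu>)"
    using dis null unfolding disintegrates_def by auto
  also have "\<dots> = (\<integral>\<^sup>+x. emeasure (\<kappa> x) (space B - C) \<partial>\<mu>)"
    by (intro nn_integral_cong arg_cong2[where f=emeasure]) (auto simp: space)
  finally have "AE x in \<mu>. emeasure (\<kappa> x) (space B - C) = 0"
    by (subst (asm) eq_commute, subst (asm) nn_integral_0_iff_AE) auto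
  then show ?thesis
    using AE_space
  proof eventually_elim
    case (elim x)
    then have x: "x \<in> space B" by (simp add: space)
    have "AE y in \<kappa> x. y \<in> C"
      using k(2)[OF x] elim(1) sets_eq_imp_space_eq[OF k(2)[OF x]]
      by (intro AE_I[of _ _ "space B - C"]) auto
    then show ?case using k(1)[OF x] by simp
  qed
qed

section \<open>Distortion coefficients\<close>

lemma nonneg_of_deriv_nonneg:
  fixes f f' :: "real \<Rightarrow> real"
  assumes "\<And>x. 0 \<le> x \<Longrightarrow> x \<le> b \<Longrightarrow> (f has_real_derivative f' x) (at x)"
    and "\<And>x. 0 \<le> x \<Longrightarrow> x \<le> b \<Longrightarrow> 0 \<le> f' x" and "f 0 = 0" and "0 \<le> b"
  shows "0 \<le> f b"
  using DERIV_nonneg_imp_nondecreasing[of 0 b f] assms by metis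

lemma mult_cos_le_sin: "0 \<le> x \<Longrightarrow> x \<le> pi \<Longrightarrow> x * cos x \<le> sin x" for x :: real
proof -
  assume x: "0 \<le> x" "x \<le> pi"
  have "0 \<le> sin x - x * cos x"
  proof (rule nonneg_of_deriv_nonneg[where f = "\<lambda>x. sin x - x * cos x" and b = x and f' = "\<lambda>x. x * sin x"])
    fix y assume "0 \<le> y" "y \<le> x"
    then show "0 \<le> y * sin y" using x by (intro mult_nonneg_nonneg sin_ge_zero) auto
  qed (use x in \<open>auto intro!: derivative_eq_intros\<close>)
  then show ?thesis by simp
qed

lemma sinh_le_mult_cosh: "0 \<le> x \<Longrightarrow> sinh x \<le> x * cosh x" for x :: real
proof -
  assume x: "0 \<le> x"
  have "0 \<le> x * cosh x - sinh x"
    by (rule nonneg_of_deriv_nonneg[where f = "\<lambda>x. x * cosh x - sinh x" and b = x and f' = "\<lambda>x. x * sinh x"])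
      (use x in \<open>auto intro!: derivative_eq_intros\<close>)
  then show ?thesis by simp
qed

text \<open>This is the sign of the derivative of the auxiliary function P used below for the sine
  ratio. Differentiate the difference of the two sides twice: the second derivative is 4 sin x (sin
  x - x cos x), and the lower-order values at 0 vanish.\<close>

lemma sin_quadratic_bound:
  fixes x :: real
  assumes "0 \<le> x" "x \<le> pi"
  shows "2 * (sin x)\<^sup>2 \<le> x\<^sup>2 + x * sin x * cos x"
proof -
  have "0 \<le> 3 * x - 2 * x * (sin x)\<^sup>2 - 3 * sin x * cos x" if "0 \<le> x" "x \<le> pi" for x :: real
  proof (rule nonneg_of_deriv_nonneg[where f = "\<lambda>x. 3 * x - 2 * x * (sin x)\<^sup>2 - 3 * sin x * cos x" and b = x and f' = "\<lambda>x. 4 * sin x * (sin x - x * cos x)"])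
    fix y :: real assume y: "0 \<le> y" "y \<le> x"
    have "3 - 2 * (sin y)\<^sup>2 - 4 * y * sin y * cos y - 3 * ((cos y)\<^sup>2 - (sin y)\<^sup>2) = 4 * sin y * (sin y - y * cos y)"
      unfolding cos_squared_eq by (simp add: power2_eq_square algebra_simps)
    then show "((\<lambda>x. 3 * x - 2 * x * (sin x)\<^sup>2 - 3 * sin x * cos x) has_real_derivative
        4 * sin y * (sin y - y * cos y)) (at y)"
      by (auto intro!: derivative_eq_intros simp: power2_eq_square algebra_simps)
    show "0 \<le> 4 * sin y * (sin y - y * cos y)"
      using y that mult_cos_le_sin[of y] sin_ge_zero[of y] by simp
  qed (use that in auto)
  note deriv = this
  have "0 \<le> x\<^sup>2 + x * sin x * cos x - 2 * (sin x)\<^sup>2"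
  proof (rule nonneg_of_deriv_nonneg[where f = "\<lambda>x. x\<^sup>2 + x * sin x * cos x - 2 * (sin x)\<^sup>2" and b = x and f' = "\<lambda>x. 3 * x - 2 * x * (sin x)\<^sup>2 - 3 * sin x * cos x"])
    fix y :: real assume y: "0 \<le> y" "y \<le> x"
    have "y * ((cos y)\<^sup>2 - (sin y)\<^sup>2) = y - 2 * y * (sin y)\<^sup>2"
      by (simp add: cos_squared_eq algebra_simps)
    then show "((\<lambda>x. x\<^sup>2 + x * sin x * cos x - 2 * (sin x)\<^sup>2) has_real_derivative
        3 * y - 2 * y * (sin y)\<^sup>2 - 3 * sin y * cos y) (at y)"
      by (auto intro!: derivative_eq_intros simp: power2_eq_square algebra_simps)
  qed (use assms deriv in auto)
  then show ?thesis by simp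
qed

lemma sinh_quadratic_bound:
  fixes x :: real
  assumes "0 \<le> x"
  shows "2 * (sinh x)\<^sup>2 \<le> x\<^sup>2 + x * sinh x * cosh x"
proof -
  have "0 \<le> 3 * x + 2 * x * (sinh x)\<^sup>2 - 3 * sinh x * cosh x" if "0 \<le> x" for x :: real
  proof (rule nonneg_of_deriv_nonneg[where f = "\<lambda>x. 3 * x + 2 * x * (sinh x)\<^sup>2 - 3 * sinh x * cosh x" and b = x and f' = "\<lambda>x. 4 * sinh x * (x * cosh x - sinh x)"])
    fix y :: real assume y: "0 \<le> y" "y \<le> x"
    have "3 + 2 * (sinh y)\<^sup>2 + 4 * y * sinh y * cosh y - 3 * ((cosh y)\<^sup>2 + (sinh y)\<^sup>2)
        = 4 * sinh y * (y * cosh y - sinh y)"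
      using cosh_square_eq[of y] by (simp add: power2_eq_square algebra_simps)
    then show "((\<lambda>x. 3 * x + 2 * x * (sinh x)\<^sup>2 - 3 * sinh x * cosh x) has_real_derivative
        4 * sinh y * (y * cosh y - sinh y)) (at y)"
      by (auto intro!: derivative_eq_intros simp: power2_eq_square algebra_simps)
    show "0 \<le> 4 * sinh y * (y * cosh y - sinh y)"
      using y sinh_le_mult_cosh[of y] by simp
  qed (use that in auto)
  note deriv = this
  have "0 \<le> x\<^sup>2 + x * sinh x * cosh x - 2 * (sinh x)\<^sup>2"
  proof (rule nonneg_of_deriv_nonneg[where f = "\<lambda>x. x\<^sup>2 + x * sinh x * cosh x - 2 * (sinh x)\<^sup>2" and b = x and f' = "\<lambda>x. 3 * x + 2 * x * (sinh x)\<^sup>2 - 3 * sinh x * cosh x"])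
    fix y :: real assume y: "0 \<le> y" "y \<le> x"
    have "y * ((cosh y)\<^sup>2 + (sinh y)\<^sup>2) = y + 2 * y * (sinh y)\<^sup>2"
      using cosh_square_eq[of y] by (simp add: algebra_simps)
    then show "((\<lambda>x. x\<^sup>2 + x * sinh x * cosh x - 2 * (sinh x)\<^sup>2) has_real_derivative
        3 * y + 2 * y * (sinh y)\<^sup>2 - 3 * sinh y * cosh y) (at y)"
      by (auto intro!: derivative_eq_intros simp: power2_eq_square algebra_simps)
  qed (use assms deriv in auto)
  then show ?thesis by simp
qed

text \<open>For K > 0, distinct points and an angle a = d(x,y) sqrt(K/(N-1)) below pi, ln \<beta> is
  N - 1 times this quantity.\<close>

definition ln_sin_ratio :: "real \<Rightarrow> real \<Rightarrow> real" where
  "ln_sin_ratio t a = ln (sin (t * a) / (t * sin a))"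

definition ln_sinh_ratio :: "real \<Rightarrow> real \<Rightarrow> real" where
  "ln_sinh_ratio t a = ln (sinh (t * a) / (t * sinh a))"

text \<open>For both ratios \<open>h\<close> below, \<open>a h'(a) - 2 h(a) = P(a) - P(t a)\<close> with an increasing function \<open>P\<close>.\<close>

lemma ln_sin_ratio_over_square_mono:
  assumes t: "0 < t" "t < 1" and ab: "0 < a" "a \<le> b" "b < pi"
  shows "ln_sin_ratio t a / a\<^sup>2 \<le> ln_sin_ratio t b / b\<^sup>2"
proof (rule DERIV_nonneg_imp_nondecreasing[where f = "\<lambda>a. ln_sin_ratio t a / a\<^sup>2", OF ab(2)])
  fix x assume "a \<le> x" "x \<le> b"
  then have x: "0 < x" "x < pi" using ab by auto
  have tx: "0 < t * x" "t * x < x" "t * x < pi"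
    using t x by (auto intro: order.strict_trans[of "t * x" x])
  have s: "0 < sin x" "0 < sin (t * x)" using x tx by (auto intro: sin_gt_zero)
  let ?P = "\<lambda>x::real. 1 - x * cos x / sin x + 2 * ln (sin x / x)"
  have "?P (t * x) \<le> ?P x"
  proof (rule DERIV_nonneg_imp_nondecreasing[where f = ?P and a = "t * x" and b = x])
    fix y assume "t * x \<le> y" "y \<le> x"
    then have y: "0 < y" "y < pi" using tx x by auto
    then have sy: "0 < sin y" by (intro sin_gt_zero)
    let ?D = "- cos y / sin y + y / (sin y)\<^sup>2 + 2 * (cos y / sin y - 1 / y)"
    have "- ((cos y - y * sin y) * sin y - y * cos y * cos y) = - cos y * sin y + y"
      using sin_cos_squared_add[of y] by (simp add: power2_eq_square algebra_simps flip: distrib_left)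
    then have "(?P has_real_derivative ?D) (at y)"
      using y sy by (auto intro!: derivative_eq_intros) (simp_all add: power2_eq_square divide_simps, simp_all add: algebra_simps)
    moreover have "?D = (y\<^sup>2 + y * sin y * cos y - 2 * (sin y)\<^sup>2) / (y * (sin y)\<^sup>2)"
      using y sy by (simp add: field_simps power2_eq_square)
    then have "0 \<le> ?D" using sin_quadratic_bound[of y] y by simp
    ultimately show "\<exists>D. (?P has_real_derivative D) (at y) \<and> 0 \<le> D" by blast
  qed (use tx in linarith)
  moreover have "x * (t * cos (t * x) / sin (t * x) - cos x / sin x) - 2 * ln_sin_ratio t x = ?P x - ?P (t * x)"
    using t x s by (simp add: ln_sin_ratio_def ln_div ln_mult algebra_simps)
  ultimately have num: "0 \<le> x * (t * cos (t * x) / sin (t * x) - cos x / sin x) - 2 * ln_sin_ratio t x" by simp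
  let ?D = "(x * (t * cos (t * x) / sin (t * x) - cos x / sin x) - 2 * ln_sin_ratio t x) / x ^ 3"
  have "(ln_sin_ratio t has_real_derivative (t * cos (t * x) / sin (t * x) - cos x / sin x)) (at x)"
    unfolding ln_sin_ratio_def using t x s
    by (auto intro!: derivative_eq_intros simp: divide_simps) (simp_all add: algebra_simps)
  then have "((\<lambda>x. ln_sin_ratio t x / x\<^sup>2) has_real_derivative ?D) (at x)"
    using x by (auto intro!: derivative_eq_intros simp: divide_simps power2_eq_square power3_eq_cube)
      (simp_all add: algebra_simps)
  moreover have "0 \<le> ?D" using num x by simp
  ultimately show "\<exists>y. ((\<lambda>x. ln_sin_ratio t x / x\<^sup>2) has_real_derivative y) (at x) \<and> 0 \<le> y" by blast
qed

lemma ln_sinh_ratio_over_square_mono: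
  assumes t: "0 < t" "t < 1" and ab: "0 < a" "a \<le> b"
  shows "ln_sinh_ratio t a / a\<^sup>2 \<le> ln_sinh_ratio t b / b\<^sup>2"
proof (rule DERIV_nonneg_imp_nondecreasing[where f = "\<lambda>a. ln_sinh_ratio t a / a\<^sup>2", OF ab(2)])
  fix x assume "a \<le> x" "x \<le> b"
  then have x: "0 < x" using ab by auto
  have tx: "0 < t * x" "t * x < x"
    using t x by auto
  have s: "0 < sinh x" "0 < sinh (t * x)" using x tx by auto
  let ?P = "\<lambda>x::real. 1 - x * cosh x / sinh x + 2 * ln (sinh x / x)"
  have "?P (t * x) \<le> ?P x"
  proof (rule DERIV_nonneg_imp_nondecreasing[where f = ?P and a = "t * x" and b = x])
    fix y assume "t * x \<le> y" "y \<le> x"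
    then have y: "0 < y" using tx x by auto
    then have sy: "0 < sinh y" by simp
    let ?D = "- cosh y / sinh y + y / (sinh y)\<^sup>2 + 2 * (cosh y / sinh y - 1 / y)"
    have "- ((cosh y + y * sinh y) * sinh y - y * cosh y * cosh y) = - cosh y * sinh y + y"
      using cosh_square_eq[of y] by (simp add: power2_eq_square algebra_simps flip: distrib_left)
    then have "(?P has_real_derivative ?D) (at y)"
      using y sy by (auto intro!: derivative_eq_intros) (simp_all add: power2_eq_square divide_simps, simp_all add: algebra_simps)
    moreover have "?D = (y\<^sup>2 + y * sinh y * cosh y - 2 * (sinh y)\<^sup>2) / (y * (sinh y)\<^sup>2)"
      using y sy by (simp add: field_simps power2_eq_square)
    then have "0 \<le> ?D" using sinh_quadratic_bound[of y] y by simp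
    ultimately show "\<exists>D. (?P has_real_derivative D) (at y) \<and> 0 \<le> D" by blast
  qed (use tx in linarith)
  moreover have "x * (t * cosh (t * x) / sinh (t * x) - cosh x / sinh x) - 2 * ln_sinh_ratio t x = ?P x - ?P (t * x)"
    using t x s by (simp add: ln_sinh_ratio_def ln_div ln_mult algebra_simps)
  ultimately have num: "0 \<le> x * (t * cosh (t * x) / sinh (t * x) - cosh x / sinh x) - 2 * ln_sinh_ratio t x" by simp
  let ?D = "(x * (t * cosh (t * x) / sinh (t * x) - cosh x / sinh x) - 2 * ln_sinh_ratio t x) / x ^ 3"
  have "(ln_sinh_ratio t has_real_derivative (t * cosh (t * x) / sinh (t * x) - cosh x / sinh x)) (at x)"
    unfolding ln_sinh_ratio_def using t x s
    by (auto intro!: derivative_eq_intros simp: divide_simps) (simp_all add: algebra_simps)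
  then have "((\<lambda>x. ln_sinh_ratio t x / x\<^sup>2) has_real_derivative ?D) (at x)"
    using x by (auto intro!: derivative_eq_intros simp: divide_simps power2_eq_square power3_eq_cube)
      (simp_all add: algebra_simps)
  moreover have "0 \<le> ?D" using num x by simp
  ultimately show "\<exists>y. ((\<lambda>x. ln_sinh_ratio t x / x\<^sup>2) has_real_derivative y) (at x) \<and> 0 \<le> y" by blast
qed

lemma mult_sin_le_sin_mult:
  fixes t a :: real
  assumes "0 < t" "t < 1" "0 \<le> a" "a \<le> pi"
  shows "t * sin a \<le> sin (t * a)"
proof -
  have "0 \<le> sin (t * a) - t * sin a"
  proof (rule nonneg_of_deriv_nonneg[where f = "\<lambda>a. sin (t * a) - t * sin a" and b = a and f' = "\<lambda>a. t * (cos (t * a) - cos a)"])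
    fix x assume x: "0 \<le> x" "x \<le> a"
    show "((\<lambda>a. sin (t * a) - t * sin a) has_real_derivative t * (cos (t * x) - cos x)) (at x)"
      by (auto intro!: derivative_eq_intros simp: algebra_simps)
    have "cos x \<le> cos (t * x)"
      using assms x by (intro cos_monotone_0_pi_le) (auto simp: mult_left_le_one_le)
    then show "0 \<le> t * (cos (t * x) - cos x)" using assms(1) by simp
  qed (use assms in auto)
  then show ?thesis by simp
qed

lemma sinh_mult_le_mult_sinh:
  fixes t a :: real
  assumes "0 < t" "t < 1" "0 \<le> a"
  shows "sinh (t * a) \<le> t * sinh a"
proof -
  have "0 \<le> t * sinh a - sinh (t * a)"
  proof (rule nonneg_of_deriv_nonneg[where f = "\<lambda>a. t * sinh a - sinh (t * a)" and b = a and f' = "\<lambda>a. t * (cosh a - cosh (t * a))"])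
    fix x assume x: "0 \<le> x" "x \<le> a"
    show "((\<lambda>a. t * sinh a - sinh (t * a)) has_real_derivative t * (cosh x - cosh (t * x))) (at x)"
      by (auto intro!: derivative_eq_intros simp: algebra_simps)
    have "cosh (t * x) \<le> cosh x"
      using assms x by (subst cosh_real_nonneg_le_iff) (auto simp: mult_left_le_one_le)
    then show "0 \<le> t * (cosh x - cosh (t * x))" using assms(1) by simp
  qed (use assms in auto)
  then show ?thesis by simp
qed

lemma ln_sin_ratio_nonneg:
  assumes "0 < t" "t < 1" "0 < a" "a < pi"
  shows "0 \<le> ln_sin_ratio t a"
proof -
  have "0 < sin a" using assms by (intro sin_gt_zero)
  then have "1 \<le> sin (t * a) / (t * sin a)"
    using mult_sin_le_sin_mult[of t a] assms by simp
  then show ?thesis unfolding ln_sin_ratio_def by simp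
qed

lemma ln_sinh_ratio_nonpos:
  assumes "0 < t" "t < 1" "0 < a"
  shows "ln_sinh_ratio t a \<le> 0"
proof -
  have "sinh (t * a) / (t * sinh a) \<le> 1" "0 < sinh (t * a) / (t * sinh a)"
    using sinh_mult_le_mult_sinh[of t a] assms by simp_all
  then show ?thesis unfolding ln_sinh_ratio_def by simp
qed

text \<open>A product of two nonnegative nondecreasing factors: the square of a, and the ratio
  divided by that square.\<close>

lemma ln_sin_ratio_mono:
  assumes t: "0 < t" "t < 1" and ab: "0 < a" "a \<le> b" "b < pi"
  shows "ln_sin_ratio t a \<le> ln_sin_ratio t b"
proof -
  have "ln_sin_ratio t a = a\<^sup>2 * (ln_sin_ratio t a / a\<^sup>2)" using ab by simp
  also have "\<dots> \<le> b\<^sup>2 * (ln_sin_ratio t b / b\<^sup>2)"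
    using ab ln_sin_ratio_nonneg[OF t, of a]
    by (intro mult_mono ln_sin_ratio_over_square_mono t power_mono) auto
  also have "\<dots> = ln_sin_ratio t b" using ab by simp
  finally show ?thesis .
qed

text \<open>The argument of the sine case breaks down: the quotient by the square is nondecreasing
  but nonpositive, so multiplying by the square need not keep its monotonicity. The sign of the
  derivative is computed directly instead.\<close>

lemma ln_sinh_ratio_antimono:
  assumes t: "0 < t" "t < 1" and ab: "0 < a" "a \<le> b"
  shows "ln_sinh_ratio t b \<le> ln_sinh_ratio t a"
proof (rule DERIV_nonpos_imp_nonincreasing[where f = "ln_sinh_ratio t", OF ab(2)])
  fix x assume "a \<le> x" "x \<le> b"
  then have x: "0 < x" using ab by simp
  then have s: "0 < sinh x" "0 < sinh (t * x)" using t by auto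
  let ?D = "t * cosh (t * x) / sinh (t * x) - cosh x / sinh x"
  have "0 \<le> cosh x * sinh (t * x) - t * cosh (t * x) * sinh x"
  proof (rule nonneg_of_deriv_nonneg[where f = "\<lambda>x. cosh x * sinh (t * x) - t * cosh (t * x) * sinh x" and b = x and f' = "\<lambda>x. (1 - t\<^sup>2) * sinh x * sinh (t * x)"])
    fix y assume "0 \<le> y" "y \<le> x"
    show "((\<lambda>x. cosh x * sinh (t * x) - t * cosh (t * x) * sinh x) has_real_derivative
        (1 - t\<^sup>2) * sinh y * sinh (t * y)) (at y)"
      by (auto intro!: derivative_eq_intros simp: algebra_simps power2_eq_square)
    show "0 \<le> (1 - t\<^sup>2) * sinh y * sinh (t * y)"
      using t \<open>0 \<le> y\<close> by (simp add: power_le_one)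
  qed (use x in auto)
  then have "?D \<le> 0" using s by (simp add: field_simps)
  moreover have "(ln_sinh_ratio t has_real_derivative ?D) (at x)"
    unfolding ln_sinh_ratio_def using t x s
    by (auto intro!: derivative_eq_intros simp: divide_simps) (simp_all add: algebra_simps)
  ultimately show "\<exists>y. (ln_sinh_ratio t has_real_derivative y) (at x) \<and> y \<le> 0" by blast
qed

text \<open>From ln (sin a / a) = -a^2/6 + o(a^2), taken at ta and at a. This is the origin of the
  factor 1/6 in the coefficient for N = \<infinity>.\<close>

lemma tendsto_ln_sin_ratio_over_square:
  assumes "0 < t" "t < 1"
  shows "((\<lambda>a. ln_sin_ratio t a / a\<^sup>2) \<longlongrightarrow> (1 - t\<^sup>2) / 6) (at_right 0)"
  unfolding ln_sin_ratio_def using assms by real_asymp (simp_all add: field_simps power2_eq_square)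

lemma tendsto_ln_sinh_ratio_over_square:
  assumes "0 < t" "t < 1"
  shows "((\<lambda>a. ln_sinh_ratio t a / a\<^sup>2) \<longlongrightarrow> - ((1 - t\<^sup>2) / 6)) (at_right 0)"
  unfolding ln_sinh_ratio_def using assms by real_asymp (simp_all add: field_simps power2_eq_square)

lemma diameter_le_iff_angle:
  assumes "0 < K" "1 < N"
  shows "pi * sqrt ((N - 1) / K) \<le> r \<longleftrightarrow> pi \<le> r * sqrt (K / (N - 1))"
proof -
  have "sqrt ((N - 1) / K) * sqrt (K / (N - 1)) = 1" "0 < sqrt ((N - 1) / K)"
    using assms by (simp_all flip: real_sqrt_mult)
  then have "sqrt (K / (N - 1)) = 1 / sqrt ((N - 1) / K)" by (auto simp: eq_divide_eq ac_simps)
  then show ?thesis using \<open>0 < sqrt ((N - 1) / K)\<close> by (simp add: field_simps)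
qed

text \<open>The factor N - 1 in ln \<beta> is traded for K r^2, which is free of N. The dimension
  then enters only through h(a)/a^2, where the angle a decreases in N.\<close>

lemma angle_square:
  fixes r K N :: real
  assumes "0 < K" "1 < N" "0 < r"
  shows "(N - 1) * h = K * r\<^sup>2 * (h / (r * sqrt (K / (N - 1)))\<^sup>2)"
  using assms by (simp add: power_mult_distrib)

section \<open>Monotonicity of the coefficients in dimension and distance\<close>

context
  fixes d :: "'a \<Rightarrow> 'a \<Rightarrow> real" and t :: real
  assumes irr: "irreversible_metric d" and t: "0 < t" "t < 1"
begin

lemma beta_fin_refl: "1 < N \<Longrightarrow> beta_fin d K N t x x = 1"
  using t irreversible_metricD(2)[OF irr, of x] by (simp add: beta_fin_def not_le)

lemma beta_fin_zero: "beta_fin d 0 N t x y = 1"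
  using t irreversible_metricD(3)[OF irr, of x y] by (simp add: beta_fin_def s_coeff_def)

lemma beta_fin_pos_curvature:
  assumes "0 < K" "1 < N" "x \<noteq> y"
  shows "beta_fin d K N t x y = (if pi \<le> d x y * sqrt (K / (N - 1)) then \<infinity>
    else ennreal (exp ((N - 1) * ln_sin_ratio t (d x y * sqrt (K / (N - 1))))))"
proof (cases "pi \<le> d x y * sqrt (K / (N - 1))")
  case True
  then show ?thesis using assms t by (simp add: beta_fin_def diameter_le_iff_angle)
next
  case False
  let ?a = "d x y * sqrt (K / (N - 1))"
  have a: "0 < ?a" "?a < pi" using False irreversible_metric_pos[OF irr assms(3)] assms by auto
  then have ta: "0 < t * ?a" "t * ?a < pi"
    using t mult_strict_right_mono[of t 1 ?a] by simp_all
  have s: "0 < sin ?a" "0 < sin (t * ?a)" using a ta by (auto intro: sin_gt_zero)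
  have "s_coeff K N (t * d x y) / (t * s_coeff K N (d x y)) = sin (t * ?a) / (t * sin ?a)"
    using assms by (simp add: s_coeff_def mult.assoc)
  moreover have "0 < sin (t * ?a) / (t * sin ?a)" using s t by simp
  ultimately have "(s_coeff K N (t * d x y) / (t * s_coeff K N (d x y))) powr (N - 1)
      = exp ((N - 1) * ln_sin_ratio t ?a)"
    unfolding powr_def ln_sin_ratio_def by (simp only: less_irrefl if_False order_less_imp_not_eq2)
  then show ?thesis using False assms t by (simp add: beta_fin_def diameter_le_iff_angle)
qed

lemma beta_fin_neg_curvature:
  assumes "K < 0" "1 < N" "x \<noteq> y"
  shows "beta_fin d K N t x y = ennreal (exp ((N - 1) * ln_sinh_ratio t (d x y * sqrt (- K / (N - 1)))))"
proof -
  let ?a = "d x y * sqrt (- K / (N - 1))"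
  have a: "0 < ?a" using irreversible_metric_pos[OF irr assms(3)] assms by (simp add: divide_neg_pos)
  have "0 < sqrt ((N - 1) / - K)" using assms by (simp add: divide_pos_neg)
  then have "s_coeff K N (t * d x y) / (t * s_coeff K N (d x y)) = sinh (t * ?a) / (t * sinh ?a)"
    using assms by (simp add: s_coeff_def mult.assoc)
  moreover have "0 < sinh (t * ?a) / (t * sinh ?a)" using a t by simp
  ultimately have "(s_coeff K N (t * d x y) / (t * s_coeff K N (d x y))) powr (N - 1)
      = exp ((N - 1) * ln_sinh_ratio t ?a)"
    unfolding powr_def ln_sinh_ratio_def by (simp only: less_irrefl if_False order_less_imp_not_eq2)
  then show ?thesis using assms t by (simp add: beta_fin_def)
qed

text \<open>A larger dimension means a smaller angle, and by \<open>angle_square\<close> only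
  h(a)/a^2 sees the angle, which is nondecreasing in both curvature signs. If the larger angle has
  reached pi, the right side is \<infinity>.\<close>

lemma beta_fin_antimono_dim:
  assumes "1 < N" "N \<le> N'"
  shows "beta_fin d K N' t x y \<le> beta_fin d K N t x y"
proof (cases "x = y")
  case True
  then show ?thesis using assms by (simp add: beta_fin_refl)
next
  case False
  let ?r = "d x y"
  have r: "0 < ?r" by (rule irreversible_metric_pos[OF irr False])
  consider "K = 0" | "K > 0" | "K < 0" by linarith
  then show ?thesis
  proof cases
    case 2
    let ?a = "?r * sqrt (K / (N - 1))" and ?a' = "?r * sqrt (K / (N' - 1))"
    have a: "0 < ?a'" "?a' \<le> ?a"
      using assms 2 r by (auto simp: frac_le)
    show ?thesis
    proof (cases "pi \<le> ?a")
      case True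
      then show ?thesis using assms 2 False by (simp add: beta_fin_pos_curvature)
    next
      case F: False
      have "(N' - 1) * ln_sin_ratio t ?a' = K * ?r\<^sup>2 * (ln_sin_ratio t ?a' / ?a'\<^sup>2)"
        by (rule angle_square) (use assms 2 r in auto)
      also have "\<dots> \<le> K * ?r\<^sup>2 * (ln_sin_ratio t ?a / ?a\<^sup>2)"
        using F 2 by (intro mult_left_mono ln_sin_ratio_over_square_mono[OF t a]) auto
      also have "\<dots> = (N - 1) * ln_sin_ratio t ?a"
        by (rule angle_square[symmetric]) (use assms 2 r in auto)
      finally show ?thesis using assms 2 False F a
        by (simp add: beta_fin_pos_curvature ennreal_leI)
    qed
  next
    case 3
    let ?a = "?r * sqrt (- K / (N - 1))" and ?a' = "?r * sqrt (- K / (N' - 1))"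
    have a: "0 < ?a'" "?a' \<le> ?a"
      using assms 3 r by (auto simp: divide_neg_pos intro!: divide_left_mono_neg)
    have "(N' - 1) * ln_sinh_ratio t ?a' = - K * ?r\<^sup>2 * (ln_sinh_ratio t ?a' / ?a'\<^sup>2)"
      by (rule angle_square) (use assms 3 r in auto)
    also have "\<dots> \<le> - K * ?r\<^sup>2 * (ln_sinh_ratio t ?a / ?a\<^sup>2)"
      using 3 by (intro mult_left_mono ln_sinh_ratio_over_square_mono[OF t a]) (auto intro: mult_nonpos_nonneg)
    also have "\<dots> = (N - 1) * ln_sinh_ratio t ?a"
      by (rule angle_square[symmetric]) (use assms 3 r in auto)
    finally show ?thesis using assms 3 False
      by (simp add: beta_fin_neg_curvature ennreal_leI)
  qed (simp add: beta_fin_zero)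
qed

lemma beta_fin_ge_1:
  assumes "0 \<le> K" "1 < N"
  shows "1 \<le> beta_fin d K N t x y"
proof (cases "x = y \<or> K = 0")
  case True
  then show ?thesis using assms by (auto simp: beta_fin_refl beta_fin_zero)
next
  case False
  let ?a = "d x y * sqrt (K / (N - 1))"
  have "0 < ?a" using False assms irreversible_metric_pos[OF irr, of x y] by simp
  then have "0 \<le> (N - 1) * ln_sin_ratio t ?a" if "\<not> pi \<le> ?a"
    using that assms by (intro mult_nonneg_nonneg ln_sin_ratio_nonneg t) auto
  then show ?thesis using False assms by (simp add: beta_fin_pos_curvature)
qed

lemma beta_fin_le_1:
  assumes "K \<le> 0" "1 < N"
  shows "beta_fin d K N t x y \<le> 1"
proof (cases "x = y \<or> K = 0")
  case True
  then show ?thesis using assms by (auto simp: beta_fin_refl beta_fin_zero)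
next
  case False
  let ?a = "d x y * sqrt (- K / (N - 1))"
  have "0 < ?a" using False assms irreversible_metric_pos[OF irr, of x y] by (simp add: divide_neg_pos)
  then have "(N - 1) * ln_sinh_ratio t ?a \<le> 0"
    using assms by (intro mult_nonneg_nonpos ln_sinh_ratio_nonpos t) auto
  then show ?thesis using False assms by (simp add: beta_fin_neg_curvature)
qed

text \<open>Together with its counterpart for K \<le> 0, this locates the minimum of \<beta> at a
  pair of extremal distance, a choice that does not depend on N.\<close>

lemma beta_fin_mono_dist:
  assumes "0 \<le> K" "1 < N" "d x y \<le> d u v"
  shows "beta_fin d K N t x y \<le> beta_fin d K N t u v"
proof (cases "x = y \<or> K = 0")
  case True
  then show ?thesis using assms beta_fin_ge_1[of K N u v] by (auto simp: beta_fin_refl beta_fin_zero)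
next
  case False
  then have "u \<noteq> v" using irreversible_metric_pos[OF irr, of x y] assms(3) irreversible_metricD(2)[OF irr, of u] by auto
  let ?a = "d x y * sqrt (K / (N - 1))" and ?b = "d u v * sqrt (K / (N - 1))"
  have "0 < ?a" "?a \<le> ?b" using False assms irreversible_metric_pos[OF irr, of x y] by (auto intro!: mult_right_mono)
  then show ?thesis
  proof (cases "pi \<le> ?b")
    case F: False
    with \<open>?a \<le> ?b\<close> have "\<not> pi \<le> ?a" by linarith
    moreover have "ln_sin_ratio t ?a \<le> ln_sin_ratio t ?b"
      using F by (intro ln_sin_ratio_mono t \<open>0 < ?a\<close> \<open>?a \<le> ?b\<close>) auto
    ultimately show ?thesis
      using F False assms \<open>u \<noteq> v\<close> by (simp add: beta_fin_pos_curvature ennreal_leI)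
  qed (use False assms \<open>u \<noteq> v\<close> in \<open>simp add: beta_fin_pos_curvature\<close>)
qed

lemma beta_fin_antimono_dist:
  assumes "K \<le> 0" "1 < N" "d x y \<le> d u v"
  shows "beta_fin d K N t u v \<le> beta_fin d K N t x y"
proof (cases "x = y \<or> K = 0")
  case True
  then show ?thesis using assms beta_fin_le_1[of K N u v] by (auto simp: beta_fin_refl beta_fin_zero)
next
  case False
  then have "u \<noteq> v" using irreversible_metric_pos[OF irr, of x y] assms(3) irreversible_metricD(2)[OF irr, of u] by auto
  let ?a = "d x y * sqrt (- K / (N - 1))" and ?b = "d u v * sqrt (- K / (N - 1))"
  have "0 < ?a" "?a \<le> ?b" using False assms irreversible_metric_pos[OF irr, of x y]
    by (auto simp: divide_neg_pos intro!: mult_right_mono divide_nonpos_nonneg)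
  then show ?thesis
    using False assms \<open>u \<noteq> v\<close>
    by (auto simp: beta_fin_neg_curvature intro!: ennreal_leI mult_left_mono ln_sinh_ratio_antimono t)
qed

end

text \<open>Serves twice: for the coefficients at dimension 1 and for the functionals in the
  exceptional cases, both of which are defined through \<open>Lim\<close>.\<close>

lemma antimono_tendsto_at_right:
  fixes f :: "real \<Rightarrow> 'b :: {complete_linorder, linorder_topology}"
  assumes "\<And>x y. a < x \<Longrightarrow> x \<le> y \<Longrightarrow> f y \<le> f x"
  shows "(f \<longlongrightarrow> (SUP x\<in>{a<..}. f x)) (at_right a)"
proof (rule order_tendstoI)
  fix l assume "l < (SUP x\<in>{a<..}. f x)"
  then obtain b where b: "a < b" "l < f b" unfolding less_SUP_iff by auto
  have "eventually (\<lambda>x. x \<in> {a<..<b}) (at_right a)"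
    using b(1) by (rule eventually_at_right_real)
  then show "eventually (\<lambda>x. l < f x) (at_right a)"
    by eventually_elim (use assms b(2) in \<open>auto intro: less_le_trans\<close>)
next
  fix u assume u: "(SUP x\<in>{a<..}. f x) < u"
  have "eventually (\<lambda>x. a < x) (at_right a)" by (simp add: eventually_at_filter)
  then show "eventually (\<lambda>x. f x < u) (at_right a)"
    by eventually_elim (use u in \<open>auto intro: le_less_trans[OF SUP_upper]\<close>)
qed

section \<open>Limits of the coefficients in the dimension\<close>

context
  fixes d :: "'a \<Rightarrow> 'a \<Rightarrow> real" and t :: real
  assumes irr: "irreversible_metric d" and t: "0 < t" "t < 1"
begin

lemma tendsto_beta_dim_1: "((\<lambda>N'. beta_fin d K N' t x y) \<longlongrightarrow> beta d K 1 t x y) (at_right 1)"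
proof -
  have lim: "((\<lambda>N'. beta_fin d K N' t x y) \<longlongrightarrow> (SUP N'\<in>{1<..}. beta_fin d K N' t x y)) (at_right 1)"
    by (rule antimono_tendsto_at_right) (rule beta_fin_antimono_dim[OF irr t])
  then have "beta d K 1 t x y = (SUP N'\<in>{1<..}. beta_fin d K N' t x y)"
    unfolding beta_def by (simp add: tendsto_Lim)
  with lim show ?thesis by simp
qed

text \<open>The delicate case is an angle of exactly pi at N, where \<beta> is \<infinity>. For N' >
  N the angle is below pi and the coefficient finite, but sin (a N') tends to 0 from above while the
  numerator tends to sin (t pi) > 0, so the limit is \<infinity> as well.\<close>

lemma tendsto_beta_fin_dim:
  assumes K: "0 < K" and N: "1 < N" and diam: "d x y \<le> pi * sqrt ((N - 1) / K)"
  shows "((\<lambda>N'. beta_fin d K N' t x y) \<longlongrightarrow> beta_fin d K N t x y) (at_right N)"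
proof (cases "x = y")
  case True
  have "eventually (\<lambda>N'. N < N') (at_right N)" by (simp add: eventually_at_filter)
  then have "eventually (\<lambda>N'. beta_fin d K N t x y = beta_fin d K N' t x y) (at_right N)"
    by eventually_elim (use True N in \<open>simp add: beta_fin_refl[OF irr t]\<close>)
  then show ?thesis by (rule tendsto_eventually[OF eventually_mono]) simp
next
  case False
  let ?r = "d x y"
  have r: "0 < ?r" by (rule irreversible_metric_pos[OF irr False])
  define a where "a N' = ?r * sqrt (K / (N' - 1))" for N'
  have ev: "eventually (\<lambda>N'. N < N') (at_right N)" by (simp add: eventually_at_filter)
  have "sqrt ((N - 1) / K) * sqrt (K / (N - 1)) = 1"
    using K N by (simp flip: real_sqrt_mult)
  moreover have "?r * sqrt (K / (N - 1)) \<le> pi * sqrt ((N - 1) / K) * sqrt (K / (N - 1))"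
    using diam K N by (intro mult_right_mono) auto
  ultimately have aN: "a N \<le> pi" by (simp add: a_def mult.assoc)
  have a_lt: "0 < a N'" "a N' < a N" if "N < N'" for N'
    using that N K r by (auto simp: a_def intro!: divide_strict_left_mono)
  have a_lim: "(a \<longlongrightarrow> a N) (at_right N)"
    unfolding a_def using N by (intro tendsto_intros) auto
  have eq: "beta_fin d K N' t x y = ennreal (exp ((N' - 1) * ln_sin_ratio t (a N')))" if "N < N'" for N'
    using that N K False a_lt[OF that] aN by (simp add: beta_fin_pos_curvature[OF irr t] a_def)
  have ev': "eventually (\<lambda>N'. ennreal (exp ((N' - 1) * ln_sin_ratio t (a N'))) = beta_fin d K N' t x y)
      (at_right N)"
    using ev by eventually_elim (simp add: eq)
  have sa: "0 < a N" using N K r by (simp add: a_def)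
  have sta: "0 < sin (t * a N)" using sa aN t
    by (intro sin_gt_zero) (auto intro: less_le_trans[of "t * a N" "a N"])
  show ?thesis
  proof (cases "a N = pi")
    case True
    have "filterlim (\<lambda>N'. sin (t * a N') / (t * sin (a N'))) at_top (at_right N)"
    proof (rule LIM_at_top_divide)
      show "((\<lambda>N'. sin (t * a N')) \<longlongrightarrow> sin (t * a N)) (at_right N)" by (intro tendsto_intros a_lim)
      show "((\<lambda>N'. t * sin (a N')) \<longlongrightarrow> 0) (at_right N)"
        using tendsto_mult_left[OF tendsto_sin[OF a_lim], of t] True by simp
      show "eventually (\<lambda>N'. 0 < t * sin (a N')) (at_right N)"
        using ev by eventually_elim (use a_lt True t in \<open>auto intro!: mult_pos_pos sin_gt_zero\<close>)
    qed (rule sta)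
    then have "filterlim (\<lambda>N'. ln_sin_ratio t (a N')) at_top (at_right N)"
      unfolding ln_sin_ratio_def by (rule filterlim_compose[OF ln_at_top])
    moreover have "((\<lambda>N'. N' - 1) \<longlongrightarrow> N - 1) (at_right N)" by (intro tendsto_intros)
    ultimately have "filterlim (\<lambda>N'. (N' - 1) * ln_sin_ratio t (a N')) at_top (at_right N)"
      using N by (intro filterlim_tendsto_pos_mult_at_top) auto
    then have "filterlim (\<lambda>N'. exp ((N' - 1) * ln_sin_ratio t (a N'))) at_top (at_right N)"
      by (rule filterlim_compose[OF exp_at_top])
    then have "((\<lambda>N'. ennreal (exp ((N' - 1) * ln_sin_ratio t (a N')))) \<longlongrightarrow> \<infinity>) (at_right N)"
      by (simp add: ennreal_tendsto_top_eq_at_top)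
    moreover have "beta_fin d K N t x y = \<infinity>"
      using True K N False by (simp add: beta_fin_pos_curvature[OF irr t] a_def)
    ultimately show ?thesis
      using Lim_transform_eventually[OF _ ev'] by metis
  next
    case neq: False
    have "0 < sin (a N)" using sa aN neq by (intro sin_gt_zero) auto
    then have "((\<lambda>N'. ennreal (exp ((N' - 1) * ln_sin_ratio t (a N')))) \<longlongrightarrow>
        ennreal (exp ((N - 1) * ln_sin_ratio t (a N)))) (at_right N)"
      unfolding ln_sin_ratio_def using t sta
      by (intro tendsto_ennrealI tendsto_intros a_lim) auto
    moreover have "beta_fin d K N t x y = ennreal (exp ((N - 1) * ln_sin_ratio t (a N)))"
      using neq aN K N False by (simp add: beta_fin_pos_curvature[OF irr t] a_def)
    ultimately show ?thesis
      using Lim_transform_eventually[OF _ ev'] by metis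
  qed
qed

lemma beta_infinity: "beta d K \<infinity> t x y = ennreal (exp (K / 6 * (1 - t\<^sup>2) * (d x y)\<^sup>2))"
proof -
  let ?r = "d x y"
  have "((\<lambda>N'. beta_fin d K N' t x y) \<longlongrightarrow> ennreal (exp (K / 6 * (1 - t\<^sup>2) * ?r\<^sup>2))) at_top"
  proof (cases "x = y \<or> K = 0")
    case True
    have "eventually (\<lambda>N'. (1::real) < N') at_top" by (rule eventually_gt_at_top)
    then have "eventually (\<lambda>N'. beta_fin d K N' t x y = ennreal (exp (K / 6 * (1 - t\<^sup>2) * ?r\<^sup>2))) at_top"
      by eventually_elim (use True irreversible_metricD(2)[OF irr] in
        \<open>auto simp: beta_fin_refl[OF irr t] beta_fin_zero[OF irr t]\<close>)
    then show ?thesis by (rule tendsto_eventually)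
  next
    case F: False
    then have r: "0 < ?r" using irreversible_metric_pos[OF irr] by auto
    \<comment> \<open>The angle tends to 0, so after \<open>angle_square\<close> only the limit of
      h(a)/a^2 at 0 matters. Generic in \<open>h\<close>, this serves the sine ratio with k = K and
      the hyperbolic one with k = -K.\<close>
    have lim: "((\<lambda>N'. k * ?r\<^sup>2 * (h (?r * sqrt (k / (N' - 1))) / (?r * sqrt (k / (N' - 1)))\<^sup>2)) \<longlongrightarrow> k * ?r\<^sup>2 * l) at_top"
      if "((\<lambda>a. h a / a\<^sup>2) \<longlongrightarrow> l) (at_right 0)" "0 < k" for h k l
    proof (intro tendsto_mult tendsto_const)
      have "filterlim (\<lambda>N'::real. ?r * sqrt (k / (N' - 1))) (at_right 0) at_top"
        using r that(2) by real_asymp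
      from filterlim_compose[OF that(1) this]
      show "((\<lambda>N'. h (?r * sqrt (k / (N' - 1))) / (?r * sqrt (k / (N' - 1)))\<^sup>2) \<longlongrightarrow> l) at_top" .
    qed
    show ?thesis
    proof (cases "K > 0")
      case True
      have "eventually (\<lambda>N'. ?r * sqrt (K / (N' - 1)) < pi) at_top"
      proof (rule order_tendstoD(2))
        show "((\<lambda>N'. ?r * sqrt (K / (N' - 1))) \<longlongrightarrow> 0) at_top" using r True by real_asymp
      qed simp
      with eventually_gt_at_top[of 1]
      have ev: "eventually (\<lambda>N'. ennreal (exp (K * ?r\<^sup>2 * (ln_sin_ratio t (?r * sqrt (K / (N' - 1)))
          / (?r * sqrt (K / (N' - 1)))\<^sup>2))) = beta_fin d K N' t x y) at_top"
      proof eventually_elim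
        case (elim N')
        have "(N' - 1) * ln_sin_ratio t (?r * sqrt (K / (N' - 1))) = K * ?r\<^sup>2 *
            (ln_sin_ratio t (?r * sqrt (K / (N' - 1))) / (?r * sqrt (K / (N' - 1)))\<^sup>2)"
          by (rule angle_square) (use elim True r in auto)
        then show ?case using elim True F by (simp add: beta_fin_pos_curvature[OF irr t])
      qed
      have "((\<lambda>N'. ennreal (exp (K * ?r\<^sup>2 * (ln_sin_ratio t (?r * sqrt (K / (N' - 1)))
          / (?r * sqrt (K / (N' - 1)))\<^sup>2)))) \<longlongrightarrow> ennreal (exp (K * ?r\<^sup>2 * ((1 - t\<^sup>2) / 6)))) at_top"
        by (intro tendsto_ennrealI tendsto_exp lim[OF tendsto_ln_sin_ratio_over_square[OF t] True])
      from Lim_transform_eventually[OF this ev] show ?thesis by (simp add: mult.commute mult.left_commute)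
    next
      case False
      with F have K: "0 < - K" by simp
      have ev: "eventually (\<lambda>N'. ennreal (exp (- K * ?r\<^sup>2 * (ln_sinh_ratio t (?r * sqrt (- K / (N' - 1)))
          / (?r * sqrt (- K / (N' - 1)))\<^sup>2))) = beta_fin d K N' t x y) at_top"
        using eventually_gt_at_top[of 1]
      proof eventually_elim
        case (elim N')
        have "(N' - 1) * ln_sinh_ratio t (?r * sqrt (- K / (N' - 1))) = - K * ?r\<^sup>2 *
            (ln_sinh_ratio t (?r * sqrt (- K / (N' - 1))) / (?r * sqrt (- K / (N' - 1)))\<^sup>2)"
          by (rule angle_square) (use elim K r in auto)
        then show ?case using elim K F by (simp add: beta_fin_neg_curvature[OF irr t])
      qed
      have "((\<lambda>N'. ennreal (exp (- K * ?r\<^sup>2 * (ln_sinh_ratio t (?r * sqrt (- K / (N' - 1)))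
          / (?r * sqrt (- K / (N' - 1)))\<^sup>2)))) \<longlongrightarrow> ennreal (exp (- K * ?r\<^sup>2 * - ((1 - t\<^sup>2) / 6)))) at_top"
        by (intro tendsto_ennrealI tendsto_exp lim[OF tendsto_ln_sinh_ratio_over_square[OF t] K])
      from Lim_transform_eventually[OF this ev] show ?thesis
        by (simp add: minus_divide_left[symmetric] mult.commute mult.left_commute del: minus_diff_eq)
    qed
  qed
  then show ?thesis unfolding beta_def by (simp add: tendsto_Lim)
qed

lemma beta_ge_1:
  assumes "0 \<le> K" "1 \<le> N" "N < \<infinity>"
  shows "1 \<le> beta d K N t x y"
proof (cases "N = 1")
  case True
  have "eventually (\<lambda>N'. (1::real) < N') (at_right 1)" by (simp add: eventually_at_filter)
  then have "eventually (\<lambda>N'. 1 \<le> beta_fin d K N' t x y) (at_right 1)"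
    by eventually_elim (rule beta_fin_ge_1[OF irr t assms(1)])
  then show ?thesis
    unfolding True by (intro tendsto_lowerbound[OF tendsto_beta_dim_1]) auto
next
  case False
  then have "1 < real_of_ereal N" using assms(2,3) by (cases N) (auto simp: one_ereal_def)
  then show ?thesis using False assms by (auto simp: beta_def intro!: beta_fin_ge_1[OF irr t])
qed

end

section \<open>Test functions and limits in the dimension\<close>

text \<open>The test functions have no finite derivative at 0. Supporting lines at positive points
  suffice, because a convex combination of points of [0,\<infinity>) is positive unless every point
  of positive weight is 0.\<close>

lemma convex_on_nonneg_of_tangents:
  fixes f :: "real \<Rightarrow> real"
  assumes tangent: "\<And>z. 0 < z \<Longrightarrow> \<exists>c. \<forall>r\<ge>0. f z + c * (r - z) \<le> f r"
  shows "convex_on {0..} f"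
  unfolding convex_on_def
proof (intro conjI ballI allI impI)
  fix x y u v :: real
  assume xy: "x \<in> {0..}" "y \<in> {0..}" and uv: "0 \<le> u" "0 \<le> v" "u + v = 1"
  define z where "z = u * x + v * y"
  have "f z \<le> u * f x + v * f y"
  proof (cases "z = 0")
    case True
    then have "u * x = 0" "v * y = 0"
      using xy uv unfolding z_def by (auto simp: add_nonneg_eq_0_iff)
    then consider "u = 0" "y = 0" | "v = 0" "x = 0" | "x = 0" "y = 0" using uv by auto
    then show ?thesis
      using uv True by cases (auto simp: distrib_right[symmetric])
  next
    case False
    then have "0 < z" using xy uv by (simp add: z_def order.strict_iff_order)
    then obtain c where c: "\<And>r. 0 \<le> r \<Longrightarrow> f z + c * (r - z) \<le> f r" using tangent by blast
    have "u * (f z + c * (x - z)) + v * (f z + c * (y - z)) \<le> u * f x + v * f y"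
      using xy uv by (intro add_mono mult_left_mono c) auto
    also have "u * (f z + c * (x - z)) + v * (f z + c * (y - z)) = (u + v) * (f z - c * z) + c * z"
      by (simp add: z_def algebra_simps)
    finally show ?thesis using uv by simp
  qed
  then show "f (u *\<^sub>R x + v *\<^sub>R y) \<le> u * f x + v * f y" by (simp add: z_def)
qed (rule convex_real_interval)

lemma DC_I:
  fixes U U' U'' :: "real \<Rightarrow> real"
  assumes "continuous_on {0..} U" "convex_on {0..} U" "U 0 = 0"
    and U': "\<And>r. 0 < r \<Longrightarrow> (U has_real_derivative U' r) (at r)"
    and U'': "\<And>r. 0 < r \<Longrightarrow> (U' has_real_derivative U'' r) (at r)"
    and cont: "continuous_on {0<..} U''"
    and mono: "mono_on {0<..} (\<lambda>r. (r * U' r - U r) / r powr (1 - real_of_ereal (1 / N)))"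
  shows "U \<in> DC N"
proof -
  have d1: "deriv U r = U' r" if "0 < r" for r using U'[OF that] by (rule DERIV_imp_deriv)
  have D2: "(deriv U has_real_derivative U'' r) (at r)" if "0 < r" for r
    using U''[OF that]
    by (rule has_field_derivative_transform_within_open[where S = "{0<..}"]) (use that d1 in simp_all)
  have d2: "deriv (deriv U) r = U'' r" if "0 < r" for r using D2[OF that] by (rule DERIV_imp_deriv)
  have "continuous_on {0<..} (deriv (deriv U))"
    using cont by (rule continuous_on_eq) (simp add: d2)
  moreover have "mono_on {0<..} (\<lambda>r. (r * deriv U r - U r) / r powr (1 - real_of_ereal (1 / N)))"
    using mono by (simp add: mono_on_def d1)
  moreover have "U field_differentiable at r \<and> deriv U field_differentiable at r" if "0 < r" for r
    using U'[OF that] D2[OF that] unfolding field_differentiable_def by blast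
  ultimately show ?thesis using assms(1-3) unfolding DC_def by blast
qed

lemma powr_minus_one_mult: "0 < z \<Longrightarrow> z powr (a - 1) * z = z powr a" for z :: real
  by (simp add: powr_diff)

text \<open>Here r U'(r) - U(r) = r^(1-1/M) / M; divided by r^(1-1/N) this is r^(1/N-1/M) / M, which
  is nondecreasing because N \<le> M. The supporting lines come from Young's inequality.\<close>

lemma neg_powr_in_DC:
  assumes M: "1 < M" and N: "1 \<le> N" "N < \<infinity>" "real_of_ereal N \<le> M"
  shows "neg_powr M \<in> DC N"
proof -
  define n where "n = real_of_ereal N"
  have n: "1 \<le> n" "n \<le> M" and "N = ereal n"
    using N by (cases N; auto simp: n_def one_ereal_def)+
  then have inv: "real_of_ereal (1 / N) = 1 / n" by (simp add: one_ereal_def)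
  let ?a = "1 - 1 / M"
  have a: "0 < ?a" "?a < 1" using M by simp_all
  show ?thesis
  proof (rule DC_I[where U' = "\<lambda>r. - (?a * r powr (?a - 1))"
        and U'' = "\<lambda>r. - (?a * ((?a - 1) * r powr (?a - 1 - 1)))"])
    show "continuous_on {0..} (neg_powr M)"
      using M by (intro continuous_on_minus continuous_on_powr' continuous_on_id continuous_on_const) auto
    show "convex_on {0..} (neg_powr M)"
    proof (rule convex_on_nonneg_of_tangents)
      fix z :: real assume z: "0 < z"
      have "- (z powr ?a) + - (?a * z powr (?a - 1)) * (r - z) \<le> - (r powr ?a)" if "0 \<le> r" for r
      proof (cases "r = 0")
        case True
        have "z powr (?a - 1) * z = z powr ?a" using z by (rule powr_minus_one_mult)
        then have "z powr ?a - ?a * (z powr (?a - 1) * z) = (1 - ?a) * z powr ?a" by (simp add: algebra_simps)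
        moreover have "0 \<le> (1 - ?a) * z powr ?a" using a by simp
        ultimately show ?thesis using True by (simp add: algebra_simps)
      next
        case False
        have "r powr ?a * z powr (1 - ?a) \<le> ?a * r + (1 - ?a) * z"
          using that False z a by (intro Youngs_inequality_0) auto
        then have "z powr (?a - 1) * (r powr ?a * z powr (1 - ?a)) \<le> z powr (?a - 1) * (?a * r + (1 - ?a) * z)"
          by (rule mult_left_mono) simp
        also have "z powr (?a - 1) * (r powr ?a * z powr (1 - ?a)) = r powr ?a * (z powr (?a - 1) * z powr (1 - ?a))"
          by (simp add: ac_simps)
        also have "z powr (?a - 1) * z powr (1 - ?a) = 1" using z by (simp flip: powr_add)
        also have "z powr (?a - 1) * (?a * r + (1 - ?a) * z) = ?a * z powr (?a - 1) * (r - z) + z powr (?a - 1) * z"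
          by (simp add: algebra_simps diff_divide_distrib)
        also have "z powr (?a - 1) * z = z powr ?a" using z by (rule powr_minus_one_mult)
        finally show ?thesis by simp
      qed
      then show "\<exists>c. \<forall>r\<ge>0. - (z powr ?a) + c * (r - z) \<le> - (r powr ?a)" by blast
    qed
    show "mono_on {0<..} (\<lambda>r. (r * - (?a * r powr (?a - 1)) - - (r powr ?a)) / r powr (1 - real_of_ereal (1 / N)))"
    proof (rule mono_onI)
      have eq: "(r * - (?a * r powr (?a - 1)) - - (r powr ?a)) / r powr (1 - real_of_ereal (1 / N))
          = (1 / M) * r powr (1 / n - 1 / M)" if "0 < r" for r
      proof -
        have "r * r powr (?a - 1) = r powr ?a"
          using powr_minus_one_mult[OF that, of ?a] by (simp only: mult.commute)
        then have "r * - (?a * r powr (?a - 1)) - - (r powr ?a) = 1 / M * r powr ?a"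
          by (simp add: algebra_simps)
        moreover have "r powr ?a / r powr (1 - 1 / n) = r powr (1 / n - 1 / M)"
          using that by (simp flip: powr_diff)
        ultimately show ?thesis by (simp only: inv times_divide_eq_right[symmetric])
      qed
      have "0 \<le> 1 / n - 1 / M" using n M by (simp add: frac_le)
      then show "(r * - (?a * r powr (?a - 1)) - - (r powr ?a)) / r powr (1 - real_of_ereal (1 / N))
          \<le> (s * - (?a * s powr (?a - 1)) - - (s powr ?a)) / s powr (1 - real_of_ereal (1 / N))"
        if "r \<in> {0<..}" "s \<in> {0<..}" "r \<le> s" for r s
        using that M by (simp only: eq greaterThan_iff) (intro mult_left_mono powr_mono2, auto)
    qed
    show "continuous_on {0<..} (\<lambda>r. - (?a * ((?a - 1) * r powr (?a - 1 - 1))))"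
      by (intro continuous_intros) auto
  qed (auto intro!: derivative_eq_intros)
qed

text \<open>Here r U'(r) - U(r) = r and the exponent 1 - 1/N is 1, so the quotient is
  constant.\<close>

lemma mult_ln_in_DC: "(\<lambda>r. r * ln r) \<in> DC \<infinity>"
proof (rule DC_I[where U' = "\<lambda>r. ln r + 1" and U'' = "\<lambda>r. 1 / r"])
  show "continuous_on {0..} (\<lambda>r::real. r * ln r)"
    unfolding continuous_on_def
  proof
    fix x :: real assume "x \<in> {0..}"
    show "((\<lambda>r. r * ln r) \<longlongrightarrow> x * ln x) (at x within {0..})"
    proof (cases "x = 0")
      case True
      have "((\<lambda>r::real. r * ln r) \<longlongrightarrow> 0) (at_right 0)" by real_asymp
      moreover have "at x within {0..} = at_right 0"
        using True by (simp add: at_within_Ici_at_right)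
      ultimately show ?thesis using True by simp
    next
      case False
      then show ?thesis using \<open>x \<in> {0..}\<close> by (intro tendsto_intros) auto
    qed
  qed
  show "convex_on {0..} (\<lambda>r::real. r * ln r)"
  proof (rule convex_on_nonneg_of_tangents)
    fix z :: real assume z: "0 < z"
    have "z * ln z + (1 + ln z) * (r - z) \<le> r * ln r" if "0 \<le> r" for r
    proof (cases "r = 0")
      case False
      then have r: "0 < r" using that by simp
      have "r * (1 - 1 / (r / z)) \<le> r * ln (r / z)"
        using r z by (intro mult_left_mono ln_ge_one_minus_inverse) auto
      then show ?thesis using r z by (simp add: ln_div algebra_simps)
    qed (use z in \<open>simp add: algebra_simps\<close>)
    then show "\<exists>c. \<forall>r\<ge>0. z * ln z + c * (r - z) \<le> r * ln r" by blast
  qed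
  show "mono_on {0<..} (\<lambda>r. (r * (ln r + 1) - r * ln r) / r powr (1 - real_of_ereal (1 / \<infinity>)))"
    by (rule mono_onI) (simp add: algebra_simps)
qed (auto intro!: derivative_eq_intros continuous_intros simp: field_simps)

section \<open>Powers in [0,\<infinity>] and the dimension limit of the functionals\<close>

lemma ennpowr_mult: "0 < a \<Longrightarrow> ennpowr (x * y) a = ennpowr x a * ennpowr y a"
  by (cases x rule: ennreal_cases; cases y rule: ennreal_cases)
     (auto simp: ennpowr_def powr_mult ennreal_mult ennreal_mult_top ennreal_top_mult
       ennreal_mult_eq_top_iff enn2real_mult simp flip: ennreal_mult)

lemma ennpowr_ennpowr: "a * b = 1 \<Longrightarrow> ennpowr (ennpowr x a) b = x"
  by (cases x rule: ennreal_cases) (auto simp: ennpowr_def powr_powr)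

lemma ennpowr_le_iff:
  assumes "0 < a"
  shows "ennpowr x (1 / a) \<le> y \<longleftrightarrow> x \<le> ennpowr y a"
  using ennpowr_mono[of "ennpowr x (1 / a)" y a] ennpowr_mono[of x "ennpowr y a" "1 / a"]
    ennpowr_ennpowr[of "1 / a" a x] ennpowr_ennpowr[of a "1 / a" y] assms by auto

lemma tendsto_ennpowr_inverse: "((\<lambda>M. ennpowr x (1 / M)) \<longlongrightarrow> ennpowr x 1) (at_right 1)"
proof (cases "x = \<infinity> \<or> enn2real x = 0")
  case False
  have "((\<lambda>M. enn2real x powr (1 / M)) \<longlongrightarrow> enn2real x powr (1 / 1)) (at_right 1)"
    using False by (intro tendsto_intros) auto
  then show ?thesis using False by (simp add: ennpowr_def tendsto_ennrealI)
qed (auto simp: ennpowr_def)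

lemma tendsto_uminus_enn2ereal:
  assumes "(g \<longlongrightarrow> l) F"
  shows "((\<lambda>x. - enn2ereal (g x)) \<longlongrightarrow> - enn2ereal l) F"
  by (intro tendsto_uminus_ereal tendsto_enn2erealI assms)

text \<open>Off the exceptional cases \<open>G_ge\<close> at N itself is enough. In the exceptional
  ones \<beta> decreases with the dimension, so the bound \<open>I\<close> at N says nothing about
  N' > N; each N' is given its own bound, the value at one minimising pair, and that value is sent
  to its limit. The distance is a separate \<open>e\<close> so that it can be \<open>d\<close> or
  its reversal.\<close>

lemma cd_value_neg_powr_le:
  fixes e :: "'a \<Rightarrow> 'a \<Rightarrow> real"
  assumes irr: "irreversible_metric e" and \<nu>: "sigma_finite_measure \<nu>"
    and A [measurable]: "A \<in> sets \<nu>" and fin: "emeasure \<nu> A \<noteq> \<infinity>"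
    and \<mu>: "finite_measure \<mu>" "sets \<mu> = sets \<nu>" "emeasure \<nu> A \<noteq> 0 \<Longrightarrow> \<mu> = uniform_measure \<nu> A"
    and \<kappa>: "AE x in \<mu>. prob_space (\<kappa> x) \<and> (AE y in \<kappa> x. y \<in> B)"
    and s: "0 < s" "s < 1" and N: "1 \<le> N" "N < \<infinity>" and M: "1 < M"
    and lo: "x\<^sub>0 \<in> A" "y\<^sub>0 \<in> B" and hi: "x\<^sub>1 \<in> A" "y\<^sub>1 \<in> B"
    and ext: "\<forall>x\<in>A. \<forall>y\<in>B. e x\<^sub>0 y\<^sub>0 \<le> e x y \<and> e x y \<le> e x\<^sub>1 y\<^sub>1"
    and I: "\<And>x y. x \<in> A \<Longrightarrow> y \<in> B \<Longrightarrow> I \<le> beta e K N s x y"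
  shows "cd_value e K N (\<lambda>N'. U_beta_functional (neg_powr M) \<nu> (beta e K N' s) \<kappa> \<mu>)
    \<le> - enn2ereal (ennpowr I (1 / M) * ennpowr (emeasure \<nu> A) (1 / M))"
proof -
  define G where "G = (\<lambda>N'. \<integral>\<^sup>+x. (\<integral>\<^sup>+y. ennreal (ac_density \<nu> \<mu> x powr (1 - 1 / M)) *
    ennpowr (beta e K N' s x y) (1 / M) \<partial>\<kappa> x) \<partial>\<nu>)"
  have F: "U_beta_functional (neg_powr M) \<nu> (beta e K N' s) \<kappa> \<mu> = - enn2ereal (G N')" for N'
    unfolding G_def by (intro U_beta_functional_neg_powr M ac_density_nonneg \<nu> \<mu>)
  have G_ge: "ennpowr J (1 / M) * ennpowr (emeasure \<nu> A) (1 / M) \<le> G N'"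
    if J: "\<And>x y. x \<in> A \<Longrightarrow> y \<in> B \<Longrightarrow> J \<le> beta e K N' s x y" for J N'
  proof (cases "emeasure \<nu> A = 0")
    case True
    then show ?thesis by (simp add: ennpowr_def)
  next
    case pos: False
    have "AE x in \<nu>. x \<in> A \<longrightarrow> prob_space (\<kappa> x) \<and> (AE y in \<kappa> x. y \<in> B)"
      using \<kappa> unfolding \<mu>(3)[OF pos] using pos fin by (subst (asm) AE_uniform_measure) (auto simp: less_top)
    then have "AE x in \<nu>. x \<in> A \<longrightarrow> prob_space (\<kappa> x) \<and> (AE y in \<kappa> x. J \<le> beta e K N' s x y)"
    proof eventually_elim
      case (elim x)
      show ?case
      proof
        assume x: "x \<in> A"
        then have "AE y in \<kappa> x. y \<in> B" using elim by simp
        then have "AE y in \<kappa> x. J \<le> beta e K N' s x y" by eventually_elim (rule J[OF x])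
        then show "prob_space (\<kappa> x) \<and> (AE y in \<kappa> x. J \<le> beta e K N' s x y)" using x elim by simp
      qed
    qed
    then show ?thesis
      unfolding G_def \<mu>(3)[OF pos] by (intro powr_integral_ge_ennpowr \<nu> A pos fin M)
  qed
  show ?thesis
  proof (cases "exceptional e K N")
    case False
    then show ?thesis unfolding cd_value_def F
      using G_ge[of I N] I by (simp add: less_eq_ennreal.rep_eq)
  next
    case exc: True
    define n where "n = real_of_ereal N"
    have n: "1 \<le> n" "N = ereal n" using N by (cases N; auto simp: n_def one_ereal_def)+
    have beta_eq: "beta e K (ereal N') s x y = beta_fin e K N' s x y" if "n < N'" for N' x y
      using that n(1) by (simp add: beta_def one_ereal_def)
    have "((\<lambda>N'. G (ereal N')) \<longlongrightarrow> (SUP N'\<in>{n<..}. G (ereal N'))) (at_right n)"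
    proof (rule antimono_tendsto_at_right)
      fix N1 N2 :: real assume "n < N1" "N1 \<le> N2"
      then show "G (ereal N2) \<le> G (ereal N1)"
        unfolding G_def using n(1)
        by (intro nn_integral_mono mult_left_mono ennpowr_mono)
           (auto simp: beta_eq M order.strict_implies_order[OF less_trans[OF zero_less_one M]]
             intro!: beta_fin_antimono_dim[OF irr s])
    qed
    from tendsto_uminus_enn2ereal[OF this]
    have val: "cd_value e K N (\<lambda>N'. U_beta_functional (neg_powr M) \<nu> (beta e K N' s) \<kappa> \<mu>)
        = - enn2ereal (SUP N'\<in>{n<..}. G (ereal N'))"
      unfolding cd_value_def F using exc n_def by (simp add: tendsto_Lim)
    let ?L = "SUP N'\<in>{n<..}. G (ereal N')"
    \<comment> \<open>As \<open>\<beta>\<close> is monotone in the distance, one pair minimises it for all \<open>N'\<close> at once, so no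
      uniformity of the limit is needed.\<close>
    have "\<exists>x\<in>A. \<exists>y\<in>B. \<forall>N'>n. \<forall>u\<in>A. \<forall>v\<in>B. beta_fin e K N' s x y \<le> beta_fin e K N' s u v"
    proof (cases "0 \<le> K")
      case True
      then show ?thesis using lo ext n(1) by (meson beta_fin_mono_dist[OF irr s] le_less_trans)
    next
      case False
      then show ?thesis using hi ext n(1)
        by (meson beta_fin_antimono_dist[OF irr s] le_less_trans linear)
    qed
    then obtain x y where xy: "x \<in> A" "y \<in> B"
      "\<And>N' u v. n < N' \<Longrightarrow> u \<in> A \<Longrightarrow> v \<in> B \<Longrightarrow> beta_fin e K N' s x y \<le> beta_fin e K N' s u v"
      by blast
    have lim: "((\<lambda>N'. beta_fin e K N' s x y) \<longlongrightarrow> beta e K N s x y) (at_right n)"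
    proof (cases "N = 1")
      case True
      then have "n = 1" using n(2) by (simp add: one_ereal_def)
      then show ?thesis using tendsto_beta_dim_1[OF irr s, of K x y] True by simp
    next
      case False
      then have K: "0 < K" "1 < n"
        and sup: "(SUP (x, y)\<in>UNIV. ereal (e x y)) = ereal (pi * sqrt ((n - 1) / K))"
        using exc n unfolding exceptional_def by (auto simp: one_ereal_def)
      have "ereal (e x y) \<le> (SUP (x, y)\<in>UNIV. ereal (e x y))"
        by (rule SUP_upper2[of "(x, y)"]) auto
      then have "e x y \<le> pi * sqrt ((n - 1) / K)" unfolding sup by simp
      then show ?thesis
        using tendsto_beta_fin_dim[OF irr s K, of x y] False n K(2) by (simp add: beta_def)
    qed
    \<comment> \<open>Taking M-th powers first makes the left side linear in \<beta>. Multiplication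
      by the finite number \<nu>(A) is continuous even when the limit of \<beta> is
      \<infinity>.\<close>
    have "beta_fin e K N' s x y * emeasure \<nu> A \<le> ennpowr ?L M" if "n < N'" for N'
    proof -
      have "ennpowr (beta_fin e K N' s x y * emeasure \<nu> A) (1 / M) \<le> G (ereal N')"
        using G_ge[of "beta_fin e K N' s x y" "ereal N'"] xy(3) that beta_eq M by (simp add: ennpowr_mult)
      also have "\<dots> \<le> ?L" by (rule SUP_upper) (use that in simp)
      finally show ?thesis using M by (simp add: ennpowr_le_iff)
    qed
    then have "eventually (\<lambda>N'. beta_fin e K N' s x y * emeasure \<nu> A \<le> ennpowr ?L M) (at_right n)"
      by (auto intro: eventually_mono[OF eventually_at_right_less[of n]])
    moreover have "((\<lambda>N'. beta_fin e K N' s x y * emeasure \<nu> A) \<longlongrightarrow> beta e K N s x y * emeasure \<nu> A) (at_right n)"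
      using ennreal_tendsto_cmult[OF _ lim, of "emeasure \<nu> A"] fin by (simp add: less_top mult.commute)
    ultimately have "beta e K N s x y * emeasure \<nu> A \<le> ennpowr ?L M"
      by (intro tendsto_upperbound) auto
    moreover have "I * emeasure \<nu> A \<le> beta e K N s x y * emeasure \<nu> A"
      by (intro mult_right_mono I xy) auto
    ultimately have "ennpowr (I * emeasure \<nu> A) (1 / M) \<le> ?L"
      using M by (simp add: ennpowr_le_iff)
    then show ?thesis
      unfolding val using M by (simp add: ennpowr_mult less_eq_ennreal.rep_eq)
  qed
qed

section \<open>The Brunn-Minkowski inequality\<close>

lemma space_borel_of [simp]: "space (borel_of T) = topspace T"
  unfolding borel_of_def by (rule space_measure_of) (auto dest: openin_subset)

lemma sets_borel_of_openin: "openin T U \<Longrightarrow> U \<in> sets (borel_of T)"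
  unfolding borel_of_def by (rule in_measure_of) (auto dest: openin_subset)

lemma sets_borel_of_closedin: "closedin T C \<Longrightarrow> C \<in> sets (borel_of T)"
  using sets.compl_sets[OF sets_borel_of_openin[of T "topspace T - C"]]
  by (auto simp: closedin_def double_diff)

lemma measurable_borel_ofI:
  assumes "f \<in> space M \<rightarrow> topspace T"
    and "\<And>U. openin T U \<Longrightarrow> f -` U \<inter> space M \<in> sets M"
  shows "f \<in> M \<rightarrow>\<^sub>M borel_of T"
  unfolding borel_of_def by (rule measurable_measure_of) (use assms in \<open>auto dest: openin_subset\<close>)

text \<open>The complement of A is an open null set, so the support lies in A; being closed, it is
  compact. This makes the test measures admissible in \<open>weak_CD\<close>.\<close>

lemma cs_probability_concentrated:
  assumes fms: "forward_metric_space d" and \<mu>: "prob_space \<mu>" "sets \<mu> = sets (fborel d)"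
    and A: "compactin (forward_topology d) A" and conc: "emeasure \<mu> (UNIV - A) = 0"
  shows "cs_probability d \<mu>" and "msupport (forward_topology d) \<mu> \<subseteq> A"
proof -
  let ?T = "forward_topology d"
  note [simp] = forward_metric_space_topspace[OF fms]
  have cl: "closedin ?T A" by (rule compactin_forward_imp_closedin[OF fms A])
  show sub: "msupport ?T \<mu> \<subseteq> A"
  proof
    fix x assume x: "x \<in> msupport ?T \<mu>"
    show "x \<in> A"
    proof (rule ccontr)
      assume "x \<notin> A"
      moreover have "openin ?T (UNIV - A)" using cl by (simp add: closedin_def)
      ultimately have "0 < emeasure \<mu> (UNIV - A)" using x unfolding msupport_def by blast
      then show False using conc by simp
    qed
  qed
  have "openin ?T (UNIV - msupport ?T \<mu>)"
  proof (subst openin_subopen, intro ballI)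
    fix x assume "x \<in> UNIV - msupport ?T \<mu>"
    then obtain U where U: "openin ?T U" "x \<in> U" "emeasure \<mu> U = 0"
      unfolding msupport_def by auto
    then have "U \<subseteq> UNIV - msupport ?T \<mu>" unfolding msupport_def by auto
    then show "\<exists>V. openin ?T V \<and> x \<in> V \<and> V \<subseteq> UNIV - msupport ?T \<mu>" using U by blast
  qed
  then have "closedin ?T (msupport ?T \<mu>)" by (simp add: closedin_def)
  then have "compactin ?T (msupport ?T \<mu>)" using closed_compactin[OF A sub] by simp
  then show "cs_probability d \<mu>" unfolding cs_probability_def using \<mu> by simp
qed

lemma emeasure_compactin_finite:
  assumes lf: "locally_finite_measure T \<nu>" and A: "compactin T A" and sets: "sets \<nu> = sets (borel_of T)"
  shows "emeasure \<nu> A \<noteq> \<infinity>"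
proof -
  have "A \<subseteq> topspace T" using A by (rule compactin_subset_topspace)
  then have "\<forall>x\<in>A. \<exists>U. openin T U \<and> x \<in> U \<and> emeasure \<nu> U < \<infinity>"
    using lf unfolding locally_finite_measure_def by blast
  then have "A \<subseteq> \<Union>{U. openin T U \<and> emeasure \<nu> U < \<infinity>}" by blast
  moreover have "\<forall>U\<in>{U. openin T U \<and> emeasure \<nu> U < \<infinity>}. openin T U" by blast
  ultimately obtain \<F> where F: "finite \<F>" "\<F> \<subseteq> {U. openin T U \<and> emeasure \<nu> U < \<infinity>}" "A \<subseteq> \<Union>\<F>"
    using A unfolding compactin_def by meson
  have "emeasure \<nu> A \<le> emeasure \<nu> (\<Union>U\<in>\<F>. U)"
    using F by (intro emeasure_mono) (auto simp: sets intro!: sets.finite_Union sets_borel_of_openin)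
  also have "\<dots> \<le> (\<Sum>U\<in>\<F>. emeasure \<nu> U)"
    using F by (intro emeasure_subadditive_finite) (auto simp: sets intro!: sets_borel_of_openin)
  also have "\<dots> < \<infinity>"
    using F(1,2) by (induction rule: finite_induct) auto
  finally show ?thesis by simp
qed

lemma measurable_curve_eval:
  assumes fms: "forward_metric_space d" and P: "sets P = sets (borel_of (curve_topology d))"
    and "0 \<le> s" "s \<le> 1"
  shows "(\<lambda>\<gamma>. \<gamma> s) \<in> P \<rightarrow>\<^sub>M fborel d"
proof (rule measurable_borel_ofI)
  fix U assume "openin (forward_topology d) U"
  from sets_borel_of_openin[OF openin_curve_eval_preimage[OF fms this assms(3,4)]]
  have "{\<gamma> \<in> geodesics d. \<gamma> s \<in> U} \<in> sets P" by (simp add: P)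
  moreover have "(\<lambda>\<gamma>. \<gamma> s) -` U \<inter> space P = {\<gamma> \<in> geodesics d. \<gamma> s \<in> U}"
    using sets_eq_imp_space_eq[OF P] topspace_curve_topology[OF fms] by auto
  ultimately show "(\<lambda>\<gamma>. \<gamma> s) -` U \<inter> space P \<in> sets P" by simp
qed (simp add: forward_metric_space_topspace[OF fms])

text \<open>Distils what the estimates need from the dynamical plan: an interpolant carried by the
  barycenters, kernels carried by the opposite sets, and the inequality for all test functions at
  once.\<close>

lemma weak_CD_inequality:
  assumes CD: "weak_CD K N d \<nu>" and t: "0 < t" "t < 1"
    and A: "compactin (forward_topology d) A\<^sub>0" "A\<^sub>0 \<subseteq> msupport (forward_topology d) \<nu>"
           "compactin (forward_topology d) A\<^sub>1" "A\<^sub>1 \<subseteq> msupport (forward_topology d) \<nu>"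
    and \<mu>\<^sub>0: "prob_space \<mu>\<^sub>0" "sets \<mu>\<^sub>0 = sets \<nu>" "emeasure \<mu>\<^sub>0 (UNIV - A\<^sub>0) = 0"
    and \<mu>\<^sub>1: "prob_space \<mu>\<^sub>1" "sets \<mu>\<^sub>1 = sets \<nu>" "emeasure \<mu>\<^sub>1 (UNIV - A\<^sub>1) = 0"
  obtains \<mu> \<kappa> \<kappa>' where "prob_space \<mu>" "sets \<mu> = sets \<nu>"
    "emeasure \<mu> (space \<nu> - barycenters d A\<^sub>0 A\<^sub>1 t) = 0"
    "AE x in \<mu>\<^sub>0. prob_space (\<kappa> x) \<and> (AE y in \<kappa> x. y \<in> A\<^sub>1)"
    "AE x in \<mu>\<^sub>1. prob_space (\<kappa>' x) \<and> (AE y in \<kappa>' x. y \<in> A\<^sub>0)"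
    "\<And>U. U \<in> DC N \<Longrightarrow> U_functional U \<nu> \<mu> \<le>
      ereal (1 - t) * cd_value d K N (\<lambda>N'. U_beta_functional U \<nu> (beta d K N' (1 - t)) \<kappa> \<mu>\<^sub>0)
      + ereal t * cd_value d K N (\<lambda>N'. U_beta_functional U \<nu> (\<lambda>x y. beta d K N' t y x) \<kappa>' \<mu>\<^sub>1)"
proof -
  let ?T = "forward_topology d" and ?B = "fborel d"
  have geo: "forward_geodesic_space d" and \<nu>_sets: "sets \<nu> = sets ?B"
    using CD unfolding weak_CD_def by auto
  then have fms: "forward_metric_space d" by (simp add: forward_geodesic_space_def)
  note [simp] = forward_metric_space_topspace[OF fms]
  have space\<nu>: "space \<nu> = UNIV" using sets_eq_imp_space_eq[OF \<nu>_sets] by simp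
  have cl: "closedin ?T A\<^sub>0" "closedin ?T A\<^sub>1"
    using A by (auto intro: compactin_forward_imp_closedin[OF fms])
  then have [measurable]: "A\<^sub>0 \<in> sets ?B" "A\<^sub>1 \<in> sets ?B" by (auto intro: sets_borel_of_closedin)
  have c0: "cs_probability d \<mu>\<^sub>0" "msupport ?T \<mu>\<^sub>0 \<subseteq> A\<^sub>0"
    using cs_probability_concentrated[OF fms _ _ A(1)] \<mu>\<^sub>0 \<nu>_sets by auto
  have c1: "cs_probability d \<mu>\<^sub>1" "msupport ?T \<mu>\<^sub>1 \<subseteq> A\<^sub>1"
    using cs_probability_concentrated[OF fms _ _ A(3)] \<mu>\<^sub>1 \<nu>_sets by auto
  have "msupport ?T \<mu>\<^sub>0 \<subseteq> msupport ?T \<nu>" "msupport ?T \<mu>\<^sub>1 \<subseteq> msupport ?T \<nu>"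
    using c0 c1 A by auto
  with CD c0 c1 obtain P \<kappa> \<kappa>' where dyn: "dynamical_optimal_plan d \<mu>\<^sub>0 \<mu>\<^sub>1 P"
    and dis: "disintegrates ?B (endpoint_plan d P) \<mu>\<^sub>0 \<kappa>"
    and dis': "disintegrates ?B (swap_plan d (endpoint_plan d P)) \<mu>\<^sub>1 \<kappa>'"
    and ineq: "\<forall>U\<in>DC N. \<forall>t\<in>{0..1}. U_functional U \<nu> (interpolant d P t) \<le>
      ereal (1 - t) * cd_value d K N (\<lambda>N'. U_beta_functional U \<nu> (beta d K N' (1 - t)) \<kappa> \<mu>\<^sub>0)
      + ereal t * cd_value d K N (\<lambda>N'. U_beta_functional U \<nu> (\<lambda>x y. beta d K N' t y x) \<kappa>' \<mu>\<^sub>1)"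
    unfolding weak_CD_def by blast
  have P: "prob_space P" "sets P = sets (borel_of (curve_topology d))"
    and coup: "is_coupling ?B \<mu>\<^sub>0 \<mu>\<^sub>1 (endpoint_plan d P)"
    using dyn unfolding dynamical_optimal_plan_def optimal_plan_def by auto
  interpret P: prob_space P by fact
  have spP: "space P = geodesics d"
    using sets_eq_imp_space_eq[OF P(2)] topspace_curve_topology[OF fms] by simp
  have ev [measurable]: "(\<lambda>\<gamma>. \<gamma> 0) \<in> P \<rightarrow>\<^sub>M ?B" "(\<lambda>\<gamma>. \<gamma> 1) \<in> P \<rightarrow>\<^sub>M ?B" "(\<lambda>\<gamma>. \<gamma> t) \<in> P \<rightarrow>\<^sub>M ?B"
    using t by (auto intro!: measurable_curve_eval[OF fms P(2)])
  have marg: "\<mu>\<^sub>0 = distr P ?B (\<lambda>\<gamma>. \<gamma> 0)" "\<mu>\<^sub>1 = distr P ?B (\<lambda>\<gamma>. \<gamma> 1)"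
    using coup unfolding is_coupling_def endpoint_plan_def by (auto simp: distr_distr o_def)
  have compl: "UNIV - A\<^sub>0 \<in> sets ?B" "UNIV - A\<^sub>1 \<in> sets ?B"
    using cl by (auto intro!: sets_borel_of_openin simp: closedin_def)
  have [simp]: "UNIV \<in> sets ?B" using sets.top[of ?B] by simp
  have "AE x in \<mu>\<^sub>0. x \<in> A\<^sub>0"
    using \<mu>\<^sub>0(2,3) compl \<nu>_sets by (intro AE_I[of _ _ "UNIV - A\<^sub>0"]) auto
  then have ae0: "AE \<gamma> in P. \<gamma> 0 \<in> A\<^sub>0" unfolding marg by (rule AE_distrD[OF ev(1)])
  have "AE x in \<mu>\<^sub>1. x \<in> A\<^sub>1"
    using \<mu>\<^sub>1(2,3) compl \<nu>_sets by (intro AE_I[of _ _ "UNIV - A\<^sub>1"]) auto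
  then have ae1: "AE \<gamma> in P. \<gamma> 1 \<in> A\<^sub>1" unfolding marg by (rule AE_distrD[OF ev(2)])
  have S [measurable]: "barycenters d A\<^sub>0 A\<^sub>1 t \<in> sets ?B"
    by (intro sets_borel_of_closedin closedin_barycenters[OF fms geo t] A)
  have prob: "prob_space (interpolant d P t)"
    unfolding interpolant_def by (intro P.prob_space_distr ev)
  \<comment> \<open>The plan is a measure on geodesics: almost every one starts in
    \<open>A\<^sub>0\<close> and ends in \<open>A\<^sub>1\<close>, so its point at time t is a
    barycenter.\<close>
  have AEt: "AE \<gamma> in P. \<gamma> t \<in> barycenters d A\<^sub>0 A\<^sub>1 t"
    using ae0 ae1 AE_space by eventually_elim (auto simp: barycenters_def spP)
  have "emeasure (interpolant d P t) (UNIV - barycenters d A\<^sub>0 A\<^sub>1 t) =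
      emeasure P {\<gamma> \<in> space P. \<gamma> t \<notin> barycenters d A\<^sub>0 A\<^sub>1 t}"
    unfolding interpolant_def using sets.compl_sets[OF S]
    by (subst emeasure_distr) (auto intro!: arg_cong2[where f=emeasure])
  also have "\<dots> = 0" using AEt by (intro emeasure_eq_0_AE) auto
  finally have conc: "emeasure (interpolant d P t) (space \<nu> - barycenters d A\<^sub>0 A\<^sub>1 t) = 0"
    by (simp add: space\<nu>)
  have pair [measurable]: "(\<lambda>\<gamma>. (\<gamma> 0, \<gamma> 1)) \<in> P \<rightarrow>\<^sub>M ?B \<Otimes>\<^sub>M ?B" by measurable
  have "emeasure (endpoint_plan d P) (space ?B \<times> (space ?B - A\<^sub>1)) = emeasure P {\<gamma> \<in> space P. \<gamma> 1 \<notin> A\<^sub>1}"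
    unfolding endpoint_plan_def
    using compl by (subst emeasure_distr)
      (auto intro!: arg_cong2[where f=emeasure] pair_measureI sets_borel_of_openin)
  also have "\<dots> = 0" using ae1 by (intro emeasure_eq_0_AE) auto
  finally have n1: "emeasure (endpoint_plan d P) (space ?B \<times> (space ?B - A\<^sub>1)) = 0" .
  \<comment> \<open>The swapped plan is the law of the exchanged endpoints, so its kernels are
    carried by \<open>A\<^sub>0\<close>.\<close>
  have "swap_plan d (endpoint_plan d P) = distr P (?B \<Otimes>\<^sub>M ?B) (\<lambda>\<gamma>. (\<gamma> 1, \<gamma> 0))"
    unfolding swap_plan_def endpoint_plan_def by (subst distr_distr) (auto simp: o_def)
  then have "emeasure (swap_plan d (endpoint_plan d P)) (space ?B \<times> (space ?B - A\<^sub>0))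
      = emeasure P {\<gamma> \<in> space P. \<gamma> 0 \<notin> A\<^sub>0}"
    using compl by (simp, subst emeasure_distr)
      (auto intro!: arg_cong2[where f=emeasure] pair_measureI sets_borel_of_openin)
  also have "\<dots> = 0" using ae0 by (intro emeasure_eq_0_AE) auto
  finally have n0: "emeasure (swap_plan d (endpoint_plan d P)) (space ?B \<times> (space ?B - A\<^sub>0)) = 0" .
  show thesis
  proof (rule that[OF prob _ conc])
    show "sets (interpolant d P t) = sets \<nu>" by (simp add: interpolant_def \<nu>_sets)
    show "AE x in \<mu>\<^sub>0. prob_space (\<kappa> x) \<and> (AE y in \<kappa> x. y \<in> A\<^sub>1)"
      using \<mu>\<^sub>0(2) \<nu>_sets n1 by (intro disintegrates_AE_prob_space[OF dis]) auto
    show "AE x in \<mu>\<^sub>1. prob_space (\<kappa>' x) \<and> (AE y in \<kappa>' x. y \<in> A\<^sub>0)"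
      using \<mu>\<^sub>1(2) \<nu>_sets n0 by (intro disintegrates_AE_prob_space[OF dis']) auto
  qed (use ineq t in auto)
qed

text \<open>Whether N is exceptional depends only on K, N and the diameter, which reversal
  preserves. The swapped term can then be read as an unswapped one for the reversed distance, while
  measure and Borel sets stay those of \<open>d\<close>.\<close>

lemma cd_value_swap: "cd_value (\<lambda>x y. d y x) K N F = cd_value d K N F"
proof -
  have "(SUP (x, y)\<in>UNIV. ereal (d y x)) = (SUP (x, y)\<in>UNIV. ereal (d x y))"
    by (rule SUP_eq) (auto intro: bexI[of _ "(_, _)"])
  then show ?thesis unfolding cd_value_def exceptional_def by simp
qed

lemma beta_swap: "beta d K N s y x = beta (\<lambda>x y. d y x) K N s x y"
proof -
  have "beta_fin d K N' s y x = beta_fin (\<lambda>x y. d y x) K N' s x y" for N'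
    by (auto simp: beta_fin_def)
  then show ?thesis by (simp only: beta_def)
qed

lemma irreversible_metric_swap: "irreversible_metric d \<Longrightarrow> irreversible_metric (\<lambda>x y. d y x)"
  unfolding irreversible_metric_def by (metis add.commute)

text \<open>Infinite coefficients make the terms on the right -\<infinity>. Both upper bounds are
  nonpositive, so their sum is never of the form \<infinity> - \<infinity>, and the inequality can
  be negated back into [0,\<infinity>].\<close>

lemma ereal_convex_combination_neg_le:
  assumes "a \<le> - enn2ereal x" "b \<le> - enn2ereal y" "0 < t" "t < 1"
    and "- enn2ereal z \<le> ereal (1 - t) * a + ereal t * b"
  shows "ennreal (1 - t) * x + ennreal t * y \<le> z"
proof -
  have "ereal (1 - t) * a + ereal t * b \<le> ereal (1 - t) * - enn2ereal x + ereal t * - enn2ereal y"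
    using assms by (intro add_mono ereal_mult_left_mono) auto
  also have "\<dots> = - enn2ereal (ennreal (1 - t) * x + ennreal t * y)"
    using assms(3,4)
    by (cases x rule: ennreal_cases; cases y rule: ennreal_cases)
       (auto simp: enn2ereal_ennreal ennreal_mult_top ennreal_mult[symmetric] ennreal_plus[symmetric]
         simp del: ennreal_plus)
  finally have "- enn2ereal z \<le> - enn2ereal (ennreal (1 - t) * x + ennreal t * y)"
    using assms(5) by (rule order_trans[rotated])
  then show ?thesis by (simp add: less_eq_ennreal.rep_eq)
qed

section \<open>Measurability and test measures in a weak CD space\<close>

context
  fixes d :: "'a \<Rightarrow> 'a \<Rightarrow> real" and \<nu> :: "'a measure" and K :: real and N :: ereal
  assumes CD: "weak_CD K N d \<nu>"
begin

lemma weak_CD_sets: "sets \<nu> = sets (fborel d)" and weak_CD_sigma_finite: "sigma_finite_measure \<nu>"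
  and weak_CD_forward_metric: "forward_metric_space d"
  using CD unfolding weak_CD_def forward_geodesic_space_def by auto

lemma weak_CD_space: "space \<nu> = UNIV"
  using sets_eq_imp_space_eq[OF weak_CD_sets] forward_metric_space_topspace[OF weak_CD_forward_metric] by simp

lemma weak_CD_irreversible: "irreversible_metric d"
  using weak_CD_forward_metric by (simp add: forward_metric_space_def)

lemma weak_CD_compact:
  assumes "compactin (forward_topology d) A"
  shows "A \<in> sets \<nu>" and "emeasure \<nu> A \<noteq> \<infinity>"
proof -
  show "A \<in> sets \<nu>"
    using compactin_forward_imp_closedin[OF weak_CD_forward_metric assms]
    by (simp add: weak_CD_sets sets_borel_of_closedin)
  have "locally_finite_measure (forward_topology d) \<nu>" using CD by (simp add: weak_CD_def)
  then show "emeasure \<nu> A \<noteq> \<infinity>"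
    using assms weak_CD_sets by (rule emeasure_compactin_finite)
qed

lemma weak_CD_barycenters:
  assumes "compactin (forward_topology d) A" "compactin (forward_topology d) B" "0 < t" "t < 1"
  shows "barycenters d A B t \<in> sets \<nu>"
  using CD assms unfolding weak_CD_sets weak_CD_def
  by (auto intro!: sets_borel_of_closedin closedin_barycenters simp: forward_geodesic_space_def)

text \<open>For a null set \<open>A\<close> a Dirac measure serves as well: functionals with zero slope at infinity
  do not see the singular part.\<close>

lemma ex_test_measure:
  assumes A: "compactin (forward_topology d) A" "A \<noteq> {}"
  obtains \<mu> where "prob_space \<mu>" "sets \<mu> = sets \<nu>" "emeasure \<mu> (UNIV - A) = 0"
    "emeasure \<nu> A \<noteq> 0 \<Longrightarrow> \<mu> = uniform_measure \<nu> A"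
proof (cases "emeasure \<nu> A = 0")
  case True
  obtain x where x: "x \<in> A" using A(2) by blast
  have "UNIV - A \<in> sets \<nu>" using sets.compl_sets[OF weak_CD_compact(1)[OF A(1)]] by (simp add: weak_CD_space)
  then show ?thesis
    using x True by (intro that[of "return \<nu> x"])
      (auto intro!: prob_space_return simp: weak_CD_space emeasure_return)
next
  case False
  note fin = weak_CD_compact(2)[OF A(1)]
  have "UNIV - A \<in> sets \<nu>" using sets.compl_sets[OF weak_CD_compact(1)[OF A(1)]] by (simp add: weak_CD_space)
  then have "emeasure (uniform_measure \<nu> A) (UNIV - A) = 0"
    using weak_CD_compact(1)[OF A(1)] by (simp add: emeasure_uniform_measure)
  then show ?thesis
    using False fin by (intro that[of "uniform_measure \<nu> A"]) (auto intro!: prob_space_uniform_measure)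
qed

end

context
  fixes d :: "'a \<Rightarrow> 'a \<Rightarrow> real" and \<nu> :: "'a measure" and K t :: real and N :: ereal and A\<^sub>0 A\<^sub>1 :: "'a set"
  assumes N1: "1 \<le> N" and CD: "weak_CD K N d \<nu>"
    and A0: "compactin (forward_topology d) A\<^sub>0" "A\<^sub>0 \<noteq> {}" "A\<^sub>0 \<subseteq> msupport (forward_topology d) \<nu>"
    and A1: "compactin (forward_topology d) A\<^sub>1" "A\<^sub>1 \<noteq> {}" "A\<^sub>1 \<subseteq> msupport (forward_topology d) \<nu>"
    and t: "0 < t" "t < 1"
begin

text \<open>Arbitrary lower bounds stand in place of the infima, so that the bound 1 for K \<ge> 0
  is covered too. The exponent \<open>M\<close> may exceed N, which is what N = 1 calls for.\<close>

lemma brunn_minkowski_exponent: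
  assumes N: "N < \<infinity>" and M: "1 < M" "real_of_ereal N \<le> M"
    and I: "\<And>x y. x \<in> A\<^sub>0 \<Longrightarrow> y \<in> A\<^sub>1 \<Longrightarrow> I\<^sub>0 \<le> beta d K N (1 - t) x y"
           "\<And>x y. x \<in> A\<^sub>0 \<Longrightarrow> y \<in> A\<^sub>1 \<Longrightarrow> I\<^sub>1 \<le> beta d K N t x y"
  shows "ennreal (1 - t) * (ennpowr I\<^sub>0 (1 / M) * ennpowr (emeasure \<nu> A\<^sub>0) (1 / M))
      + ennreal t * (ennpowr I\<^sub>1 (1 / M) * ennpowr (emeasure \<nu> A\<^sub>1) (1 / M))
    \<le> ennpowr (emeasure \<nu> (barycenters d A\<^sub>0 A\<^sub>1 t)) (1 / M)"
proof -
  obtain \<mu>\<^sub>0 where \<mu>0: "prob_space \<mu>\<^sub>0" "sets \<mu>\<^sub>0 = sets \<nu>" "emeasure \<mu>\<^sub>0 (UNIV - A\<^sub>0) = 0"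
    "emeasure \<nu> A\<^sub>0 \<noteq> 0 \<Longrightarrow> \<mu>\<^sub>0 = uniform_measure \<nu> A\<^sub>0"
    using ex_test_measure[OF CD A0(1,2)] by blast
  obtain \<mu>\<^sub>1 where \<mu>1: "prob_space \<mu>\<^sub>1" "sets \<mu>\<^sub>1 = sets \<nu>" "emeasure \<mu>\<^sub>1 (UNIV - A\<^sub>1) = 0"
    "emeasure \<nu> A\<^sub>1 \<noteq> 0 \<Longrightarrow> \<mu>\<^sub>1 = uniform_measure \<nu> A\<^sub>1"
    using ex_test_measure[OF CD A1(1,2)] by blast
  obtain \<mu> \<kappa> \<kappa>' where \<mu>: "prob_space \<mu>" "sets \<mu> = sets \<nu>"
    "emeasure \<mu> (space \<nu> - barycenters d A\<^sub>0 A\<^sub>1 t) = 0"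
    and \<kappa>: "AE x in \<mu>\<^sub>0. prob_space (\<kappa> x) \<and> (AE y in \<kappa> x. y \<in> A\<^sub>1)"
    and \<kappa>': "AE x in \<mu>\<^sub>1. prob_space (\<kappa>' x) \<and> (AE y in \<kappa>' x. y \<in> A\<^sub>0)"
    and U: "\<And>U. U \<in> DC N \<Longrightarrow> U_functional U \<nu> \<mu> \<le>
      ereal (1 - t) * cd_value d K N (\<lambda>N'. U_beta_functional U \<nu> (beta d K N' (1 - t)) \<kappa> \<mu>\<^sub>0)
      + ereal t * cd_value d K N (\<lambda>N'. U_beta_functional U \<nu> (\<lambda>x y. beta d K N' t y x) \<kappa>' \<mu>\<^sub>1)"
    using weak_CD_inequality[OF CD t A0(1,3) A1(1,3) \<mu>0(1-3) \<mu>1(1-3)] by blast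
  obtain x y x' y' where xy: "x \<in> A\<^sub>0" "y \<in> A\<^sub>1" "x' \<in> A\<^sub>0" "y' \<in> A\<^sub>1"
    and ext: "\<forall>u\<in>A\<^sub>0. \<forall>v\<in>A\<^sub>1. d x y \<le> d u v \<and> d u v \<le> d x' y'"
    using dist_attains_inf_sup[OF weak_CD_forward_metric[OF CD] A0(1) A1(1) A0(2) A1(2)] by blast
  let ?V0 = "cd_value d K N (\<lambda>N'. U_beta_functional (neg_powr M) \<nu> (beta d K N' (1 - t)) \<kappa> \<mu>\<^sub>0)"
  let ?V1 = "cd_value d K N (\<lambda>N'. U_beta_functional (neg_powr M) \<nu> (\<lambda>x y. beta d K N' t y x) \<kappa>' \<mu>\<^sub>1)"
  have V0: "?V0 \<le> - enn2ereal (ennpowr I\<^sub>0 (1 / M) * ennpowr (emeasure \<nu> A\<^sub>0) (1 / M))"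
  proof (rule cd_value_neg_powr_le[OF weak_CD_irreversible[OF CD] weak_CD_sigma_finite[OF CD]
        weak_CD_compact[OF CD A0(1)] prob_space.finite_measure[OF \<mu>0(1)] \<mu>0(2) \<mu>0(4) \<kappa> _ _ N1 N M(1) xy ext])
    show "I\<^sub>0 \<le> beta d K N (1 - t) x y" if "x \<in> A\<^sub>0" "y \<in> A\<^sub>1" for x y
      using that by (rule I(1))
  qed (use t in simp_all)
  have V1: "?V1 \<le> - enn2ereal (ennpowr I\<^sub>1 (1 / M) * ennpowr (emeasure \<nu> A\<^sub>1) (1 / M))"
    unfolding beta_swap[of d] cd_value_swap[of d, symmetric]
  proof (rule cd_value_neg_powr_le[OF irreversible_metric_swap[OF weak_CD_irreversible[OF CD]]
        weak_CD_sigma_finite[OF CD] weak_CD_compact[OF CD A1(1)] prob_space.finite_measure[OF \<mu>1(1)]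
        \<mu>1(2) \<mu>1(4) \<kappa>' t N1 N M(1) xy(2,1) xy(4,3)])
    show "\<forall>v\<in>A\<^sub>1. \<forall>u\<in>A\<^sub>0. d x y \<le> d u v \<and> d u v \<le> d x' y'" using ext by blast
    show "I\<^sub>1 \<le> beta (\<lambda>x y. d y x) K N t y x" if "y \<in> A\<^sub>1" "x \<in> A\<^sub>0" for x y
      unfolding beta_swap[of d K N t x y, symmetric] using that(2,1) by (rule I(2))
  qed
  have le: "- enn2ereal (\<integral>\<^sup>+x. ennreal (ac_density \<nu> \<mu> x powr (1 - 1 / M)) \<partial>\<nu>)
      \<le> ereal (1 - t) * ?V0 + ereal t * ?V1"
    using U[OF neg_powr_in_DC[OF M(1) N1 N M(2)]] unfolding U_functional_neg_powr[OF M(1)] .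
  have "ennreal (1 - t) * (ennpowr I\<^sub>0 (1 / M) * ennpowr (emeasure \<nu> A\<^sub>0) (1 / M))
      + ennreal t * (ennpowr I\<^sub>1 (1 / M) * ennpowr (emeasure \<nu> A\<^sub>1) (1 / M))
      \<le> (\<integral>\<^sup>+x. ennreal (ac_density \<nu> \<mu> x powr (1 - 1 / M)) \<partial>\<nu>)"
    by (rule ereal_convex_combination_neg_le[OF V0 V1 t le])
  also have "\<dots> \<le> ennpowr (emeasure \<nu> (barycenters d A\<^sub>0 A\<^sub>1 t)) (1 / M)"
    by (intro powr_integral_le_ennpowr weak_CD_sigma_finite[OF CD] \<mu> weak_CD_barycenters[OF CD A0(1) A1(1) t] M)
  finally show ?thesis .
qed

lemma brunn_minkowski_finite_dim:
  assumes N: "N < \<infinity>"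
    and I: "\<And>x y. x \<in> A\<^sub>0 \<Longrightarrow> y \<in> A\<^sub>1 \<Longrightarrow> I\<^sub>0 \<le> beta d K N (1 - t) x y"
           "\<And>x y. x \<in> A\<^sub>0 \<Longrightarrow> y \<in> A\<^sub>1 \<Longrightarrow> I\<^sub>1 \<le> beta d K N t x y"
  shows "ennreal (1 - t) * ennpowr I\<^sub>0 (1 / real_of_ereal N) * ennpowr (emeasure \<nu> A\<^sub>0) (1 / real_of_ereal N)
      + ennreal t * ennpowr I\<^sub>1 (1 / real_of_ereal N) * ennpowr (emeasure \<nu> A\<^sub>1) (1 / real_of_ereal N)
    \<le> ennpowr (emeasure \<nu> (barycenters d A\<^sub>0 A\<^sub>1 t)) (1 / real_of_ereal N)"
proof (cases "N = 1")
  case False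
  then have "1 < real_of_ereal N" using N N1 by (cases N) (auto simp: one_ereal_def)
  then show ?thesis
    using brunn_minkowski_exponent[OF N _ _ I, of "real_of_ereal N"] by (simp add: mult.assoc)
next
  case True
  \<comment> \<open>Coefficient and measure are merged under one power: a product of two limits in
    [0,\<infinity>] would be problematic at \<infinity> * 0.\<close>
  let ?L = "\<lambda>M. ennreal (1 - t) * ennpowr (I\<^sub>0 * emeasure \<nu> A\<^sub>0) (1 / M)
      + ennreal t * ennpowr (I\<^sub>1 * emeasure \<nu> A\<^sub>1) (1 / M)"
  have "?L 1 \<le> ennpowr (emeasure \<nu> (barycenters d A\<^sub>0 A\<^sub>1 t)) (1 / 1)"
  proof (rule tendsto_le)
    show "(?L \<longlongrightarrow> ?L 1) (at_right 1)"
      by (intro tendsto_add ennreal_tendsto_cmult) (use tendsto_ennpowr_inverse in \<open>simp_all\<close>)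
    show "((\<lambda>M. ennpowr (emeasure \<nu> (barycenters d A\<^sub>0 A\<^sub>1 t)) (1 / M)) \<longlongrightarrow>
        ennpowr (emeasure \<nu> (barycenters d A\<^sub>0 A\<^sub>1 t)) (1 / 1)) (at_right 1)"
      using tendsto_ennpowr_inverse by simp
    have "eventually (\<lambda>M. (1::real) < M) (at_right 1)" by (simp add: eventually_at_filter)
    then show "eventually (\<lambda>M. ?L M \<le> ennpowr (emeasure \<nu> (barycenters d A\<^sub>0 A\<^sub>1 t)) (1 / M)) (at_right 1)"
    proof eventually_elim
      case (elim M)
      then show ?case
        using brunn_minkowski_exponent[OF N _ _ I, of M] True by (simp add: ennpowr_mult)
    qed
  qed simp
  then show ?thesis using True by (simp add: ennpowr_mult mult.assoc)
qed

text \<open>The number \<open>q\<close> carries the sign of K, so the two curvature signs need no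
  separate treatment. Positive masses allow uniform distributions at both ends.\<close>

lemma brunn_minkowski_infinite_dim:
  assumes N: "N = \<infinity>" and q: "\<And>x y. x \<in> A\<^sub>0 \<Longrightarrow> y \<in> A\<^sub>1 \<Longrightarrow> q \<le> K * (d x y)\<^sup>2"
    and pos: "emeasure \<nu> A\<^sub>0 \<noteq> 0" "emeasure \<nu> A\<^sub>1 \<noteq> 0"
    and fin: "emeasure \<nu> (barycenters d A\<^sub>0 A\<^sub>1 t) \<noteq> \<infinity>"
  shows "emeasure \<nu> (barycenters d A\<^sub>0 A\<^sub>1 t) \<noteq> 0"
    and "- ln (measure \<nu> (barycenters d A\<^sub>0 A\<^sub>1 t)) \<le>
      (1 - t) * - ln (measure \<nu> A\<^sub>0) + t * - ln (measure \<nu> A\<^sub>1) - t * (1 - t) / 2 * q"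
proof -
  obtain \<mu>\<^sub>0 where \<mu>0: "prob_space \<mu>\<^sub>0" "sets \<mu>\<^sub>0 = sets \<nu>" "emeasure \<mu>\<^sub>0 (UNIV - A\<^sub>0) = 0"
    "\<mu>\<^sub>0 = uniform_measure \<nu> A\<^sub>0"
    using ex_test_measure[OF CD A0(1,2)] pos by blast
  obtain \<mu>\<^sub>1 where \<mu>1: "prob_space \<mu>\<^sub>1" "sets \<mu>\<^sub>1 = sets \<nu>" "emeasure \<mu>\<^sub>1 (UNIV - A\<^sub>1) = 0"
    "\<mu>\<^sub>1 = uniform_measure \<nu> A\<^sub>1"
    using ex_test_measure[OF CD A1(1,2)] pos by blast
  obtain \<mu> \<kappa> \<kappa>' where \<mu>: "prob_space \<mu>" "sets \<mu> = sets \<nu>"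
    "emeasure \<mu> (space \<nu> - barycenters d A\<^sub>0 A\<^sub>1 t) = 0"
    and \<kappa>: "AE x in \<mu>\<^sub>0. prob_space (\<kappa> x) \<and> (AE y in \<kappa> x. y \<in> A\<^sub>1)"
    and \<kappa>': "AE x in \<mu>\<^sub>1. prob_space (\<kappa>' x) \<and> (AE y in \<kappa>' x. y \<in> A\<^sub>0)"
    and U: "\<And>U. U \<in> DC N \<Longrightarrow> U_functional U \<nu> \<mu> \<le>
      ereal (1 - t) * cd_value d K N (\<lambda>N'. U_beta_functional U \<nu> (beta d K N' (1 - t)) \<kappa> \<mu>\<^sub>0)
      + ereal t * cd_value d K N (\<lambda>N'. U_beta_functional U \<nu> (\<lambda>x y. beta d K N' t y x) \<kappa>' \<mu>\<^sub>1)"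
    using weak_CD_inequality[OF CD t A0(1,3) A1(1,3) \<mu>0(1-3) \<mu>1(1-3)] by blast
  let ?U = "\<lambda>r::real. r * ln r"
  \<comment> \<open>Stated for general sets and coefficients exp v, so that it applies at both ends
    with the roles of the sets exchanged.\<close>
  have bound: "U_beta_functional ?U \<nu> b k (uniform_measure \<nu> A) \<le> ereal (- ln (measure \<nu> A) - w)"
    if A: "compactin (forward_topology d) A" "emeasure \<nu> A \<noteq> 0"
      and k: "AE x in uniform_measure \<nu> A. prob_space (k x) \<and> (AE y in k x. y \<in> B)"
      and b: "\<And>x y. b x y = ennreal (exp (v x y))"
      and w: "\<And>x y. x \<in> A \<Longrightarrow> y \<in> B \<Longrightarrow> w \<le> v x y" for A B k b v w
  proof -
    note A' = weak_CD_compact[OF CD A(1)]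
    note m = emeasure_eq_pos_measure[OF A(2) A'(2)]
    let ?m = "measure \<nu> A"
    note dec = uniform_measure_decomposition[OF weak_CD_sigma_finite[OF CD] A'(1) A(2) A'(2)]
    have k': "AE x in \<nu>. x \<in> A \<longrightarrow> prob_space (k x) \<and> (AE y in k x. y \<in> B)"
      using k A'(1) m by (subst (asm) AE_uniform_measure) auto
    have "iterated_integral \<nu> k (\<lambda>x y. U_distorted ?U (ac_density \<nu> (uniform_measure \<nu> A) x) (b x y))
        \<le> ereal (1 / ?m * (- ln ?m - w) * ?m)"
    proof (rule iterated_integral_le[OF A'])
      show "AE x in \<nu>. x \<in> A \<longrightarrow> prob_space (k x) \<and> (AE y in k x.
          U_distorted ?U (ac_density \<nu> (uniform_measure \<nu> A) x) (b x y) \<le> ereal (1 / ?m * (- ln ?m - w)))"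
        using k' dec(2)
      proof (eventually_elim, intro impI conjI)
        fix x assume x: "x \<in> A \<longrightarrow> prob_space (k x) \<and> (AE y in k x. y \<in> B)"
          "ac_density \<nu> (uniform_measure \<nu> A) x = indicat_real A x / ?m" "x \<in> A"
        then have r: "ac_density \<nu> (uniform_measure \<nu> A) x = 1 / ?m" by simp
        have "AE y in k x. y \<in> B" using x by simp
        then show "AE y in k x. U_distorted ?U (ac_density \<nu> (uniform_measure \<nu> A) x) (b x y)
            \<le> ereal (1 / ?m * (- ln ?m - w))"
        proof eventually_elim
          case (elim y)
          \<comment> \<open>U(r/b) b = r ln (r/b): the coefficient enters only through its logarithm
            \<open>v\<close>.\<close>
          have "1 / ?m / exp (v x y) * ln (1 / ?m / exp (v x y)) * exp (v x y) = 1 / ?m * (- ln ?m - v x y)"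
            using m(2) by (simp add: ln_div ln_mult field_simps)
          also have "\<dots> \<le> 1 / ?m * (- ln ?m - w)"
            using m(2) w[OF x(3) elim] by (intro mult_left_mono) auto
          finally show ?case unfolding r b U_distorted_def by simp
        qed
      qed (auto)
      show "AE x in \<nu>. x \<notin> A \<longrightarrow>
          (\<forall>y. U_distorted ?U (ac_density \<nu> (uniform_measure \<nu> A) x) (b x y) = 0)"
        using dec(2) by eventually_elim (simp add: U_distorted_def b)
    qed
    then show ?thesis
      unfolding U_beta_functional_def dec(1) using m(2) by (simp add: zero_ennreal.rep_eq)
  qed
  have 1: "cd_value d K N (\<lambda>N'. U_beta_functional ?U \<nu> (beta d K N' (1 - t)) \<kappa> \<mu>\<^sub>0)
      \<le> ereal (- ln (measure \<nu> A\<^sub>0) - q / 6 * (1 - (1 - t)\<^sup>2))"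
  proof -
    have le: "0 \<le> 1 - (1 - t)\<^sup>2" using t by (simp add: power_le_one)
    have "q / 6 * (1 - (1 - t)\<^sup>2) \<le> K / 6 * (1 - (1 - t)\<^sup>2) * (d x y)\<^sup>2"
      if "x \<in> A\<^sub>0" "y \<in> A\<^sub>1" for x y
      using divide_right_mono[OF mult_right_mono[OF q[OF that] le], of 6] by (simp add: mult.commute mult.left_commute)
    then have "U_beta_functional ?U \<nu> (beta d K \<infinity> (1 - t)) \<kappa> (uniform_measure \<nu> A\<^sub>0)
        \<le> ereal (- ln (measure \<nu> A\<^sub>0) - q / 6 * (1 - (1 - t)\<^sup>2))"
      using t by (intro bound[OF A0(1) pos(1) \<kappa>[unfolded \<mu>0(4)], where v = "\<lambda>x y. K / 6 * (1 - (1 - t)\<^sup>2) * (d x y)\<^sup>2"])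
        (simp_all add: beta_infinity[OF weak_CD_irreversible[OF CD]])
    then show ?thesis by (simp add: \<mu>0(4) N cd_value_def exceptional_def)
  qed
  have 2: "cd_value d K N (\<lambda>N'. U_beta_functional ?U \<nu> (\<lambda>x y. beta d K N' t y x) \<kappa>' \<mu>\<^sub>1)
      \<le> ereal (- ln (measure \<nu> A\<^sub>1) - q / 6 * (1 - t\<^sup>2))"
  proof -
    have le: "0 \<le> 1 - t\<^sup>2" using t by (simp add: power_le_one)
    have "q / 6 * (1 - t\<^sup>2) \<le> K / 6 * (1 - t\<^sup>2) * (d x y)\<^sup>2"
      if "x \<in> A\<^sub>0" "y \<in> A\<^sub>1" for x y
      using divide_right_mono[OF mult_right_mono[OF q[OF that] le], of 6] by (simp add: mult.commute mult.left_commute)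
    then have "U_beta_functional ?U \<nu> (\<lambda>x y. beta d K \<infinity> t y x) \<kappa>' (uniform_measure \<nu> A\<^sub>1)
        \<le> ereal (- ln (measure \<nu> A\<^sub>1) - q / 6 * (1 - t\<^sup>2))"
      using t by (intro bound[OF A1(1) pos(2) \<kappa>'[unfolded \<mu>1(4)], where v = "\<lambda>x y. K / 6 * (1 - t\<^sup>2) * (d y x)\<^sup>2"])
        (simp_all add: beta_infinity[OF weak_CD_irreversible[OF CD]])
    then show ?thesis by (simp add: \<mu>1(4) N cd_value_def exceptional_def)
  qed
  have "U_functional ?U \<nu> \<mu> \<le>
      ereal (1 - t) * ereal (- ln (measure \<nu> A\<^sub>0) - q / 6 * (1 - (1 - t)\<^sup>2))
      + ereal t * ereal (- ln (measure \<nu> A\<^sub>1) - q / 6 * (1 - t\<^sup>2))"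
    using 1 2 t by (intro order_trans[OF U] add_mono ereal_mult_left_mono) (simp_all add: N mult_ln_in_DC)
  \<comment> \<open>The constant arises from (1-t)(1-(1-t)^2) + t(1-t^2) = 3t(1-t), divided by
    6.\<close>
  also have "\<dots> = ereal ((1 - t) * - ln (measure \<nu> A\<^sub>0) + t * - ln (measure \<nu> A\<^sub>1) - t * (1 - t) / 2 * q)"
    by (simp add: power2_eq_square field_simps)
  finally have le: "U_functional ?U \<nu> \<mu> \<le>
      ereal ((1 - t) * - ln (measure \<nu> A\<^sub>0) + t * - ln (measure \<nu> A\<^sub>1) - t * (1 - t) / 2 * q)" .
  note ent = entropy_lower_bound[OF weak_CD_sigma_finite[OF CD] \<mu>(1,2) weak_CD_barycenters[OF CD A0(1) A1(1) t] \<mu>(3) fin le]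
  show "emeasure \<nu> (barycenters d A\<^sub>0 A\<^sub>1 t) \<noteq> 0" by (rule ent(1))
  show "- ln (measure \<nu> (barycenters d A\<^sub>0 A\<^sub>1 t)) \<le>
      (1 - t) * - ln (measure \<nu> A\<^sub>0) + t * - ln (measure \<nu> A\<^sub>1) - t * (1 - t) / 2 * q"
    by (rule ent(2))
qed

end

lemma ennlog_inverse_emeasure:
  assumes "emeasure M A \<noteq> 0" "emeasure M A \<noteq> \<infinity>"
  shows "ennlog (1 / emeasure M A) = ereal (- ln (measure M A))"
  using emeasure_eq_pos_measure[OF assms]
  by (simp add: ennlog_def divide_ennreal[of 1, simplified] ln_div)

theorem theorem5p12:
  fixes d :: "'a \<Rightarrow> 'a \<Rightarrow> real" and \<nu> :: "'a measure"
    and K t :: real and N :: ereal and A\<^sub>0 A\<^sub>1 :: "'a set"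
  assumes "1 \<le> N"
    and "weak_CD K N d \<nu>"
    and "compactin (forward_topology d) A\<^sub>0" and "A\<^sub>0 \<noteq> {}"
    and "A\<^sub>0 \<subseteq> msupport (forward_topology d) \<nu>"
    and "compactin (forward_topology d) A\<^sub>1" and "A\<^sub>1 \<noteq> {}"
    and "A\<^sub>1 \<subseteq> msupport (forward_topology d) \<nu>"
    and "0 < t" and "t < 1"
  shows "(N < \<infinity> \<longrightarrow>
      ennpowr (emeasure \<nu> (barycenters d A\<^sub>0 A\<^sub>1 t)) (1 / real_of_ereal N)
        \<ge> ennreal (1 - t)
            * (INF (x, y)\<in>A\<^sub>0 \<times> A\<^sub>1. ennpowr (beta d K N (1 - t) x y) (1 / real_of_ereal N))
            * ennpowr (emeasure \<nu> A\<^sub>0) (1 / real_of_ereal N)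
          + ennreal t
            * (INF (x, y)\<in>A\<^sub>0 \<times> A\<^sub>1. ennpowr (beta d K N t x y) (1 / real_of_ereal N))
            * ennpowr (emeasure \<nu> A\<^sub>1) (1 / real_of_ereal N)
      \<and> (0 \<le> K \<longrightarrow>
          ennpowr (emeasure \<nu> (barycenters d A\<^sub>0 A\<^sub>1 t)) (1 / real_of_ereal N)
            \<ge> ennreal (1 - t) * ennpowr (emeasure \<nu> A\<^sub>0) (1 / real_of_ereal N)
              + ennreal t * ennpowr (emeasure \<nu> A\<^sub>1) (1 / real_of_ereal N)))
    \<and> (N = \<infinity> \<longrightarrow>
      ennlog (1 / emeasure \<nu> (barycenters d A\<^sub>0 A\<^sub>1 t))
        \<le> ereal (1 - t) * ennlog (1 / emeasure \<nu> A\<^sub>0)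
          + ereal t * ennlog (1 / emeasure \<nu> A\<^sub>1)
          + ereal (t * (1 - t) / 2
              * (- min K 0 * (GREATEST r. r \<in> (\<lambda>(x, y). (d x y)\<^sup>2) ` (A\<^sub>0 \<times> A\<^sub>1))
                 - max K 0 * (LEAST r. r \<in> (\<lambda>(x, y). (d x y)\<^sup>2) ` (A\<^sub>0 \<times> A\<^sub>1)))))"
proof (intro conjI impI)
  let ?n = "real_of_ereal N" and ?S = "barycenters d A\<^sub>0 A\<^sub>1 t"
  note bm = brunn_minkowski_finite_dim[OF assms(1-10)]
  note irr = weak_CD_irreversible[OF assms(2)]
  {
    assume N: "N < \<infinity>"
    then have n: "0 < ?n" using assms(1) by (cases N) (auto simp: one_ereal_def)
    let ?I = "\<lambda>s. INF (x, y)\<in>A\<^sub>0 \<times> A\<^sub>1. ennpowr (beta d K N s x y) (1 / ?n)"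
    \<comment> \<open>The infimum is taken over powers of \<beta>, whereas a bound on \<beta> itself
      is wanted; the N-th power of the infimum is one, and taking its root gives the infimum
      back.\<close>
    have I: "ennpowr (?I s) ?n \<le> beta d K N s x y" if "x \<in> A\<^sub>0" "y \<in> A\<^sub>1" for s x y
    proof -
      have "?I s \<le> ennpowr (beta d K N s x y) (1 / ?n)"
        by (rule INF_lower2[of "(x, y)"]) (use that in auto)
      then have "ennpowr (?I s) ?n \<le> ennpowr (ennpowr (beta d K N s x y) (1 / ?n)) ?n"
        using n by (intro ennpowr_mono) auto
      then show ?thesis using n by (simp add: ennpowr_ennpowr)
    qed
    have I': "ennpowr (ennpowr (?I s) ?n) (1 / ?n) = ?I s" for s
      using n by (simp add: ennpowr_ennpowr)
    show "ennreal (1 - t) * ?I (1 - t) * ennpowr (emeasure \<nu> A\<^sub>0) (1 / ?n)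
        + ennreal t * ?I t * ennpowr (emeasure \<nu> A\<^sub>1) (1 / ?n) \<le> ennpowr (emeasure \<nu> ?S) (1 / ?n)"
      using bm[OF N I I] unfolding I' .
    assume "0 \<le> K"
    then have "1 \<le> beta d K N (1 - t) x y" "1 \<le> beta d K N t x y" for x y
      using assms(1,9,10) N by (auto intro!: beta_ge_1[OF irr])
    from bm[OF N this]
    show "ennreal (1 - t) * ennpowr (emeasure \<nu> A\<^sub>0) (1 / ?n)
        + ennreal t * ennpowr (emeasure \<nu> A\<^sub>1) (1 / ?n) \<le> ennpowr (emeasure \<nu> ?S) (1 / ?n)"
      by (simp add: ennpowr_def[of 1])
  }
  assume N: "N = \<infinity>"
  obtain x y x' y' where xy: "x \<in> A\<^sub>0" "y \<in> A\<^sub>1" "x' \<in> A\<^sub>0" "y' \<in> A\<^sub>1"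
    and ext: "\<forall>u\<in>A\<^sub>0. \<forall>v\<in>A\<^sub>1. d x y \<le> d u v \<and> d u v \<le> d x' y'"
    using dist_attains_inf_sup[OF weak_CD_forward_metric[OF assms(2)] assms(3,6,4,7)] by blast
  let ?D = "(\<lambda>(x, y). (d x y)\<^sup>2) ` (A\<^sub>0 \<times> A\<^sub>1)"
  note nn = irreversible_metricD(1)[OF irr]
  have sq: "(d x y)\<^sup>2 \<le> (d u v)\<^sup>2" "(d u v)\<^sup>2 \<le> (d x' y')\<^sup>2" if "u \<in> A\<^sub>0" "v \<in> A\<^sub>1" for u v
    using ext that nn by (auto intro!: power_mono)
  have least: "(LEAST r. r \<in> ?D) = (d x y)\<^sup>2"
    by (rule Least_equality) (use xy sq in force)+
  have greatest: "(GREATEST r. r \<in> ?D) = (d x' y')\<^sup>2"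
    by (rule Greatest_equality) (use xy sq in force)+
  \<comment> \<open>One of the two factors is 0 and the other is K, so \<open>q\<close> is the
    minimum of K d^2, taken at the largest distance for K < 0 and at the smallest for K \<ge>
    0.\<close>
  define q where "q = min K 0 * (d x' y')\<^sup>2 + max K 0 * (d x y)\<^sup>2"
  have q: "q \<le> K * (d u v)\<^sup>2" if "u \<in> A\<^sub>0" "v \<in> A\<^sub>1" for u v
    using sq[OF that] unfolding q_def by (cases "0 \<le> K") (auto intro: mult_left_mono mult_left_mono_neg)
  have extra: "t * (1 - t) / 2 * (- min K 0 * (d x' y')\<^sup>2 - max K 0 * (d x y)\<^sup>2) = - (t * (1 - t) / 2 * q)"
    by (simp add: q_def algebra_simps)
  note fin = weak_CD_compact(2)[OF assms(2,3)] weak_CD_compact(2)[OF assms(2,6)]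
  show "ennlog (1 / emeasure \<nu> ?S) \<le> ereal (1 - t) * ennlog (1 / emeasure \<nu> A\<^sub>0)
      + ereal t * ennlog (1 / emeasure \<nu> A\<^sub>1)
      + ereal (t * (1 - t) / 2 * (- min K 0 * (GREATEST r. r \<in> ?D) - max K 0 * (LEAST r. r \<in> ?D)))"
  \<comment> \<open>A null set makes its logarithm, and with it the right side, infinite.\<close>
  proof (cases "emeasure \<nu> A\<^sub>0 = 0 \<or> emeasure \<nu> A\<^sub>1 = 0")
    case True
    then have "ennlog (1 / emeasure \<nu> A\<^sub>0) = \<infinity> \<or> ennlog (1 / emeasure \<nu> A\<^sub>1) = \<infinity>"
      by (auto simp: ennlog_def)
    then show ?thesis using assms(9,10) by auto
  next
    case False
    show ?thesis
    proof (cases "emeasure \<nu> ?S = \<infinity>")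
      case True
      then show ?thesis by (simp add: ennlog_def)
    next
      case S: False
      have pos: "emeasure \<nu> A\<^sub>0 \<noteq> 0" "emeasure \<nu> A\<^sub>1 \<noteq> 0" using False by auto
      note bmi = brunn_minkowski_infinite_dim[OF assms(1-10) N q pos S]
      show ?thesis
        using bmi(2) ennlog_inverse_emeasure[OF bmi(1) S]
        unfolding least greatest extra ennlog_inverse_emeasure[OF pos(1) fin(1)]
          ennlog_inverse_emeasure[OF pos(2) fin(2)] by simp
    qed
  qed
qed

end
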